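(* Let $q$ be a prime power and let $\mathbb{F}_{q^2}(\mathscr{H})$ be the function field of the Hermitian curve $\mathscr{H}: X^{q+1}-Y^qZ-YZ^q=0$ over $\mathbb{F}_{q^2}$. For any place $P$ of degree $3$ of $\mathbb{F}_{q^2}(\mathscr{H})$, the Weierstrass gap sequence at $P$ is $$G(P)=\{u(q+1)-v \mid u,v\in\mathbb{Z},\ 0\le v\le q,\ 0<3u\le v\}.$$
   Context: For a place $P$ (of any degree) of a function field $F$ over a finite field, a positive integer $n$ is a gap at $P$ if there is no $f\in F$ whose pole divisor is exactly $nP$. The Weierstrass gap sequence $G(P)$ is the set of all gaps at $P$. *)

theory Defs
  imports
    "HOL-Library.Cardinality"
    "HOL-Computational_Algebra.Polynomial"
    "HOL-Number_Theory.Prime_Powers"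
    "HOL-Algebra.QuotRing"
    "HOL-Algebra.Embedded_Algebras"
begin

section \<open>The function field of a projective plane curve\<close>

text \<open>
  A polynomial in \<open>k[X,Y,Z]\<close> is an element of \<open>k[X][Y][Z]\<close>: the variable \<open>X\<close> is the innermost
  and \<open>Z\<close> the outermost one.
\<close>

type_synonym 'k poly3 = "'k poly poly poly"

definition const3 :: "'k::field \<Rightarrow> 'k poly3" where
  "const3 c = [:[:[:c:]:]:]"

definition varX :: "'k::field poly3" where "varX = [:[:[:0, 1:]:]:]"
definition varY :: "'k::field poly3" where "varY = [:[:0, 1:]:]"
definition varZ :: "'k::field poly3" where "varZ = [:0, 1:]"

text \<open>The zero polynomial is homogeneous of every degree.\<close>

definition homogeneous :: "nat \<Rightarrow> 'k::field poly3 \<Rightarrow> bool" where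
  "homogeneous d p \<longleftrightarrow>
     (\<forall>i j l. Polynomial.coeff (Polynomial.coeff (Polynomial.coeff p l) j) i \<noteq> 0 \<longrightarrow> i + j + l = d)"

text \<open>
  For an irreducible form \<open>H\<close>, the function field of the curve \<open>H = 0\<close> is the degree zero part of
  the localisation of \<open>k[X,Y,Z]/(H)\<close> at its nonzero homogeneous elements: its elements are the
  classes of fractions \<open>a/b\<close> of forms of the same degree with \<open>b\<close> not in \<open>(H)\<close>, where \<open>a/b\<close> and
  \<open>c/d\<close> are identified if \<open>ad - cb\<close> lies in \<open>(H)\<close>.
\<close>

type_synonym 'k curve_function = "('k poly3 \<times> 'k poly3) set"

definition curve_fractions :: "'k::field poly3 \<Rightarrow> ('k poly3 \<times> 'k poly3) set" where
  "curve_fractions H =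
     {(a, b). (\<exists>d. homogeneous d a \<and> homogeneous d b) \<and> \<not> H dvd b}"

definition curve_rel ::
  "'k::field poly3 \<Rightarrow> (('k poly3 \<times> 'k poly3) \<times> ('k poly3 \<times> 'k poly3)) set" where
  "curve_rel H =
     {((a, b), (c, d)). (a, b) \<in> curve_fractions H \<and> (c, d) \<in> curve_fractions H
        \<and> H dvd a * d - c * b}"

definition curve_function_field :: "'k::field poly3 \<Rightarrow> 'k curve_function ring" where
  "curve_function_field H =
     \<lparr>carrier = curve_fractions H // curve_rel H,
      mult = (\<lambda>A B. \<Union>(a, b)\<in>A. \<Union>(c, d)\<in>B. curve_rel H `` {(a * c, b * d)}),
      one = curve_rel H `` {(1, 1)},
      zero = curve_rel H `` {(0, 1)},
      add = (\<lambda>A B. \<Union>(a, b)\<in>A. \<Union>(c, d)\<in>B. curve_rel H `` {(a * d + c * b, b * d)})\<rparr>"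

definition curve_constants :: "'k::field poly3 \<Rightarrow> 'k curve_function set" where
  "curve_constants H = (\<lambda>c. curve_rel H `` {(const3 c, 1)}) ` UNIV"

definition hermitian_form :: "nat \<Rightarrow> 'k::field poly3" where
  "hermitian_form q = varX ^ (q + 1) - varY ^ q * varZ - varY * varZ ^ q"


section \<open>Places, valuations and pole divisors\<close>

text \<open>
  Below, \<open>F\<close> is a function field of one variable over the subfield \<open>K\<close>. As in Stichtenoth's book,
  a place is the maximal ideal of a valuation ring of \<open>F/K\<close>.
\<close>

definition valuation_ring :: "('a, 'b) ring_scheme \<Rightarrow> 'a set \<Rightarrow> 'a set \<Rightarrow> bool" where
  "valuation_ring F K V \<longleftrightarrow>
     subring V F \<and> K \<subset> V \<and> V \<subset> carrier F \<and>
     (\<forall>z \<in> carrier F - {\<zero>\<^bsub>F\<^esub>}. z \<in> V \<or> inv\<^bsub>F\<^esub> z \<in> V)"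

definition place :: "('a, 'b) ring_scheme \<Rightarrow> 'a set \<Rightarrow> 'a set \<Rightarrow> bool" where
  "place F K P \<longleftrightarrow> (\<exists>V. valuation_ring F K V \<and> maximalideal P (F\<lparr>carrier := V\<rparr>))"

text \<open>
  A place determines its valuation ring: a nonzero \<open>z\<close> fails to lie in it exactly if its inverse
  lies in the maximal ideal.
\<close>

definition place_ring :: "('a, 'b) ring_scheme \<Rightarrow> 'a set \<Rightarrow> ('a, 'b) ring_scheme" where
  "place_ring F P = F\<lparr>carrier := {z \<in> carrier F. z = \<zero>\<^bsub>F\<^esub> \<or> inv\<^bsub>F\<^esub> z \<notin> P}\<rparr>"

text \<open>The residue field has degree \<open>n\<close> over (the image of) the field of constants.\<close>

definition has_degree :: "('a, 'b) ring_scheme \<Rightarrow> 'a set \<Rightarrow> 'a set \<Rightarrow> nat \<Rightarrow> bool" where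
  "has_degree F K P n \<longleftrightarrow>
     ring.dimension (place_ring F P Quot P) n
       ((\<lambda>c. P +>\<^bsub>place_ring F P\<^esub> c) ` K) (carrier (place_ring F P Quot P))"

text \<open>
  The normalised discrete valuation: \<open>z = t\<^sup>n u\<close> with \<open>t\<close> a local parameter at \<open>P\<close> and \<open>u\<close> a unit.
  It is only meaningful for nonzero \<open>z\<close>.
\<close>

definition valuation :: "('a, 'b) ring_scheme \<Rightarrow> 'a set \<Rightarrow> 'a \<Rightarrow> int" where
  "valuation F P z =
     (THE n. \<exists>t \<in> carrier (place_ring F P). \<exists>u \<in> Units (place_ring F P).
        P = PIdl\<^bsub>place_ring F P\<^esub> t \<and> z = t [^]\<^bsub>F\<^esub> n \<otimes>\<^bsub>F\<^esub> u)"

text \<open>A divisor is represented by its coefficient function, with value \<open>0\<close> outside the places.\<close>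

definition pole_divisor :: "('a, 'b) ring_scheme \<Rightarrow> 'a set \<Rightarrow> 'a \<Rightarrow> 'a set \<Rightarrow> int" where
  "pole_divisor F K f = (\<lambda>Q. if place F K Q then max 0 (- valuation F Q f) else 0)"

definition multiple_of_place :: "nat \<Rightarrow> 'a set \<Rightarrow> 'a set \<Rightarrow> int" where
  "multiple_of_place n P = (\<lambda>Q. if Q = P then int n else 0)"

text \<open>The zero function is excluded because it has no pole divisor.\<close>

definition gaps :: "('a, 'b) ring_scheme \<Rightarrow> 'a set \<Rightarrow> 'a set \<Rightarrow> nat set" where
  "gaps F K P =
     {n. n > 0 \<and>
        \<not> (\<exists>f \<in> carrier F - {\<zero>\<^bsub>F\<^esub>}. pole_divisor F K f = multiple_of_place n P)}"

end

theory Submission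
  imports Defs "HOL-Algebra.Algebraic_Closure_Type"
begin

text \<open>
  Every place of the function field is the restriction of the order of vanishing at a point of the
  curve over the algebraic closure \<open>K\<close> of \<open>k\<close>, read off from expansions in \<open>K((t))\<close>. The uniformizers
  needed for this come from \<open>g\<^sup>N - g = g(x\<^sup>N, y\<^sup>N) - g(x, y)\<close>. A place of degree three is a triple
  \<open>P\<^sub>0, P\<^sub>1, P\<^sub>2\<close> of Frobenius conjugate points. The tangent \<open>l\<^sub>i\<close> at \<open>P\<^sub>i\<close> meets the curve in
  \<open>q P\<^sub>i + P\<^sub>i\<^sub>+\<^sub>1\<close>, so the cubic form \<open>T = l\<^sub>0 l\<^sub>1 l\<^sub>2\<close> is defined over \<open>k\<close> and has divisor \<open>(q + 1) P\<close>.
  A function with pole divisor \<open>n P\<close>, \<open>n = u (q + 1) - v\<close>, is therefore \<open>F / T\<^sup>u\<close> with \<open>F\<close> of degree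
  \<open>3 u\<close> vanishing to order exactly \<open>v\<close> at each \<open>P\<^sub>i\<close>. If \<open>3 u \<le> v\<close>, then \<open>F\<close> has at least \<open>v + 1\<close> zeros
  on each tangent, so \<open>T\<close> divides \<open>F\<close>, which contradicts \<open>v \<le> q\<close>. If \<open>v < 3 u\<close>, a trace of
  \<open>(x - a)\<^sup>v\<^sup>-\<^sup>1 l\<^sub>1 l\<^sub>2\<close> is such an \<open>F\<close>.
\<close>

hide_const (open) Polynomials.degree Polynomials.lead_coeff
  UnivPoly.coeff UnivPoly.monom UnivPoly.deg Divisibility.prime Module.smult Coset.order

unbundle fps_syntax

section \<open>Polynomials in two variables and ring homomorphisms\<close>

text \<open>A pole divisor ranges over all places, so membership in \<open>gaps\<close> cannot be
  decided before every place is known; this forces the classification of places. Points over the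
  closure make orders readable from coefficients, with Frobenius acting coefficientwise, but local
  parameters must come from k: x - a does not, x^N - x does. Where degrees enter: f T^u is regular
  at all finite points, hence a polynomial in x and y, and at infinity only its pole order, at most
  3u(q + 1), is known. As x and y have pole orders q and q + 1 there, this bounds the degree by 3u,
  except for the monomial x^(q+1) when 3u = q, which the equation of the curve removes. Conversely,
  the trace of (x - a)^(v-1) \<open>l\<^sub>1 l\<^sub>2\<close> has degree at most v + 1, which is
  where v < 3u is used. Degree three enters through the cycle of tangents: \<open>l\<^sub>2\<close>
  has its residual zero at \<open>P\<^sub>0\<close>. It supplies the last order to the product above
  and, together with \<open>l\<^sub>0\<close>, the order q + 1 to T.\<close>

locale cr_hom =
  fixes h :: "'a::comm_ring_1 \<Rightarrow> 'b::comm_ring_1"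
  assumes hom_add: "h (x + y) = h x + h y"
    and hom_mult: "h (x * y) = h x * h y"
    and hom_1: "h 1 = 1"
begin

lemma hom_0: "h 0 = 0"
  using hom_add[of 0 0] by simp

lemma hom_minus: "h (- x) = - h x"
  using hom_add[of x "- x"] hom_0 by (simp add: eq_neg_iff_add_eq_0 add.commute)

lemma hom_diff: "h (x - y) = h x - h y"
  using hom_add[of x "- y"] hom_minus by simp

lemma hom_power: "h (x ^ n) = h x ^ n"
  by (induction n) (auto simp: hom_1 hom_mult)

lemma hom_sum: "h (sum f A) = (\<Sum>i\<in>A. h (f i))"
  by (induction A rule: infinite_finite_induct) (auto simp: hom_0 hom_add)

lemma hom_prod: "h (prod f A) = (\<Prod>i\<in>A. h (f i))"
  by (induction A rule: infinite_finite_induct) (auto simp: hom_1 hom_mult)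

lemmas homs = hom_0 hom_1 hom_add hom_mult hom_minus hom_diff hom_power hom_sum hom_prod

lemma coeff_map: "coeff (map_poly h p) i = h (coeff p i)"
  by (simp add: coeff_map_poly hom_0)

lemma map_poly_cr_hom: "cr_hom (map_poly h)"
proof
  show "map_poly h (p + r) = map_poly h p + map_poly h r" for p r
    by (rule poly_eqI) (simp add: coeff_map hom_add)
  show "map_poly h (p * r) = map_poly h p * map_poly h r" for p r
    by (rule poly_eqI) (simp add: coeff_map coeff_mult hom_sum hom_mult)
  show "map_poly h 1 = 1"
    by (simp add: hom_1)
qed

end

lemma cr_hom_comp: "cr_hom f \<Longrightarrow> cr_hom g \<Longrightarrow> cr_hom (\<lambda>x. f (g x))"
  by (simp add: cr_hom_def)

lemma cr_hom_id: "cr_hom (\<lambda>x. x)"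
  by (simp add: cr_hom_def)

lemma cr_hom_poly: "cr_hom (\<lambda>p. poly p x)"
  by (simp add: cr_hom_def)

lemma cr_hom_to_ac: "cr_hom to_ac"
  by (simp add: cr_hom_def)

lemma cr_hom_fls_const: "cr_hom (fls_const :: 'a::comm_ring_1 \<Rightarrow> _)"
  by (simp add: cr_hom_def fls_plus_const)

lemma cr_hom_const_poly: "cr_hom (\<lambda>c. [:c:])"
  by (simp add: cr_hom_def one_pCons)

definition ev2 :: "('a::comm_ring_1 \<Rightarrow> 'b::comm_ring_1) \<Rightarrow> 'b \<Rightarrow> 'b \<Rightarrow> 'a poly poly \<Rightarrow> 'b" where
  "ev2 h x y g = poly (map_poly (\<lambda>p. poly (map_poly h p) x) g) y"

definition cst2 :: "'a::comm_ring_1 \<Rightarrow> 'a poly poly" where "cst2 c = [:[:c:]:]"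
definition X2 :: "'a::comm_ring_1 poly poly" where "X2 = [:[:0, 1:]:]"
definition Y2 :: "'a::comm_ring_1 poly poly" where "Y2 = [:0, 1:]"

lemma cr_hom_cst2: "cr_hom cst2"
  by (simp add: cr_hom_def cst2_def one_pCons)

lemma cr_hom_ev1: "cr_hom h \<Longrightarrow> cr_hom (\<lambda>p. poly (map_poly h p) x)"
  by (intro cr_hom_comp[OF cr_hom_poly] cr_hom.map_poly_cr_hom)

lemma cr_hom_ev2: "cr_hom h \<Longrightarrow> cr_hom (ev2 h x y)"
  unfolding ev2_def[abs_def] by (intro cr_hom_ev1)

lemma poly2_induct [case_names const X Y add mult]:
  assumes "\<And>c. P (cst2 c)" "P X2" "P Y2"
    and add: "\<And>f g. P f \<Longrightarrow> P g \<Longrightarrow> P (f + g)"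
    and mult: "\<And>f g. P f \<Longrightarrow> P g \<Longrightarrow> P (f * g)"
  shows "P g"
proof -
  have 1: "P [:p:]" for p
  proof (induction p)
    case 0
    then show ?case using assms(1)[of 0] by (simp add: cst2_def)
  next
    case (pCons a p)
    have "[:pCons a p:] = cst2 a + X2 * [:p:]"
      by (simp add: cst2_def X2_def)
    then show ?case using pCons assms by metis
  qed
  show ?thesis
  proof (induction g)
    case 0
    then show ?case using 1[of 0] by simp
  next
    case (pCons a g)
    have "pCons a g = [:a:] + Y2 * g"
      by (simp add: Y2_def)
    then show ?case using pCons assms 1 by metis
  qed
qed

context cr_hom
begin

lemma ev2_cst2: "ev2 h x y (cst2 c) = h c"
  by (simp add: ev2_def cst2_def map_poly_pCons hom_0)

lemma ev2_X2: "ev2 h x y X2 = x"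
  by (simp add: ev2_def X2_def map_poly_pCons hom_0 hom_1)

lemma ev2_Y2: "ev2 h x y Y2 = y"
  by (simp add: ev2_def Y2_def map_poly_pCons hom_0 hom_1)

lemmas ev2_base = ev2_cst2 ev2_X2 ev2_Y2

lemmas ev2_homs = cr_hom.homs[OF cr_hom_ev2[OF cr_hom_axioms]]

text \<open>The universal property of \<open>k[X][Y]\<close>. It identifies a Frobenius power or a
  conjugated expansion by comparing constants and the two coordinates only.\<close>

lemma ev2_unique:
  assumes "cr_hom f" and "\<And>c. f (cst2 c) = h c"
  shows "f g = ev2 h (f X2) (f Y2) g"
proof -
  interpret f: cr_hom f by fact
  show ?thesis
    by (induction g rule: poly2_induct) (auto simp: assms ev2_base ev2_homs f.homs)
qed

end

definition map_poly2 :: "('a::comm_ring_1 \<Rightarrow> 'b::comm_ring_1) \<Rightarrow> 'a poly poly \<Rightarrow> 'b poly poly" where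
  "map_poly2 h = map_poly (map_poly h)"

lemma cr_hom_map2: "cr_hom h \<Longrightarrow> cr_hom (map_poly2 h)"
  unfolding map_poly2_def by (intro cr_hom.map_poly_cr_hom)

context cr_hom
begin

lemma coeff_map2: "coeff (coeff (map_poly2 h g) j) i = h (coeff (coeff g j) i)"
  by (simp add: map_poly2_def coeff_map cr_hom.coeff_map[OF map_poly_cr_hom])

lemma map_poly2_base: "map_poly2 h (cst2 c) = cst2 (h c)" "map_poly2 h X2 = X2" "map_poly2 h Y2 = Y2"
  by (auto simp: map_poly2_def cst2_def X2_def Y2_def map_poly_pCons homs)

lemmas map_poly2_homs = cr_hom.homs[OF cr_hom_map2[OF cr_hom_axioms]]

end

lemma ev2_altdef:
  "ev2 h x y g = (\<Sum>j\<le>degree g. (\<Sum>i\<le>degree (coeff g j). h (coeff (coeff g j) i) * x ^ i) * y ^ j)"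
  if "cr_hom h"
proof -
  interpret cr_hom h by fact
  interpret e: cr_hom "\<lambda>p. poly (map_poly h p) x" using that by (rule cr_hom_ev1)
  have poly_ge: "poly p z = (\<Sum>i\<le>n. coeff p i * z ^ i)" if "degree p \<le> n" for p and z :: 'b and n
    unfolding poly_altdef using that
    by (intro sum.mono_neutral_left) (auto simp: coeff_eq_0)
  show ?thesis unfolding ev2_def
    by (subst poly_ge[OF map_poly_degree_leq], subst e.coeff_map,
        subst poly_ge[OF map_poly_degree_leq], subst coeff_map, rule refl)
qed

lemma dvd_imp_ev2_eq:
  assumes "cr_hom h" "C dvd f - g" "ev2 h x y C = 0"
  shows "ev2 h x y f = ev2 h x y g"
proof -
  interpret cr_hom h by fact
  from assms(2) obtain r where r: "f - g = C * r" by (rule dvdE)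
  have "ev2 h x y (f - g) = 0"
    unfolding r by (simp add: ev2_homs assms(3))
  then show ?thesis by (simp add: ev2_homs)
qed

text \<open>Pseudo-division multiplies the dividend by a power of the leading coefficient. For monic
  \<open>C\<close> this power is 1, so there are remainders although the coefficients form only a
  domain, later \<open>k[x]\<close>.\<close>

lemma monic_division:
  fixes C :: "'a::idom poly"
  assumes "lead_coeff C = 1"
  obtains r where "C dvd g - r" "r = 0 \<or> degree r < degree C"
proof -
  have C: "C \<noteq> 0" using assms by auto
  obtain u r where ur: "pseudo_divmod g C = (u, r)" by fastforce
  from pseudo_divmod[OF C ur] assms have "g = C * u + r" "r = 0 \<or> degree r < degree C"
    by auto
  then show ?thesis using that[of r] by simp
qed

lemma monic_division_unique:
  fixes C :: "'a::idom poly"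
  assumes "C dvd r" "degree r < degree C"
  shows "r = 0"
  using assms by (meson dvd_imp_degree_le leD)

lemma fls_subdegree_pos_iff:
  assumes "F \<noteq> 0" "fls_subdegree F \<ge> 0"
  shows "fls_subdegree F > 0 \<longleftrightarrow> F $$ 0 = 0"
  using assms nth_fls_subdegree_nonzero[OF assms(1)] fls_eq0_below_subdegree[of 0 F]
  by (cases "fls_subdegree F = 0") auto

lemma fps_to_fls_nonpos_nth: "fps_nth s 0 = 0 \<Longrightarrow> n \<le> 0 \<Longrightarrow> fps_to_fls s $$ n = 0"
  by (cases "n = 0") auto

text \<open>Terms of pairwise different order cannot cancel, so the smallest order survives.\<close>

lemma fls_subdegree_sum_distinct:
  fixes f :: "'i \<Rightarrow> 'a::idom fls"
  assumes "finite S" "S \<noteq> {}" "\<And>s. s \<in> S \<Longrightarrow> f s \<noteq> 0"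
    and "inj_on (\<lambda>s. fls_subdegree (f s)) S"
  shows "sum f S \<noteq> 0 \<and> fls_subdegree (sum f S) = Min ((\<lambda>s. fls_subdegree (f s)) ` S)"
  using assms
proof (induction S rule: finite_ne_induct)
  case (singleton x)
  then show ?case by simp
next
  case (insert x F)
  have IH: "sum f F \<noteq> 0" "fls_subdegree (sum f F) = Min ((\<lambda>s. fls_subdegree (f s)) ` F)"
    using insert by (auto simp: inj_on_insert)
  have fin: "finite ((\<lambda>s. fls_subdegree (f s)) ` F)" "(\<lambda>s. fls_subdegree (f s)) ` F \<noteq> {}"
    using insert by auto
  have ne: "fls_subdegree (f x) \<noteq> fls_subdegree (sum f F)"
  proof
    assume "fls_subdegree (f x) = fls_subdegree (sum f F)"
    then have "fls_subdegree (f x) \<in> (\<lambda>s. fls_subdegree (f s)) ` F"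
      using Min_in[OF fin] unfolding IH(2) by simp
    then show False
      using insert.prems(2) insert.hyps by (auto simp: inj_on_def)
  qed
  have fx: "f x \<noteq> 0" using insert by auto
  have sum: "sum f (insert x F) = f x + sum f F" using insert by simp
  have Min: "Min ((\<lambda>s. fls_subdegree (f s)) ` insert x F) = min (fls_subdegree (f x)) (fls_subdegree (sum f F))"
    using fin IH(2) by simp
  show ?case
  proof (cases "fls_subdegree (f x) < fls_subdegree (sum f F)")
    case True
    then have "fls_subdegree (f x + sum f F) = fls_subdegree (f x)" 
      by (intro fls_subdegree_add_eq1 fx)
    moreover have "f x + sum f F \<noteq> 0" using ne
      by (metis add_eq_0_iff fls_uminus_subdegree)
    ultimately show ?thesis unfolding sum Min using True by simp
  next
    case False
    with ne have lt: "fls_subdegree (sum f F) < fls_subdegree (f x)" by simp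
    then have "fls_subdegree (f x + sum f F) = fls_subdegree (sum f F)" 
      by (intro fls_subdegree_add_eq2 IH)
    moreover have "f x + sum f F \<noteq> 0" using ne
      by (metis add_eq_0_iff fls_uminus_subdegree)
    ultimately show ?thesis unfolding sum Min using lt by simp
  qed
qed

section \<open>The constant field and its algebraic closure\<close>

lemma freshman:
  fixes x y :: "'b::comm_ring_1"
  assumes "Factorial_Ring.prime CHAR('b)"
  shows "(x + y) ^ (CHAR('b) ^ n) = x ^ (CHAR('b) ^ n) + y ^ (CHAR('b) ^ n)"
  using freshmans_dream'[OF assms refl] .

lemma card_poly_fixed: "card {z :: 'b::idom. z ^ N = z} \<le> N \<and> finite {z :: 'b. z ^ N = z}" if "N \<ge> 2"
proof -
  let ?p = "monom 1 N - monom 1 1 :: 'b poly"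
  have deg: "degree ?p = N" 
    using that degree_add_eq_left[of "- monom 1 1" "monom 1 N :: 'b poly"] by (simp add: degree_monom_eq)
  then have "?p \<noteq> 0" using that by auto
  moreover have "{z :: 'b. z ^ N = z} = {z. poly ?p z = 0}"
    by (auto simp: poly_monom)
  ultimately show ?thesis
    using card_poly_roots_bound[of ?p] poly_roots_finite[of ?p] deg by auto
qed

lemma periodic_mult: "(z :: 'b::monoid_mult) ^ N = z \<Longrightarrow> z ^ (N ^ n) = z"
  by (induction n) (auto simp: power_mult mult.commute)

locale hermitian =
  fixes q :: nat and ty :: "'k::field itself"
  assumes primepow_q: "primepow q"
    and card_k: "CARD('k) = q ^ 2"
begin

lemma q_ge_2: "q \<ge> 2"
  using primepow_gt_Suc_0[OF primepow_q] by simp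

lemma q_pos: "q > 0"
  using q_ge_2 by simp

lemma finite_k: "finite (UNIV :: 'k set)"
  using card_k q_pos by (intro card_ge_0_finite) simp

lemma prime_char: "Factorial_Ring.prime CHAR('k)"
  using finite_imp_CHAR_pos[OF finite_k] by (rule prime_CHAR_semidom)

text \<open>Translation by 1 permutes the field, so the sum of all elements is unchanged although
  each of the q^2 terms grows by 1.\<close>

lemma of_nat_card: "of_nat (q ^ 2) = (0 :: 'k)"
proof -
  have "(\<Sum>c\<in>(UNIV :: 'k set). c + 1) = (\<Sum>c\<in>(UNIV :: 'k set). c)"
    by (rule sum.reindex_bij_witness[of _ "\<lambda>c. c - 1" "\<lambda>c. c + 1"]) auto
  then show ?thesis
    by (simp add: sum.distrib card_k)
qed

lemma q_char: "\<exists>e. q = CHAR('k) ^ e"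
proof -
  from primepow_q obtain p e where p: "Factorial_Ring.prime p" "q = p ^ e"
    unfolding primepow_def by auto
  have "CHAR('k) dvd q ^ 2"
    using of_nat_card by (simp only: of_nat_eq_0_iff_char_dvd)
  then have "CHAR('k) dvd p"
    using p prime_char by (metis prime_dvd_power)
  then have "CHAR('k) = p"
    using p(1) prime_char by (simp add: primes_dvd_imp_eq)
  with p show ?thesis by auto
qed

lemma frob_add:
  fixes x y :: "'b::comm_ring_1"
  assumes "CHAR('b) = CHAR('k)"
  shows "(x + y) ^ (q ^ n) = x ^ (q ^ n) + y ^ (q ^ n)"
proof -
  obtain e where "q = CHAR('k) ^ e" using q_char by blast
  then show ?thesis
    using freshman[of x y "e * n"] prime_char assms by (simp add: power_mult)
qed

lemma frob_cr_hom:
  assumes "CHAR('b::comm_ring_1) = CHAR('k)"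
  shows "cr_hom (\<lambda>x::'b. x ^ (q ^ n))"
  by standard (simp_all add: frob_add[OF assms] power_mult_distrib)

lemmas frob_diff = cr_hom.hom_diff[OF frob_cr_hom]
lemmas frob_minus = cr_hom.hom_minus[OF frob_cr_hom]
lemmas frob_sum = cr_hom.hom_sum[OF frob_cr_hom]

lemmas frob1_add = frob_add[where n = 1, simplified]
lemmas frob1_diff = frob_diff[where n = 1, simplified]
lemmas frob1_minus = frob_minus[where n = 1, simplified]

text \<open>The order of the constant field: the Q-th power is the Frobenius over \<open>k\<close>,
  while the q-th power in the curve equation is its square root under composition.\<close>

definition Q :: nat where "Q = q ^ 2"

lemma Q_pow: "Q ^ n = q ^ (2 * n)"
  by (simp add: Q_def power_mult)

lemma Q_ge: "Q \<ge> 2"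
  unfolding Q_def using q_ge_2 self_le_power[of q 2] by linarith

text \<open>Multiplication by c permutes the nonzero elements; one extra factor c turns the exponent
  Q - 1 into Q.\<close>

lemma k_pow_Q: "(c::'k) ^ Q = c"
proof (cases "c = 0")
  case False
  have "c * (\<Prod>y\<in>UNIV-{0}. c * y) = c * c ^ (card (UNIV :: 'k set) - 1) * \<Prod>(UNIV-{0})"
    by (simp add: prod.distrib mult_ac)
  also have "c * c ^ (card (UNIV :: 'k set) - 1) = c ^ Suc (card (UNIV :: 'k set) - 1)"
    by (subst power_Suc) auto
  also have "Suc (card (UNIV :: 'k set) - 1) = Q"
    using card_k q_pos by (simp add: Q_def)
  also have "(\<Prod>y\<in>UNIV-{0}. c * y) = (\<Prod>y\<in>UNIV-{0}. y)"
    by (rule prod.reindex_bij_witness[of _ "\<lambda>y. y / c" "\<lambda>y. c * y"]) (use False in auto)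
  finally show ?thesis
    using finite_k by simp
qed (use Q_ge in auto)

lemma k_pow_Qn: "(c::'k) ^ (Q ^ n) = c"
  by (induction n) (simp_all add: k_pow_Q power_mult mult.commute)

text \<open>The embedded field already supplies Q roots of the polynomial X^Q - X of degree Q. This
  is the test for descent from the closure to \<open>k\<close>.\<close>

lemma fixed_iff: "(z :: 'k alg_closure) ^ Q = z \<longleftrightarrow> z \<in> range to_ac"
proof -
  let ?F = "{z :: 'k alg_closure. z ^ Q = z}"
  have "range to_ac \<subseteq> ?F"
    using k_pow_Q by (auto simp flip: to_ac_power)
  moreover have "card (range to_ac :: 'k alg_closure set) = Q"
    using card_image[OF inj_to_ac[where 'a = 'k]] card_k by (simp add: Q_def)
  ultimately have "range to_ac = ?F"
    using card_poly_fixed[OF Q_ge, where 'b = "'k alg_closure"] by (intro card_seteq) auto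
  then show ?thesis by auto
qed

text \<open>All powers of z are values of remainders modulo an annihilating polynomial, and over the
  finite \<open>k\<close> there are finitely many of these. So two Frobenius powers of z agree, and
  injectivity of Frobenius cancels the smaller one.\<close>

lemma K_periodic: "\<exists>m>0. (z :: 'k alg_closure) ^ (Q ^ m) = z"
proof -
  obtain p :: "'k poly" where p: "p \<noteq> 0" "poly (map_poly to_ac p) z = 0"
    using alg_closure_algebraic[of z] by blast
  interpret e: cr_hom "\<lambda>p. poly (map_poly to_ac p) z"
    by (intro cr_hom_ev1 cr_hom_to_ac)
  let ?B = "{r :: 'k poly. degree r \<le> degree p}"
  have "?B \<subseteq> Poly ` {xs. set xs \<subseteq> UNIV \<and> length xs \<le> Suc (degree p)}"
  proof
    fix r :: "'k poly" assume "r \<in> ?B"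
    then show "r \<in> Poly ` {xs. set xs \<subseteq> UNIV \<and> length xs \<le> Suc (degree p)}"
      by (intro image_eqI[of _ _ "coeffs r"]) (auto simp: degree_eq_length_coeffs)
  qed
  then have fin: "finite ?B"
    using finite_lists_length_le[OF finite_k] by (meson finite_imageI finite_subset)
  have "z ^ n \<in> (\<lambda>p. poly (map_poly to_ac p) z) ` ?B" for n
  proof (rule image_eqI)
    have "z ^ n = poly (map_poly to_ac (monom 1 n)) z"
      by (simp add: map_poly_monom poly_monom)
    also have "monom 1 n = monom 1 n div p * p + (monom 1 n mod p :: 'k poly)"
      by simp
    also have "poly (map_poly to_ac \<dots>) z = poly (map_poly to_ac (monom 1 n mod p)) z"
      unfolding e.hom_add e.hom_mult p(2) by simp
    finally show "z ^ n = poly (map_poly to_ac (monom 1 n mod p)) z" .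
    show "monom 1 n mod p \<in> ?B"
      using degree_mod_less[OF p(1), of "monom 1 n"] by auto
  qed
  then have "range (\<lambda>i. z ^ (Q ^ i)) \<subseteq> (\<lambda>p. poly (map_poly to_ac p) z) ` ?B"
    by auto
  then have "finite (range (\<lambda>i. z ^ (Q ^ i)))"
    using fin finite_subset by blast
  then have "\<not> inj (\<lambda>i. z ^ (Q ^ i))"
    using finite_imageD by blast
  then obtain i j where ij: "z ^ (Q ^ i) = z ^ (Q ^ j)" "i < j"
    unfolding inj_def by (metis linorder_neqE_nat)
  have "(z ^ (Q ^ (j - i)) - z) ^ (Q ^ i) = 0"
    unfolding Q_pow frob_diff[OF CHAR_alg_closure]
    using ij by (simp flip: power_mult power_add add: Q_pow algebra_simps)
  then show ?thesis
    using ij by (intro exI[of _ "j - i"]) simp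
qed

lemma K_periodic2:
  fixes a b :: "'k alg_closure"
  obtains m where "m > 0" "a ^ (Q ^ m) = a" "b ^ (Q ^ m) = b"
proof -
  obtain m n where "m > 0" "a ^ (Q ^ m) = a" "n > 0" "b ^ (Q ^ n) = b"
    using K_periodic[of a] K_periodic[of b] by blast
  then have "a ^ (Q ^ (m * n)) = a" "b ^ (Q ^ (m * n)) = b" "m * n > 0"
    using periodic_mult[of a "Q ^ m" n] periodic_mult[of b "Q ^ n" m] power_mult[of Q n m]
    by (auto simp: power_mult mult.commute)
  then show ?thesis using that by blast
qed

text \<open>The kernel of the trace from \<open>k\<close> to its subfield with q elements; adding
  such a constant to y preserves the curve.\<close>

definition S :: "'k set" where "S = {c. c ^ q + c = 0}"

lemma finite_S: "finite S"
  by (rule finite_subset[OF subset_UNIV finite_k])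

lemma S_closed:
  shows "0 \<in> S" and "c \<in> S \<Longrightarrow> - c \<in> S" and "c \<in> S \<Longrightarrow> d \<in> S \<Longrightarrow> c + d \<in> S"
proof -
  show "0 \<in> S" using q_pos by (simp add: S_def)
  show "- c \<in> S" if "c \<in> S"
  proof -
    have "(- c) ^ q + - c = - (c ^ q + c)"
      by (simp add: frob1_minus[OF refl])
    then show ?thesis
      using that unfolding S_def mem_Collect_eq by (simp only: neg_equal_0_iff_equal)
  qed
  show "c + d \<in> S" if "c \<in> S" "d \<in> S"
  proof -
    have "(c + d) ^ q + (c + d) = (c ^ q + c) + (d ^ q + d)"
      unfolding frob1_add[OF refl] by (simp add: algebra_simps)
    then show ?thesis
      using that unfolding S_def mem_Collect_eq by (metis add.right_neutral)
  qed
qed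

text \<open>The additive map c^q - c sends \<open>k\<close> into \<open>S\<close>, and each nonempty
  fibre is a translate of the at most q solutions of z^q = z. Hence q^2 is at most q times the
  cardinality of \<open>S\<close>.\<close>

lemma card_S: "card S \<ge> q"
proof -
  let ?f = "\<lambda>c::'k. c ^ q - c"
  have im: "?f c \<in> S" for c
  proof -
    have "(c ^ q) ^ q = c"
      using k_pow_Q[of c] by (simp add: Q_def power2_eq_square power_mult)
    then show ?thesis by (simp add: S_def frob1_diff)
  qed
  have fib: "card {c. ?f c = d} \<le> q" for d
  proof (cases "\<exists>c0. ?f c0 = d")
    case True
    then obtain c0 where c0: "?f c0 = d" by blast
    have "{c. ?f c = d} = (\<lambda>z. c0 + z) ` {z. z ^ q = z}"
    proof (intro equalityI subsetI)
      fix c assume "c \<in> {c. ?f c = d}"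
      with c0 have "c ^ q - c = c0 ^ q - c0" by simp
      then have "(c - c0) ^ q = c - c0"
        unfolding frob1_diff[OF refl] by (simp add: algebra_simps)
      then show "c \<in> (\<lambda>z. c0 + z) ` {z. z ^ q = z}" by (intro image_eqI[of _ _ "c - c0"]) auto
    next
      fix c assume "c \<in> (\<lambda>z. c0 + z) ` {z. z ^ q = z}"
      then show "c \<in> {c. ?f c = d}" using c0 by (auto simp: frob1_add)
    qed
    then have "card {c. ?f c = d} \<le> card {z :: 'k. z ^ q = z}"
      using card_poly_fixed[OF q_ge_2, where 'b = 'k] by (metis card_image_le)
    then show ?thesis using card_poly_fixed[OF q_ge_2, where 'b = 'k] by linarith
  qed auto
  have "UNIV = (\<Union>d\<in>S. {c. ?f c = d})" using im by auto
  then have "q ^ 2 \<le> (\<Sum>d\<in>S. card {c. ?f c = d})"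
    using card_UN_le[OF finite_S, of "\<lambda>d. {c. ?f c = d}"] card_k by simp
  also have "\<dots> \<le> (\<Sum>d\<in>S. q)" by (intro sum_mono fib)
  finally have "q * q \<le> card S * q" by (simp add: power2_eq_square)
  then show ?thesis using q_pos by simp
qed

end

section \<open>Local expansions at the points of the curve\<close>

context hermitian
begin

text \<open>Additivity of the q-th power applies to finite sums only. So the series is cut after
  degree n; the q-th power of the tail starts beyond n.\<close>

lemma fps_frob_nth:
  fixes f :: "'k alg_closure fps"
  shows "(f ^ q) $ n = (if q dvd n then (f $ (n div q)) ^ q else 0)"
proof -
  define g where "g = (\<Sum>i\<le>n. fps_const (f $ i) * fps_X ^ i)"
  have g_nth: "g $ j = (if j \<le> n then f $ j else 0)" for j
    by (simp add: g_def fps_sum_nth if_distrib[of "\<lambda>x. _ * x"] cong: if_cong)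
  define r where "r = Abs_fps (\<lambda>j. f $ (j + Suc n))"
  have f: "f = g + fps_X ^ Suc n * r"
    by (rule fps_ext) (auto simp: g_nth r_def fps_X_power_mult_nth simp del: power_Suc)
  have "f ^ q = g ^ q + (fps_X ^ Suc n) ^ q * r ^ q"
    by (subst f) (simp add: frob1_add power_mult_distrib)
  also have "(fps_X ^ Suc n) ^ q = (fps_X ^ (Suc n * q) :: 'k alg_closure fps)"
    by (simp only: power_mult)
  finally have fq: "f ^ q = g ^ q + fps_X ^ (Suc n * q) * r ^ q" .
  have "n < Suc n * q"
    using mult_le_mono2[of 1 q "Suc n"] q_pos by simp
  then have "(f ^ q) $ n = (g ^ q) $ n"
    unfolding fq by (simp add: fps_X_power_mult_nth del: mult_Suc)
  also have "g ^ q = (\<Sum>i\<le>n. fps_const ((f $ i) ^ q) * fps_X ^ (i * q))"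
  proof -
    have "sum F A ^ q = (\<Sum>i\<in>A. F i ^ q)" for F :: "nat \<Rightarrow> 'k alg_closure fps" and A
      using frob_sum[where n = 1, of F A] by simp
    then show ?thesis
      by (simp add: g_def power_mult_distrib fps_const_power power_mult)
  qed
  also have "\<dots> $ n = (\<Sum>i\<le>n. if i * q = n then (f $ i) ^ q else 0)"
    by (simp add: fps_sum_nth if_distrib[of "\<lambda>x. _ * x"] eq_commute cong: if_cong)
  also have "\<dots> = (if q dvd n then (f $ (n div q)) ^ q else 0)"
  proof (cases "q dvd n")
    case True
    then obtain m where m: "n = q * m" by blast
    have "(\<Sum>i\<le>n. if i * q = n then (f $ i) ^ q else 0) = (\<Sum>i\<in>{m}. (f $ i) ^ q)"
      using q_pos m by (intro sum.mono_neutral_cong_right) auto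
    then show ?thesis using True m q_pos by simp
  next
    case False
    then show ?thesis by (auto intro!: sum.neutral)
  qed
  finally show ?thesis .
qed

text \<open>Comparing coefficients gives a recursion from n div q to n. It is well founded only for
  positive n, so index 0 is excluded from the recursive call, and there \<open>w\<close> must
  vanish.\<close>

lemma artin_schreier_ex:
  fixes w :: "'k alg_closure fps"
  assumes "w $ 0 = 0"
  shows "\<exists>s. s $ 0 = 0 \<and> s ^ q + s = w"
proof -
  have "\<exists>c. \<forall>n. c n = w $ n - (if q dvd n \<and> n > 0 then c (n div q) ^ q else 0)"
  proof -
    define R where "R = wfrec less_than (\<lambda>c n. w $ n - (if q dvd n \<and> n > 0 then c (n div q) ^ q else 0))"
    have "R n = w $ n - (if q dvd n \<and> n > 0 then R (n div q) ^ q else 0)" for n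
      unfolding R_def using q_ge_2
      by (subst wfrec[OF wf_less_than]) (simp add: cut_def)
    then show ?thesis by blast
  qed
  then obtain c where c: "\<And>n. c n = w $ n - (if q dvd n \<and> n > 0 then c (n div q) ^ q else 0)"
    by blast
  have c0: "c 0 = 0" using c[of 0] assms by simp
  have "Abs_fps c ^ q + Abs_fps c = w"
  proof (rule fps_ext)
    fix n
    show "(Abs_fps c ^ q + Abs_fps c) $ n = w $ n"
      using c[of n] c0 q_pos by (cases "n = 0") (auto simp: fps_frob_nth)
  qed
  then show ?thesis using c0 by (intro exI[of _ "Abs_fps c"]) simp
qed

definition as_sol :: "'k alg_closure fps \<Rightarrow> 'k alg_closure fps" where
  "as_sol w = (SOME s. s $ 0 = 0 \<and> s ^ q + s = w)"

lemma as_sol: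
  assumes "w $ 0 = 0"
  shows "as_sol w $ 0 = 0" "as_sol w ^ q + as_sol w = w"
  using someI_ex[OF artin_schreier_ex[OF assms]] by (auto simp: as_sol_def)

lemma as_sol_nth:
  assumes "w $ 0 = 0"
  shows "as_sol w $ n = w $ n - (if q dvd n then (as_sol w $ (n div q)) ^ q else 0)"
proof -
  have "w $ n = (as_sol w ^ q + as_sol w) $ n"
    using as_sol(2)[OF assms] by simp
  then show ?thesis by (simp add: fps_frob_nth)
qed

text \<open>With x = a + t this is x^(q+1) - a^(q+1), the right-hand side of the equation for y -
  b.\<close>

definition w_aff :: "'k alg_closure \<Rightarrow> 'k alg_closure fps" where
  "w_aff a = fps_const (a ^ q) * fps_X + fps_const a * fps_X ^ q + fps_X ^ (q + 1)"

text \<open>The expansion of w = 1/y in t = x/y: dividing the curve equation by y^(q+1) gives w +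
  w^q = t^(q+1).\<close>

definition w_inf :: "'k alg_closure fls" where
  "w_inf = fps_to_fls (as_sol (fps_X ^ (q + 1)))"

text \<open>
  \<open>None\<close> is the point \<open>(0 : 1 : 0)\<close> at infinity. The series \<open>xs\<close> and \<open>ys\<close> expand the affine coordinates
  \<open>X/Z\<close> and \<open>Y/Z\<close> in the local parameter \<open>x - a\<close>, or \<open>x/y\<close> at infinity.
\<close>

type_synonym 'a point = "('a \<times> 'a) option"

fun xs :: "'k alg_closure point \<Rightarrow> 'k alg_closure fls" where
  "xs None = fls_X / w_inf"
| "xs (Some (a, b)) = fps_to_fls (fps_const a + fps_X)"

fun ys :: "'k alg_closure point \<Rightarrow> 'k alg_closure fls" where
  "ys None = 1 / w_inf"
| "ys (Some (a, b)) = fps_to_fls (fps_const b + as_sol (w_aff a))"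

fun on_curve :: "'k alg_closure point \<Rightarrow> bool" where
  "on_curve None = True"
| "on_curve (Some (a, b)) = (b ^ q + b = a ^ (q + 1))"

text \<open>The sign is chosen so that the affine equation is monic in Y. The coefficient ring is
  left open because the equation is used over \<open>k\<close> and over its closure.\<close>

definition Cv :: "'b::comm_ring_1 poly poly" where
  "Cv = Y2 ^ q + Y2 - X2 ^ (q + 1)"

lemma map_poly2_Cv: "cr_hom h \<Longrightarrow> map_poly2 h Cv = Cv"
  by (simp add: Cv_def cr_hom.map_poly2_homs cr_hom.map_poly2_base)

lemma Cv_monic: "degree (Cv :: 'b::idom poly poly) = q" "lead_coeff (Cv :: 'b poly poly) = 1"
proof -
  have 1: "Cv = monom 1 q + ([:0, 1:] - [:[:0, 1:] ^ (q + 1):] :: 'b poly poly)"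
    by (simp only: Cv_def Y2_def X2_def monom_altdef cr_hom.hom_power[OF cr_hom_const_poly]
        smult_1_left add_diff_eq)
  have 2: "degree ([:0, 1:] - [:[:0, 1:] ^ (q + 1):] :: 'b poly poly) \<le> 1"
    by (intro degree_diff_le) auto
  then have 3: "degree ([:0, 1:] - [:[:0, 1:] ^ (q + 1):] :: 'b poly poly) < q"
    using q_ge_2 by simp
  show *: "degree (Cv :: 'b poly poly) = q"
    unfolding 1 using degree_add_eq_left[of "[:0, 1:] - [:[:0, 1:] ^ (q + 1):]" "monom 1 q :: 'b poly poly"] 3
    by (simp add: degree_monom_eq)
  show "lead_coeff (Cv :: 'b poly poly) = 1"
    unfolding * unfolding 1 using coeff_eq_0[OF 3] by simp
qed

lemma w_inf:
  "w_inf ^ q + w_inf = fls_X ^ (q + 1)" "w_inf \<noteq> 0" "fls_subdegree w_inf = int q + 1"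
proof -
  let ?w = "fps_X ^ (q + 1) :: 'k alg_closure fps"
  have 0: "?w $ 0 = 0" by simp
  have "fps_to_fls (as_sol ?w ^ q + as_sol ?w) = fps_to_fls ?w"
    using as_sol(2)[OF 0] by (rule arg_cong)
  then show 1: "w_inf ^ q + w_inf = fls_X ^ (q + 1)"
    by (simp only: w_inf_def fps_to_fls_plus fps_to_fls_power fps_X_to_fls)
  then show 2: "w_inf \<noteq> 0" using q_pos by (auto simp: power_0_left)
  have pos: "fls_subdegree w_inf > 0"
  proof -
    have "as_sol ?w \<noteq> 0" using 2 by (auto simp: w_inf_def)
    then have "subdegree (as_sol ?w) \<noteq> 0"
      using as_sol(1)[OF 0] by (metis nth_subdegree_nonzero)
    then show ?thesis by (simp add: w_inf_def fls_subdegree_fls_to_fps)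
  qed
  have "fls_subdegree (w_inf + w_inf ^ q) = fls_subdegree w_inf"
  proof (rule fls_subdegree_add_eq1)
    show "fls_subdegree w_inf < fls_subdegree (w_inf ^ q)"
      using pos q_ge_2 by (simp add: fls_subdegree_pow)
  qed (rule 2)
  then show "fls_subdegree w_inf = int q + 1"
    using 1 by (metis add.commute fls_subdegree_fls_X_pow of_nat_1 of_nat_add)
qed

lemma w_aff_0: "w_aff a $ 0 = 0"
  using q_pos by (simp add: w_aff_def)

lemma point_eq:
  assumes "on_curve R"
  shows "ys R ^ q + ys R = xs R ^ (q + 1)"
proof (cases R)
  case None
  have "(1 / w_inf) ^ q + 1 / w_inf = (w_inf ^ q + w_inf) / w_inf ^ (q + 1)"
    using w_inf(2) by (simp add: field_simps)
  then show ?thesis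
    using None w_inf(1) by (simp add: power_divide)
next
  case (Some p)
  obtain a b where R: "R = Some (a, b)" using Some by (cases p) auto
  have ab: "b ^ q + b = a ^ (q + 1)" using assms R by simp
  let ?s = "as_sol (w_aff a)"
  have "(fps_const b + ?s) ^ q + (fps_const b + ?s) = fps_const (b ^ q + b) + (?s ^ q + ?s)"
    by (simp add: frob1_add fps_const_power flip: fps_const_add)
  also have "\<dots> = fps_const (a ^ (q + 1)) + w_aff a"
    unfolding as_sol(2)[OF w_aff_0] ab ..
  also have "\<dots> = (fps_const a + fps_X) ^ q * (fps_const a + fps_X)"
    unfolding w_aff_def by (simp add: frob1_add fps_const_power algebra_simps flip: fps_const_mult)
  finally have "fps_to_fls ((fps_const b + ?s) ^ q + (fps_const b + ?s))
      = fps_to_fls ((fps_const a + fps_X) ^ q * (fps_const a + fps_X))"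
    by (rule arg_cong)
  then show ?thesis
    unfolding R xs.simps ys.simps fps_to_fls_plus[of "_ ^ q"] fps_to_fls_power fls_times_fps_to_fls
    by simp
qed

section \<open>Evaluation of polynomials along the expansion at a point\<close>

definition evR :: "'k alg_closure point \<Rightarrow> 'k alg_closure poly poly \<Rightarrow> 'k alg_closure fls" where
  "evR R = ev2 fls_const (xs R) (ys R)"

definition evk :: "'k alg_closure point \<Rightarrow> 'k poly poly \<Rightarrow> 'k alg_closure fls" where
  "evk R g = evR R (map_poly2 to_ac g)"

sublocale evR: cr_hom "evR R" for R
  unfolding evR_def by (intro cr_hom_ev2 cr_hom_fls_const)

sublocale lift: cr_hom "map_poly2 (to_ac :: 'k \<Rightarrow> 'k alg_closure)"
  by (intro cr_hom_map2 cr_hom_to_ac)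

sublocale evk: cr_hom "evk R" for R
  unfolding evk_def[abs_def] by (intro cr_hom_comp[OF evR.cr_hom_axioms] lift.cr_hom_axioms)

lemma evR_base: "evR R (cst2 c) = fls_const c" "evR R X2 = xs R" "evR R Y2 = ys R"
  by (simp_all add: evR_def cr_hom.ev2_base[OF cr_hom_fls_const])

lemma lift_base: "map_poly2 to_ac (cst2 c) = cst2 (to_ac c)" "map_poly2 to_ac X2 = X2" "map_poly2 to_ac Y2 = Y2"
  by (simp_all add: cr_hom.map_poly2_base[OF cr_hom_to_ac])

lemma evk_base: "evk R (cst2 c) = fls_const (to_ac c)" "evk R X2 = xs R" "evk R Y2 = ys R"
  by (simp_all add: evk_def lift_base evR_base)

lemma evR_Cv: "on_curve R \<Longrightarrow> evR R Cv = 0"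
  using point_eq[of R] by (simp add: Cv_def evR.homs evR_base)

lemma evk_Cv: "on_curve R \<Longrightarrow> evk R Cv = 0"
  by (simp add: evk_def map_poly2_Cv[OF cr_hom_to_ac] evR_Cv)

lemma evk_cong: "on_curve R \<Longrightarrow> Cv dvd f - g \<Longrightarrow> evk R f = evk R g"
  using evk.hom_mult[of R Cv] evk_Cv[of R] evk.hom_diff[of R f g] by (auto elim!: dvdE)

definition val2 :: "'b::comm_ring_1 \<Rightarrow> 'b \<Rightarrow> 'b poly poly \<Rightarrow> 'b" where
  "val2 a b = ev2 (\<lambda>x. x) a b"

sublocale val2: cr_hom "val2 a b" for a b :: "'k alg_closure"
  unfolding val2_def by (intro cr_hom_ev2 cr_hom_id)

lemma val2_base: "val2 a b (cst2 c) = c" "val2 a b X2 = a" "val2 a b Y2 = b"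
  by (simp_all add: val2_def cr_hom.ev2_base[OF cr_hom_id])

lemma evR_affine:
  "\<exists>F. evR (Some (a, b)) g = fps_to_fls F \<and> fps_nth F 0 = val2 a b g"
proof (induction g rule: poly2_induct)
  case (const c)
  show ?case by (rule exI[of _ "fps_const c"]) (simp add: evR_base val2_base)
next
  case X
  show ?case by (rule exI[of _ "fps_const a + fps_X"]) (simp add: evR_base val2_base)
next
  case Y
  show ?case
    by (rule exI[of _ "fps_const b + as_sol (w_aff a)"])
      (simp add: evR_base val2_base as_sol(1)[OF w_aff_0])
next
  case (add f g)
  then obtain F G where "evR (Some (a, b)) f = fps_to_fls F \<and> fps_nth F 0 = val2 a b f"
    "evR (Some (a, b)) g = fps_to_fls G \<and> fps_nth G 0 = val2 a b g" by blast
  then show ?case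
    by (intro exI[of _ "F + G"]) (simp add: evR.homs val2.homs fps_to_fls_plus)
next
  case (mult f g)
  then obtain F G where "evR (Some (a, b)) f = fps_to_fls F \<and> fps_nth F 0 = val2 a b f"
    "evR (Some (a, b)) g = fps_to_fls G \<and> fps_nth G 0 = val2 a b g" by blast
  then show ?case
    by (intro exI[of _ "F * G"]) (simp add: evR.homs val2.homs fls_times_fps_to_fls)
qed

lemma evR_affine_nth0: "evR (Some (a, b)) g $$ 0 = val2 a b g"
  using evR_affine[of a b g] by auto

lemma evR_affine_ge0: "fls_subdegree (evR (Some (a, b)) g) \<ge> 0"
  using evR_affine[of a b g] by (auto simp: fls_subdegree_fls_to_fps_gt0)

lemma evR_affine_pos:
  assumes "evR (Some (a, b)) g \<noteq> 0"
  shows "fls_subdegree (evR (Some (a, b)) g) > 0 \<longleftrightarrow> val2 a b g = 0"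
  using fls_subdegree_pos_iff[OF assms evR_affine_ge0] by (simp add: evR_affine_nth0)

end

section \<open>The order at infinity, norms, and regular functions\<close>

definition supp2 :: "'a::zero poly poly \<Rightarrow> (nat \<times> nat) set" where
  "supp2 g = {(i, j). coeff (coeff g j) i \<noteq> 0}"

lemma supp2_subset: "supp2 g \<subseteq> (\<lambda>(j, i). (i, j)) ` (SIGMA j:{..degree g}. {..degree (coeff g j)})"
proof
  fix p assume "p \<in> supp2 g"
  then obtain i j where p: "p = (i, j)" "coeff (coeff g j) i \<noteq> 0" by (auto simp: supp2_def)
  then have "i \<le> degree (coeff g j)" "coeff g j \<noteq> 0" by (auto intro: le_degree)
  moreover from this have "j \<le> degree g" by (auto intro: le_degree)
  ultimately show "p \<in> (\<lambda>(j, i). (i, j)) ` (SIGMA j:{..degree g}. {..degree (coeff g j)})"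
    using p by (intro image_eqI[of _ _ "(j, i)"]) auto
qed

lemma finite_supp2: "finite (supp2 g)"
  by (rule finite_subset[OF supp2_subset]) auto

lemma supp2_nonempty: "g \<noteq> 0 \<Longrightarrow> supp2 g \<noteq> {}"
  by (auto simp: supp2_def poly_eq_iff)

lemma ev2_supp2:
  assumes "cr_hom h"
  shows "ev2 h x y g = (\<Sum>(i, j)\<in>supp2 g. h (coeff (coeff g j) i) * x ^ i * y ^ j)"
proof -
  interpret cr_hom h by fact
  let ?D = "SIGMA j:{..degree g}. {..degree (coeff g j)}"
  let ?t = "\<lambda>(i, j). h (coeff (coeff g j) i) * x ^ i * y ^ j"
  have "ev2 h x y g = (\<Sum>j\<le>degree g. \<Sum>i\<le>degree (coeff g j). ?t (i, j))"
    by (simp add: ev2_altdef[OF assms] sum_distrib_right)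
  also have "\<dots> = (\<Sum>p\<in>?D. ?t ((\<lambda>(j, i). (i, j)) p))"
    by (subst sum.Sigma) (auto intro!: sum.cong)
  also have "\<dots> = sum ?t ((\<lambda>(j, i). (i, j)) ` ?D)"
    by (subst sum.reindex) (auto simp: inj_on_def)
  also have "\<dots> = sum ?t (supp2 g)"
    by (rule sum.mono_neutral_right) (use supp2_subset[of g] in \<open>auto simp: supp2_def hom_0\<close>)
  finally show ?thesis .
qed

context hermitian
begin

lemma order_inj:
  fixes i j i' j' :: nat
  assumes "q * i + (q + 1) * j = q * i' + (q + 1) * j'" "j < q" "j' < q"
  shows "i = i' \<and> j = j'"
proof -
  have "(q * (i + j) + j) mod q = (q * (i' + j') + j') mod q"
    using assms(1) by (simp add: algebra_simps)
  then have "j = j'" using assms(2,3) by (simp only: mod_mult_self4 mod_less)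
  then show ?thesis using assms q_pos by simp
qed

text \<open>
  The monomials \<open>x\<^sup>i y\<^sup>j\<close> with \<open>j < q\<close> have pairwise distinct pole orders \<open>q i + (q + 1) j\<close> at infinity.
\<close>

lemma inf_order:
  assumes "g \<noteq> 0" "degree g < q"
  shows "evR None g \<noteq> 0"
    and "\<And>i j. coeff (coeff g j) i \<noteq> 0 \<Longrightarrow> int (q * i + (q + 1) * j) \<le> - fls_subdegree (evR None g)"
proof -
  let ?t = "\<lambda>(i, j). fls_const (coeff (coeff g j) i) * xs None ^ i * ys None ^ j"
  have ev: "evR None g = sum ?t (supp2 g)"
    unfolding evR_def by (rule ev2_supp2[OF cr_hom_fls_const])
  have ne: "xs None \<noteq> 0" "ys None \<noteq> 0" using w_inf(2) by auto
  have sd: "fls_subdegree (xs None) = - int q" "fls_subdegree (ys None) = - int q - 1"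
    using w_inf by (simp_all add: fls_divide_subdegree)
  have t_ne: "?t s \<noteq> 0" if "s \<in> supp2 g" for s
    using that ne by (auto simp: supp2_def)
  have t_sd: "fls_subdegree (?t (i, j)) = - int (q * i + (q + 1) * j)" if "(i, j) \<in> supp2 g" for i j
  proof -
    have "fls_subdegree (?t (i, j)) = int i * fls_subdegree (xs None) + int j * fls_subdegree (ys None)"
      using that ne by (simp add: supp2_def fls_subdegree_pow del: xs.simps ys.simps)
    then show ?thesis by (simp only: sd) (simp add: algebra_simps)
  qed
  have j_less: "j < q" if "(i, j) \<in> supp2 g" for i j
  proof -
    have "coeff g j \<noteq> 0" using that by (auto simp: supp2_def)
    then show ?thesis using le_degree[of g j] assms(2) by simp
  qed
  have inj: "inj_on (\<lambda>s. fls_subdegree (?t s)) (supp2 g)"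
  proof (intro inj_onI)
    fix s s' assume *: "s \<in> supp2 g" "s' \<in> supp2 g" "fls_subdegree (?t s) = fls_subdegree (?t s')"
    obtain i j i' j' where ij: "s = (i, j)" "s' = (i', j')" by (cases s, cases s') auto
    have "int (q * i + (q + 1) * j) = int (q * i' + (q + 1) * j')"
      using *(3) unfolding ij t_sd[OF *(1)[unfolded ij]] t_sd[OF *(2)[unfolded ij]] by linarith
    then have "i = i' \<and> j = j'"
      using *(1,2) ij j_less by (intro order_inj) (auto simp only: of_nat_eq_iff)
    then show "s = s'" using ij by simp
  qed
  note * = fls_subdegree_sum_distinct[OF finite_supp2 supp2_nonempty[OF assms(1)] t_ne inj]
  show "evR None g \<noteq> 0" unfolding ev using * by blast
  fix i j assume ij: "coeff (coeff g j) i \<noteq> 0"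
  then have mem: "(i, j) \<in> supp2 g" by (simp add: supp2_def)
  then have "Min ((\<lambda>s. fls_subdegree (?t s)) ` supp2 g) \<le> fls_subdegree (?t (i, j))"
    by (intro Min_le finite_imageI finite_supp2 imageI mem)
  then show "int (q * i + (q + 1) * j) \<le> - fls_subdegree (evR None g)"
    unfolding ev using * t_sd[OF mem] by linarith
qed

lemma map_poly2_to_ac_eq_0_iff: "map_poly2 to_ac (g :: 'k poly poly) = 0 \<longleftrightarrow> g = 0"
  using cr_hom.coeff_map2[OF cr_hom_to_ac, of g] by (simp add: poly_eq_iff)

lemma degree_map2_to_ac: "degree (map_poly2 to_ac (g :: 'k poly poly)) = degree g"
  unfolding map_poly2_def by (intro degree_map_poly) (auto simp: map_poly_eq_0_iff)

text \<open>A nonzero remainder modulo \<open>Cv\<close> has degree below q in y, so its monomials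
  cannot cancel at infinity. Thus the expansion at infinity embeds the coordinate ring.\<close>

lemma evk_None_eq_0_iff: "evk None g = 0 \<longleftrightarrow> Cv dvd g"
proof
  assume 0: "evk None g = 0"
  obtain r where r: "Cv dvd g - r" "r = 0 \<or> degree r < degree (Cv :: 'k poly poly)"
    using monic_division[OF Cv_monic(2)] .
  have "evk None r = 0" using evk_cong[OF _ r(1)] 0 by simp
  then have "r = 0"
    using r(2) inf_order(1)[of "map_poly2 to_ac r"]
    by (auto simp: evk_def Cv_monic(1) map_poly2_to_ac_eq_0_iff degree_map2_to_ac)
  then show "Cv dvd g" using r(1) by simp
next
  assume "Cv dvd g"
  then show "evk None g = 0" using evk_cong[of None g 0] by (simp add: evk.homs)
qed

section \<open>Translations of y and the norm down to k[x]\<close>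

definition shift :: "'k \<Rightarrow> 'k poly poly \<Rightarrow> 'k poly poly" where
  "shift c g = pcompose g [:[:c:], 1:]"

sublocale shift: cr_hom "shift c" for c
  by standard (simp_all add: shift_def pcompose_add pcompose_mult pcompose_1)

lemma shift_base: "shift c (cst2 d) = cst2 d" "shift c X2 = X2" "shift c Y2 = Y2 + cst2 c"
  by (simp_all add: shift_def cst2_def X2_def Y2_def pcompose_pCons)

lemma shift_shift: "shift c (shift d g) = shift (c + d) g"
proof -
  have "shift c (shift d g) = pcompose g (pcompose [:[:d:], 1:] [:[:c:], 1:])"
    unfolding shift_def by (rule pcompose_assoc[symmetric])
  also have "pcompose [:[:d:], 1:] [:[:c:], 1:] = [:[:c + d:], 1:]"
    by (simp add: pcompose_pCons add.commute)
  finally show ?thesis by (simp add: shift_def)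
qed

lemma shift_0: "shift 0 g = g"
  by (simp add: shift_def)

lemma degree_shift: "degree (shift c g) = degree g"
  by (simp add: shift_def degree_pcompose)

lemma shift_Cv:
  assumes "c \<in> S"
  shows "shift c Cv = Cv"
proof -
  have "shift c Cv = Y2 ^ q + Y2 - X2 ^ (q + 1) + cst2 (c ^ q + c)"
    by (simp add: Cv_def shift.homs shift_base frob1_add cr_hom.hom_power[OF cr_hom_cst2]
        cr_hom.hom_add[OF cr_hom_cst2])
  then show ?thesis
    using assms by (simp add: Cv_def S_def cst2_def)
qed

lemma shift_dvd:
  assumes "c \<in> S" "Cv dvd g"
  shows "Cv dvd shift c g"
proof -
  obtain r where "g = Cv * r" using assms(2) by (rule dvdE)
  then have "shift c g = Cv * shift c r"
    using shift_Cv[OF assms(1)] by (simp add: shift.hom_mult)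
  then show ?thesis by simp
qed

text \<open>
  The curve is an Artin--Schreier cover of the \<open>x\<close>-line: its automorphisms \<open>y \<mapsto> y + c\<close> with
  \<open>c\<^sup>q + c = 0\<close> make the norm down to \<open>k[x]\<close> explicit.
\<close>

lemma norm_ex:
  fixes b :: "'k poly poly"
  obtains c D where "Cv dvd b * c - [:D:]" "\<not> Cv dvd b \<Longrightarrow> D \<noteq> 0"
proof -
  define N where "N = (\<Prod>c\<in>S. shift c b)"
  have N_inv: "shift d N = N" if "d \<in> S" for d
    unfolding N_def shift.hom_prod shift_shift
    by (rule prod.reindex_bij_witness[of _ "\<lambda>c. c - d" "\<lambda>c. d + c"])
      (use that S_closed S_closed(3)[of _ "- d"] in auto)
  obtain r where r: "Cv dvd N - r" "r = 0 \<or> degree r < degree (Cv :: 'k poly poly)"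
    using monic_division[OF Cv_monic(2)] .
  have deg_r: "degree r < q" using r(2) q_pos by (auto simp: Cv_monic)
  have r_inv: "shift d r = r" if "d \<in> S" for d
  proof -
    have "Cv dvd shift d (N - r)" by (rule shift_dvd[OF that r(1)])
    then have "Cv dvd N - shift d r" by (simp add: shift.homs N_inv[OF that])
    then have "Cv dvd (N - r) - (N - shift d r)" using r(1) by (rule dvd_diff[rotated])
    then have "Cv dvd shift d r - r" by simp
    moreover have "degree (shift d r - r) < degree (Cv :: 'k poly poly)"
      using deg_r degree_diff_le_max[of "shift d r" r] by (simp add: degree_shift Cv_monic)
    ultimately have "shift d r - r = 0" by (rule monic_division_unique)
    then show ?thesis by simp
  qed
  have root: "poly (r - [:poly r 0:]) [:d:] = 0" if "d \<in> S" for d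
  proof -
    have "poly (shift d r) 0 = poly r [:d:]"
      by (simp add: shift_def poly_pcompose)
    then show ?thesis using r_inv[OF that] by simp
  qed
  \<comment> \<open>Invariance makes r, as a polynomial in y, take one and the same value at all of
    \<open>S\<close>. These are at least q points and the degree is below q, so r lies in
    \<open>k[x]\<close>.\<close>
  have "r = [:poly r 0:]"
  proof (rule ccontr)
    assume "r \<noteq> [:poly r 0:]"
    then have nz: "r - [:poly r 0:] \<noteq> 0" by simp
    have "card ((\<lambda>d. [:d:]) ` S) \<le> card {z. poly (r - [:poly r 0:]) z = 0}"
      using root poly_roots_finite[OF nz] by (intro card_mono) auto
    also have "\<dots> \<le> degree (r - [:poly r 0:])"
      by (rule card_poly_roots_bound[OF nz])
    also have "\<dots> < q" using deg_r degree_diff_le_max[of r "[:poly r 0:]"] by simp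
    finally show False
      using card_S by (simp add: card_image inj_on_def)
  qed
  then have ND: "Cv dvd N - [:poly r 0:]" using r(1) by simp
  have N: "N = b * (\<Prod>c\<in>S - {0}. shift c b)"
    unfolding N_def using prod.remove[OF finite_S S_closed(1), of "\<lambda>c. shift c b"]
    by (simp add: shift_0)
  \<comment> \<open>A vanishing norm makes one translate of \<open>b\<close> vanish on the curve,
    and translating back makes \<open>b\<close> itself vanish.\<close>
  have "poly r 0 \<noteq> 0" if "\<not> Cv dvd b"
  proof
    assume "poly r 0 = 0"
    then have "evk None N = 0" using ND by (simp add: evk_None_eq_0_iff)
    then obtain c where c: "c \<in> S" "evk None (shift c b) = 0"
      by (auto simp: N_def evk.homs finite_S)
    have "Cv dvd shift (- c) (shift c b)"
      using shift_dvd[OF S_closed(2)[OF c(1)]] c(2) by (simp only: evk_None_eq_0_iff)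
    then show False using that by (simp add: shift_shift shift_0)
  qed
  then show ?thesis using ND N by (intro that[of _ "poly r 0"]) auto
qed

text \<open>Over the closed field P splits into linear factors, and x - z expands to a - z + t,
  which is never zero.\<close>

lemma evR_const_poly_nonzero:
  assumes "P \<noteq> 0"
  shows "evR (Some (a, b)) [:P:] \<noteq> 0"
  using assms
proof (induction "degree P" arbitrary: P)
  case 0
  then obtain c where "P = [:c:]" "c \<noteq> 0" by (auto elim: degree_eq_zeroE)
  then show ?case using evR_base(1)[of "Some (a, b)" c] by (simp add: cst2_def)
next
  case (Suc n)
  then obtain z where "poly P z = 0"
    using alg_closed_imp_poly_has_root[of P] by auto
  then obtain P' where P': "P = [:- z, 1:] * P'"
    unfolding poly_eq_0_iff_dvd by (rule dvdE)
  have ne: "P' \<noteq> 0" using P' Suc.prems by auto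
  have "degree P = Suc (degree P')"
    unfolding P' by (subst degree_mult_eq) (use ne in auto)
  then have IH: "evR (Some (a, b)) [:P':] \<noteq> 0" using Suc ne by auto
  have eq: "[:P:] = (X2 - cst2 z) * [:P':]"
    unfolding P' by (simp add: X2_def cst2_def)
  have "fps_to_fls (fps_const a + fps_X) - fls_const z \<noteq> 0"
  proof
    assume "fps_to_fls (fps_const a + fps_X) - fls_const z = 0"
    then have "(fps_to_fls (fps_const a + fps_X) - fls_const z) $$ 1 = 0" by simp
    then show False by simp
  qed
  then have "evR (Some (a, b)) (X2 - cst2 z) \<noteq> 0"
    by (simp add: evR.homs evR_base)
  then show ?case
    using IH unfolding eq evR.hom_mult by simp
qed

text \<open>At a finite point the norm reduces the claim to polynomials in x alone, whose expansions
  do not vanish.\<close>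

lemma evk_eq_0_iff:
  assumes "on_curve R"
  shows "evk R g = 0 \<longleftrightarrow> Cv dvd g"
proof
  assume 0: "evk R g = 0"
  show "Cv dvd g"
  proof (cases R)
    case None
    then show ?thesis using 0 evk_None_eq_0_iff by simp
  next
    case (Some p)
    obtain a b where R: "R = Some (a, b)" using Some by (cases p) auto
    show ?thesis
    proof (rule ccontr)
      assume "\<not> Cv dvd g"
      then obtain c D where D: "Cv dvd g * c - [:D:]" "D \<noteq> 0"
        using norm_ex[of g] by blast
      then have "evk R [:D:] = 0"
        using evk_cong[OF assms D(1)] 0 by (simp add: evk.homs)
      moreover have "map_poly2 to_ac [:D:] = [:map_poly to_ac D:]"
        by (simp add: map_poly2_def map_poly_pCons)
      ultimately show False
        using D(2) evR_const_poly_nonzero[of "map_poly to_ac D" a b]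
        by (simp add: evk_def R map_poly_eq_0_iff)
    qed
  qed
next
  assume "Cv dvd g"
  then show "evk R g = 0" using evk_cong[OF assms, of g 0] by (simp add: evk.homs)
qed

text \<open>The kernel of a homomorphism into the field \<open>K((t))\<close> is prime; this is the
  irreducibility of the curve.\<close>

lemma Cv_dvd_mult: "Cv dvd f * g \<longleftrightarrow> Cv dvd f \<or> Cv dvd (g :: 'k poly poly)"
  by (simp add: evk.homs flip: evk_None_eq_0_iff)

lemma Cv_not_dvd_1: "\<not> Cv dvd (1 :: 'k poly poly)"
  by (simp add: evk.homs flip: evk_None_eq_0_iff)

lemma fiber:
  fixes a :: "'k alg_closure"
  shows "\<exists>b. b ^ q + b = a ^ (q + 1)"
    and "b ^ q + b = a ^ (q + 1) \<Longrightarrow> c \<in> S \<Longrightarrow> (b + to_ac c) ^ q + (b + to_ac c) = a ^ (q + 1)"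
proof -
  let ?p = "monom 1 q + [:- (a ^ (q + 1)), 1:]"
  have "degree ?p = q"
    using q_ge_2 by (subst degree_add_eq_left) (auto simp: degree_monom_eq)
  then obtain z where "poly ?p z = 0"
    using alg_closed_imp_poly_has_root[of ?p] q_pos by auto
  then show "\<exists>b. b ^ q + b = a ^ (q + 1)"
    by (intro exI[of _ z]) (simp add: poly_monom algebra_simps)
  assume b: "b ^ q + b = a ^ (q + 1)" and c: "c \<in> S"
  have "(b + to_ac c) ^ q + (b + to_ac c) = b ^ q + b + to_ac (c ^ q + c)"
    by (simp add: frob1_add)
  then show "(b + to_ac c) ^ q + (b + to_ac c) = a ^ (q + 1)"
    using b c unfolding S_def mem_Collect_eq by (simp only: to_ac_0 add_0_right)
qed

text \<open>Translating one point by \<open>S\<close> gives at least q points over x = a, too many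
  zeros for a nonzero polynomial in y of degree below q.\<close>

lemma fiber_vanish:
  fixes g :: "'k alg_closure poly poly"
  assumes "degree g < q" "\<And>b. b ^ q + b = a ^ (q + 1) \<Longrightarrow> val2 a b g = 0"
  shows "poly (coeff g j) a = 0"
proof -
  let ?p = "map_poly (\<lambda>p. poly p a) g"
  obtain b where b: "b ^ q + b = a ^ (q + 1)" using fiber(1) by blast
  have root: "poly ?p (b + to_ac c) = 0" if "c \<in> S" for c
    using assms(2)[OF fiber(2)[OF b that]] by (simp add: val2_def ev2_def)
  have "?p = 0"
  proof (rule ccontr)
    assume nz: "?p \<noteq> 0"
    have "card ((\<lambda>c. b + to_ac c) ` S) \<le> card {z. poly ?p z = 0}"
      using root poly_roots_finite[OF nz] by (intro card_mono) auto
    also have "\<dots> \<le> degree ?p" by (rule card_poly_roots_bound[OF nz])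
    also have "\<dots> < q" using assms(1) map_poly_degree_leq[of "\<lambda>p. poly p a" g] by simp
    finally show False using card_S by (simp add: card_image inj_on_def)
  qed
  then have "coeff ?p j = 0" by simp
  then show ?thesis by (simp add: coeff_map_poly)
qed

text \<open>
  A root of the denominator \<open>D\<close> cancels because there are \<open>q\<close> points of the curve above it, while
  \<open>g\<close> has degree less than \<open>q\<close> in \<open>y\<close>.
\<close>

lemma regular_imp_polynomial:
  fixes g :: "'k alg_closure poly poly"
  assumes "D \<noteq> 0" "degree g < q"
    and "\<And>a b. on_curve (Some (a, b)) \<Longrightarrow> evR (Some (a, b)) g = 0 \<or>
      fls_subdegree (evR (Some (a, b)) [:D:]) \<le> fls_subdegree (evR (Some (a, b)) g)"
  shows "\<exists>F. g = smult D F \<and> degree F < q"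
  using assms
proof (induction "degree D" arbitrary: D g)
  case 0
  then obtain c where c: "D = [:c:]" "c \<noteq> 0" by (auto elim: degree_eq_zeroE)
  then show ?case
    using 0 by (intro exI[of _ "smult [:1 / c:] g"]) (simp add: one_pCons[symmetric])
next
  case (Suc n)
  then obtain z where z: "poly D z = 0"
    using alg_closed_imp_poly_has_root[of D] by auto
  then obtain D' where D': "D = [:- z, 1:] * D'"
    unfolding poly_eq_0_iff_dvd by (rule dvdE)
  have ne: "D' \<noteq> 0" using D' Suc.prems by auto
  have deg: "degree D' = n"
    using Suc.hyps(2) unfolding D' by (subst (asm) degree_mult_eq) (use ne in auto)
  have van: "val2 z b g = 0" if "b ^ q + b = z ^ (q + 1)" for b
  proof -
    have "val2 z b [:D:] = 0" using z by (simp add: val2_def ev2_def map_poly_pCons)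
    then have "fls_subdegree (evR (Some (z, b)) [:D:]) > 0"
      using evR_affine_pos[of z b "[:D:]"] evR_const_poly_nonzero[OF Suc.prems(1)] by simp
    moreover have "evR (Some (z, b)) g = 0 \<or>
      fls_subdegree (evR (Some (z, b)) [:D:]) \<le> fls_subdegree (evR (Some (z, b)) g)"
      using Suc.prems(3)[of z b] that by simp
    ultimately show ?thesis
      using evR_affine_pos[of z b g] evR_affine_nth0[of z b g] by fastforce
  qed
  have dvd: "[:- z, 1:] dvd coeff g j" for j
    using fiber_vanish[OF Suc.prems(2) van] poly_eq_0_iff_dvd by blast
  define g' where "g' = map_poly (\<lambda>p. p div [:- z, 1:]) g"
  have g: "g = smult [:- z, 1:] g'"
    by (rule poly_eqI) (simp only: g'_def coeff_smult coeff_map_poly div_0 dvd_mult_div_cancel[OF dvd])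
  have "degree g' < q"
    using Suc.prems(2) map_poly_degree_leq[of "\<lambda>p. p div [:- z, 1:]" g] by (simp add: g'_def)
  moreover have "evR (Some (a, b)) g' = 0 \<or>
      fls_subdegree (evR (Some (a, b)) [:D':]) \<le> fls_subdegree (evR (Some (a, b)) g')"
    if ab: "on_curve (Some (a, b))" for a b
  proof -
    let ?R = "Some (a, b)"
    have l: "evR ?R [:[:- z, 1:]:] \<noteq> 0" by (rule evR_const_poly_nonzero) simp
    have "evR ?R [:D:] = evR ?R [:[:- z, 1:]:] * evR ?R [:D':]"
      using evR.hom_mult[of ?R "[:[:- z, 1:]:]" "[:D':]"] by (simp add: D')
    moreover have "evR ?R g = evR ?R [:[:- z, 1:]:] * evR ?R g'"
      using evR.hom_mult[of ?R "[:[:- z, 1:]:]" g'] by (simp add: g)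
    ultimately show ?thesis
      using Suc.prems(3)[OF ab] l evR_const_poly_nonzero[OF ne, of a b]
      by (cases "evR ?R g' = 0") auto
  qed
  ultimately obtain F where "g' = smult D' F" "degree F < q"
    using Suc.hyps(1)[OF deg[symmetric] ne] by blast
  then show ?case using g D' by (intro exI[of _ F]) simp
qed

end

section \<open>Valuation rings of the function field\<close>

lemma diff_dvd_power_diff: "x - y dvd x ^ n - (y :: 'b::comm_ring_1) ^ n"
proof (cases n)
  case (Suc m)
  then show ?thesis by (simp only: diff_power_eq_sum dvd_triv_left)
qed simp

section \<open>Valuation rings of a subfield and their maximal ideals\<close>

locale val_subring =
  fixes E W :: "'f::field set"
  assumes W_E: "W \<subseteq> E"
    and E_mult: "\<And>x y. x \<in> E \<Longrightarrow> y \<in> E \<Longrightarrow> x * y \<in> E"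
    and E_inverse: "\<And>x. x \<in> E \<Longrightarrow> inverse x \<in> E"
    and W_1: "1 \<in> W"
    and W_add: "\<And>x y. x \<in> W \<Longrightarrow> y \<in> W \<Longrightarrow> x + y \<in> W"
    and W_minus: "\<And>x. x \<in> W \<Longrightarrow> - x \<in> W"
    and W_mult: "\<And>x y. x \<in> W \<Longrightarrow> y \<in> W \<Longrightarrow> x * y \<in> W"
    and W_val: "\<And>x. x \<in> E \<Longrightarrow> x \<noteq> 0 \<Longrightarrow> x \<in> W \<or> inverse x \<in> W"
begin

definition M :: "'f set" where "M = {x \<in> W. x = 0 \<or> inverse x \<notin> W}"

lemma W_0: "0 \<in> W"
  using W_add[OF W_1 W_minus[OF W_1]] by simp

lemma W_power: "x \<in> W \<Longrightarrow> x ^ n \<in> W"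
  by (induction n) (auto intro: W_1 W_mult)

lemma M_W: "x \<in> M \<Longrightarrow> x \<in> W"
  by (simp add: M_def)

lemma M_0: "0 \<in> M"
  by (simp add: M_def W_0)

lemma one_notin_M: "1 \<notin> M"
  by (simp add: M_def W_1)

lemma inverse_W: "x \<in> W \<Longrightarrow> x \<notin> M \<Longrightarrow> inverse x \<in> W \<and> x \<noteq> 0"
  by (auto simp: M_def)

lemma M_absorb:
  assumes "x \<in> M" "y \<in> W"
  shows "x * y \<in> M"
proof (cases "x * y = 0")
  case False
  have "inverse (x * y) \<notin> W"
  proof
    assume "inverse (x * y) \<in> W"
    then have "y * inverse (x * y) \<in> W" using assms(2) W_mult by blast
    then have "inverse x \<in> W" using False by (simp add: field_simps)
    then show False using assms(1) False by (auto simp: M_def)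
  qed
  then show ?thesis using assms W_mult by (auto simp: M_def)
qed (use M_0 in auto)

lemma M_absorb': "x \<in> W \<Longrightarrow> y \<in> M \<Longrightarrow> x * y \<in> M"
  using M_absorb[of y x] by (simp add: mult.commute)

lemma M_prime: "x \<in> W \<Longrightarrow> y \<in> W \<Longrightarrow> x * y \<in> M \<Longrightarrow> x \<in> M \<or> y \<in> M"
  using W_mult[of "inverse x" "inverse y"] by (auto simp: M_def)

text \<open>One of x/y and y/x lies in \<open>W\<close>; factoring out the denominator of that
  quotient reduces the sum to absorption.\<close>

lemma M_add:
  assumes "x \<in> M" "y \<in> M"
  shows "x + y \<in> M"
proof -
  have *: "x + y \<in> M" if "x \<in> M" "y \<in> M" "y \<noteq> 0" "x / y \<in> W" for x y
  proof -
    have "y * (1 + x / y) \<in> M" using that W_add[OF W_1] by (intro M_absorb)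
    moreover have "y * (1 + x / y) = x + y" using that by (simp add: field_simps)
    ultimately show ?thesis by simp
  qed
  show ?thesis
  proof (cases "x = 0 \<or> y = 0")
    case False
    have "x / y \<in> E" using assms M_W W_E E_mult[of x "inverse y"] E_inverse[of y]
      by (auto simp: divide_inverse)
    then consider "x / y \<in> W" | "y / x \<in> W" using W_val[of "x / y"] False by auto
    then show ?thesis
      using *[of x y] *[of y x] assms False by cases (auto simp: add.commute)
  qed (use assms in auto)
qed

lemma M_minus: "x \<in> M \<Longrightarrow> - x \<in> M"
  using M_absorb[of x "- 1"] W_minus[OF W_1] by simp

lemma M_diff: "x \<in> M \<Longrightarrow> y \<in> M \<Longrightarrow> x - y \<in> M"
  using M_add[of x "- y"] M_minus by simp

lemma M_sum: "(\<And>i. i \<in> A \<Longrightarrow> f i \<in> M) \<Longrightarrow> sum f A \<in> M"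
  by (induction A rule: infinite_finite_induct) (auto intro: M_0 M_add)

lemma prod_notin_M: "(\<And>i. i \<in> A \<Longrightarrow> f i \<in> W \<and> f i \<notin> M) \<Longrightarrow> prod f A \<in> W \<and> prod f A \<notin> M"
  by (induction A rule: infinite_finite_induct) (auto simp: W_1 one_notin_M W_mult dest: M_prime)

lemma power_notin_M: "x \<in> W \<Longrightarrow> x \<notin> M \<Longrightarrow> x ^ n \<notin> M"
  using prod_notin_M[of "{..<n}" "\<lambda>_. x"] by simp

lemma M_power: "x \<in> M \<Longrightarrow> n > 0 \<Longrightarrow> x ^ n \<in> M"
  by (cases n) (auto intro: M_absorb W_power M_W)

text \<open>Integral closedness for roots: otherwise 1/x lies in \<open>W\<close>, and so does x =
  x^(n+1) (1/x)^n.\<close>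

lemma integral_W:
  assumes "x \<in> E" "x ^ Suc n \<in> W"
  shows "x \<in> W"
proof (rule ccontr)
  assume "x \<notin> W"
  then have x: "inverse x \<in> W" "x \<noteq> 0" using W_val[OF assms(1)] W_0 by auto
  have "x ^ Suc n * inverse x ^ n \<in> W" by (rule W_mult[OF assms(2) W_power[OF x(1)]])
  moreover have "x ^ Suc n * inverse x ^ n = x"
    using x(2) by (simp add: mult.assoc flip: power_mult_distrib)
  ultimately show False using \<open>x \<notin> W\<close> by metis
qed

end

context hermitian
begin

section \<open>Local parameters at finite points, defined over k\<close>

definition valk :: "'k alg_closure \<Rightarrow> 'k alg_closure \<Rightarrow> 'k poly poly \<Rightarrow> 'k alg_closure" where
  "valk a b g = val2 a b (map_poly2 to_ac g)"

sublocale valk: cr_hom "valk a b" for a b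
  unfolding valk_def[abs_def] by (intro cr_hom_comp[OF val2.cr_hom_axioms] lift.cr_hom_axioms)

lemma valk_base: "valk a b (cst2 c) = to_ac c" "valk a b X2 = a" "valk a b Y2 = b"
  by (simp_all add: valk_def lift_base val2_base)

lemma evk_affine_ge0: "fls_subdegree (evk (Some (a, b)) g) \<ge> 0"
  by (simp add: evk_def evR_affine_ge0)

lemma evk_affine_nth0: "evk (Some (a, b)) g $$ 0 = valk a b g"
  by (simp add: evk_def valk_def evR_affine_nth0)

lemma evk_affine_pos:
  "evk (Some (a, b)) g \<noteq> 0 \<Longrightarrow> fls_subdegree (evk (Some (a, b)) g) > 0 \<longleftrightarrow> valk a b g = 0"
  by (simp add: evk_def valk_def evR_affine_pos)

text \<open>The two-variable form of the fact that x' - x divides g(x') - g(x).\<close>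

lemma diff_in_ideal:
  fixes x y x' y' :: "'k poly poly"
  shows "\<exists>u v. ev2 cst2 x' y' g - ev2 cst2 x y g = (x' - x) * u + (y' - y) * v"
proof -
  interpret c: cr_hom "cst2 :: 'k \<Rightarrow> _" by (rule cr_hom_cst2)
  show ?thesis
  proof (induction g rule: poly2_induct)
    case (const c)
    show ?case by (intro exI[of _ 0]) (simp add: c.ev2_base)
  next
    case X
    show ?case by (intro exI[of _ 1] exI[of _ 0]) (simp add: c.ev2_base)
  next
    case Y
    show ?case by (intro exI[of _ 0] exI[of _ 1]) (simp add: c.ev2_base)
  next
    case (add f g)
    then obtain u v u' v' where
      uv: "ev2 cst2 x' y' f - ev2 cst2 x y f = (x' - x) * u + (y' - y) * v"
      "ev2 cst2 x' y' g - ev2 cst2 x y g = (x' - x) * u' + (y' - y) * v'" by blast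
    have "ev2 cst2 x' y' (f + g) - ev2 cst2 x y (f + g) =
      (ev2 cst2 x' y' f - ev2 cst2 x y f) + (ev2 cst2 x' y' g - ev2 cst2 x y g)"
      by (simp add: c.ev2_homs)
    also have "\<dots> = (x' - x) * (u + u') + (y' - y) * (v + v')"
      unfolding uv by (simp add: algebra_simps)
    finally show ?case by blast
  next
    case (mult f g)
    then obtain u v u' v' where
      uv: "ev2 cst2 x' y' f - ev2 cst2 x y f = (x' - x) * u + (y' - y) * v"
      "ev2 cst2 x' y' g - ev2 cst2 x y g = (x' - x) * u' + (y' - y) * v'" by blast
    have "ev2 cst2 x' y' (f * g) - ev2 cst2 x y (f * g) =
      (ev2 cst2 x' y' f - ev2 cst2 x y f) * ev2 cst2 x' y' g +
      ev2 cst2 x y f * (ev2 cst2 x' y' g - ev2 cst2 x y g)"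
      by (simp add: c.ev2_homs algebra_simps)
    also have "\<dots> = (x' - x) * (u * ev2 cst2 x' y' g + ev2 cst2 x y f * u') +
        (y' - y) * (v * ev2 cst2 x' y' g + ev2 cst2 x y f * v')"
      unfolding uv by (simp add: algebra_simps)
    finally show ?case by blast
  qed
qed

text \<open>This power map is a ring homomorphism fixing all constants of \<open>k\<close>, so it is
  determined by the images of X and Y.\<close>

lemma power_eq_ev2: "(g :: 'k poly poly) ^ (Q ^ m) = ev2 cst2 (X2 ^ (Q ^ m)) (Y2 ^ (Q ^ m)) g"
proof -
  interpret c: cr_hom "cst2 :: 'k \<Rightarrow> _" by (rule cr_hom_cst2)
  have "cr_hom (\<lambda>g :: 'k poly poly. g ^ (Q ^ m))"
    unfolding Q_pow by (rule frob_cr_hom) simp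
  moreover have "cst2 (c :: 'k) ^ (Q ^ m) = cst2 c" for c
    by (simp add: k_pow_Qn flip: c.hom_power)
  ultimately show ?thesis by (rule c.ev2_unique)
qed

lemma eq_ev2: "(g :: 'k poly poly) = ev2 cst2 X2 Y2 g"
  using cr_hom.ev2_unique[OF cr_hom_cst2 cr_hom_id] by simp

text \<open>
  With \<open>N\<close> a power of \<open>q\<^sup>2\<close> such that the point has coordinates in the field of \<open>N\<close> elements,
  \<open>g\<^sup>N - g = g(x\<^sup>N, y\<^sup>N) - g(x, y)\<close> lies in the ideal generated by \<open>x\<^sup>N - x\<close> and \<open>y\<^sup>N - y\<close>,
  and the equation of the curve expresses the second generator by the first one.
\<close>

lemma local_uniformizer:
  assumes R: "on_curve (Some (a, b))"
  obtains t where "fls_subdegree (evk (Some (a, b)) t) = 1"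
    "\<And>g. valk a b g = 0 \<Longrightarrow> \<exists>h g1. valk a b h \<noteq> 0 \<and> Cv dvd g * h - t * g1"
proof -
  obtain m where m: "m > 0" "a ^ (Q ^ m) = a" "b ^ (Q ^ m) = b"
    by (rule K_periodic2)
  define N where "N = Q ^ m"
  have N2: "N \<ge> 2" unfolding N_def using m(1) Q_ge self_le_power[of Q m] by linarith
  \<comment> \<open>As a^N = a, putting x = a + s turns this into s^N - s, which has order
    1.\<close>
  define t :: "'k poly poly" where "t = X2 ^ N - X2"
  define d :: "'k poly poly" where "d = Y2 ^ N - Y2"
  have frN: "(x + y) ^ N = x ^ N + y ^ N" "(x - y) ^ N = x ^ N - y ^ N"
    if "CHAR('b) = CHAR('k)" for x y :: "'b::comm_ring_1"
    unfolding N_def Q_pow using frob_add[OF that] frob_diff[OF that] by auto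
  have "evk (Some (a, b)) t = fps_to_fls ((fps_const a + fps_X) ^ N - (fps_const a + fps_X))"
    by (simp add: t_def evk.homs evk_base fps_to_fls_power)
  also have "(fps_const a + fps_X) ^ N = fps_const a + (fps_X ^ N :: 'k alg_closure fps)"
  proof -
    have "(fps_const a + fps_X) ^ N = fps_const a ^ N + (fps_X ^ N :: 'k alg_closure fps)"
      by (rule frN) simp
    then show ?thesis using m by (simp only: fps_const_power N_def)
  qed
  also have "fps_const a + fps_X ^ N - (fps_const a + fps_X) = fps_X ^ N - (fps_X :: 'k alg_closure fps)"
    by (rule add_diff_cancel_left)
  finally have et: "evk (Some (a, b)) t = fls_X ^ N - fls_X"
    by (simp add: fps_to_fls_power fps_X_to_fls)
  have "fls_subdegree (fls_X ^ N - fls_X :: 'k alg_closure fls) = 1"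
    using N2 by (subst fls_subdegree_diff_eq2) auto
  with et have 1: "fls_subdegree (evk (Some (a, b)) t) = 1" by simp
  have "\<exists>h g1. valk a b h \<noteq> 0 \<and> Cv dvd g * h - t * g1" if g: "valk a b g = 0" for g
  proof -
    obtain u v where uv: "g ^ N - g = t * u + d * v"
      using diff_in_ideal[of "X2 ^ N" "Y2 ^ N" g X2 Y2] power_eq_ev2[of g m] eq_ev2[of g]
      by (auto simp: N_def t_def d_def)
    have "d ^ q + d = (Y2 ^ q + Y2) ^ N - (Y2 ^ q + Y2)"
      by (simp add: d_def frob1_diff frN power_mult[symmetric] mult.commute)
    also have "Y2 ^ q + Y2 = Cv + (X2 ^ (q + 1) :: 'k poly poly)" by (simp add: Cv_def)
    also have "(Cv + X2 ^ (q + 1)) ^ N - (Cv + X2 ^ (q + 1)) =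
        Cv ^ N - Cv + ((X2 ^ N) ^ (q + 1) - X2 ^ (q + 1) :: 'k poly poly)"
      by (simp add: frN power_mult[symmetric] mult.commute del: power_Suc)
    finally have dq: "d ^ q + d = Cv ^ N - Cv + ((X2 ^ N) ^ (q + 1) - X2 ^ (q + 1))" .
    obtain r where r: "(X2 ^ N) ^ (q + 1) - X2 ^ (q + 1) = t * r"
      using diff_dvd_power_diff[of "X2 ^ N" X2 "q + 1"] unfolding t_def by (rule dvdE)
    have Cdvd: "Cv dvd Cv ^ N - (Cv :: 'k poly poly)"
      using N2 by (intro dvd_diff dvd_power) auto
    \<comment> \<open>The first factor completes g to g^N - g, the second completes d to d^q + d,
      which is a multiple of t modulo the curve. Where g and d vanish, h has the value -1.\<close>
    define h where "h = (g ^ (N - 1) - 1) * (1 + d ^ (q - 1))"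
    have gN: "g * g ^ (N - 1) = g ^ N" using N2 by (cases N) auto
    have dN: "d * d ^ (q - 1) = d ^ q" using q_pos by (cases q) auto
    have "g * h = (g * g ^ (N - 1) - g) * (1 + d ^ (q - 1))"
      by (simp add: h_def algebra_simps)
    also have "\<dots> = t * u * (1 + d ^ (q - 1)) + (d * d ^ (q - 1) + d) * v"
      unfolding gN uv by (simp add: algebra_simps)
    also have "\<dots> = t * (u * (1 + d ^ (q - 1)) + r * v) + (Cv ^ N - Cv) * v"
      unfolding dN dq r by (simp add: algebra_simps)
    finally have "g * h - t * (u * (1 + d ^ (q - 1)) + r * v) = (Cv ^ N - Cv) * v"
      by simp
    then have "Cv dvd g * h - t * (u * (1 + d ^ (q - 1)) + r * v)"
      using Cdvd by simp
    moreover have "valk a b d = 0"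
      using m by (simp add: d_def valk.homs valk_base N_def)
    then have "valk a b h = - 1"
      using g N2 q_ge_2 by (simp add: h_def valk.homs power_0_left)
    ultimately show ?thesis
      by (intro exI[of _ h] exI[of _ "u * (1 + d ^ (q - 1)) + r * v"]) simp
  qed
  with 1 show ?thesis using that by blast
qed

text \<open>Each division by t costs a factor that does not vanish at the point, and it lowers the
  order by one.\<close>

lemma local_structure:
  assumes R: "on_curve (Some (a, b))"
    and t: "fls_subdegree (evk (Some (a, b)) t) = 1"
    and t_local: "\<And>g. valk a b g = 0 \<Longrightarrow> \<exists>h g1. valk a b h \<noteq> 0 \<and> Cv dvd g * h - t * g1"
    and "\<not> Cv dvd g"
  shows "\<exists>h g'. valk a b h \<noteq> 0 \<and> valk a b g' \<noteq> 0 \<and>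
    Cv dvd g * h - t ^ nat (fls_subdegree (evk (Some (a, b)) g)) * g'"
  using assms(4)
proof (induction "nat (fls_subdegree (evk (Some (a, b)) g))" arbitrary: g)
  case 0
  have "evk (Some (a, b)) g \<noteq> 0" using 0(2) evk_eq_0_iff[OF R] by simp
  then have "valk a b g \<noteq> 0" using evk_affine_pos[of a b g] 0(1) by auto
  then show ?case unfolding 0(1)[symmetric]
    by (intro exI[of _ 1] exI[of _ g]) (simp add: valk.homs)
next
  case (Suc n)
  let ?R = "Some (a, b)"
  have nz: "evk ?R g \<noteq> 0" using Suc(3) evk_eq_0_iff[OF R] by simp
  have tnz: "evk ?R t \<noteq> 0" using t by auto
  have "valk a b g = 0" using evk_affine_pos[OF nz] Suc(2) by auto
  then obtain h g1 where h: "valk a b h \<noteq> 0" "Cv dvd g * h - t * g1"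
    using t_local by blast
  have hnz: "evk ?R h \<noteq> 0" using h(1) evk_affine_nth0[of a b h] by auto
  have sh: "fls_subdegree (evk ?R h) = 0"
    using evk_affine_pos[OF hnz] evk_affine_ge0[of a b h] h(1) by auto
  have eq: "evk ?R g * evk ?R h = evk ?R t * evk ?R g1"
    using evk_cong[OF R h(2)] by (simp add: evk.homs)
  have g1nz: "evk ?R g1 \<noteq> 0" using eq nz hnz by auto
  have "fls_subdegree (evk ?R g) = 1 + fls_subdegree (evk ?R g1)"
    using arg_cong[OF eq, of fls_subdegree] nz hnz tnz g1nz sh t by simp
  then have n: "n = nat (fls_subdegree (evk ?R g1))" using Suc(2) by simp
  obtain h' g' where h': "valk a b h' \<noteq> 0" "valk a b g' \<noteq> 0" "Cv dvd g1 * h' - t ^ n * g'"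
    using Suc(1)[OF n] g1nz evk_eq_0_iff[OF R] n by auto
  have "g * (h * h') - t ^ Suc n * g' = (g * h - t * g1) * h' + t * (g1 * h' - t ^ n * g')"
    by (simp add: algebra_simps)
  then have "Cv dvd g * (h * h') - t ^ Suc n * g'"
    using h(2) h'(3) by simp
  then show ?case
    unfolding Suc(2)[symmetric] using h(1) h'
    by (intro exI[of _ "h * h'"] exI[of _ g']) (simp add: valk.homs)
qed

end

lemma fls_mult_nth_0:
  fixes f g :: "'a::comm_ring_1 fls"
  assumes "fls_subdegree f \<ge> 0" "fls_subdegree g \<ge> 0"
  shows "(f * g) $$ 0 = f $$ 0 * g $$ 0"
proof -
  obtain F G where "f = fps_to_fls F" "g = fps_to_fls G"
    using fls_regpart_to_fls_trivial assms by metis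
  then show ?thesis by (simp flip: fls_times_fps_to_fls)
qed

section \<open>The function field as a subfield of Laurent series\<close>

context hermitian
begin

declare xs.simps [simp del] ys.simps [simp del]

text \<open>The image of the function field under expansion at infinity, so that valuation rings can
  be studied with the arithmetic of a field type.\<close>

definition funs :: "'k alg_closure fls set" where
  "funs = {evk None g / evk None h | g h. \<not> Cv dvd h}"

lemma funsI: "\<not> Cv dvd h \<Longrightarrow> evk None g / evk None h \<in> funs"
  by (auto simp: funs_def)

lemma evk_in_funs: "evk None g \<in> funs"
  using funsI[OF Cv_not_dvd_1, of g] by (simp add: evk.homs)

lemma funs_mult: "x \<in> funs \<Longrightarrow> y \<in> funs \<Longrightarrow> x * y \<in> funs"
  unfolding funs_def by (clarsimp simp flip: evk.hom_mult) (metis Cv_dvd_mult)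

lemma funs_inverse:
  assumes "x \<in> funs"
  shows "inverse x \<in> funs"
proof -
  obtain g h where gh: "x = evk None g / evk None h" "\<not> Cv dvd h"
    using assms by (auto simp: funs_def)
  show ?thesis
  proof (cases "Cv dvd g")
    case True
    then have "evk None g = 0" by (simp only: evk_None_eq_0_iff)
    then show ?thesis using gh(1) evk_in_funs[of 0] by (simp add: evk.hom_0)
  next
    case False
    then show ?thesis using gh(1) funsI[of g h] by simp
  qed
qed

end

locale herm_val = hermitian q ty + val_subring funs W
  for q and ty :: "'k::field itself" and W :: "'k alg_closure fls set" +
  assumes const_W: "fls_const (to_ac c) \<in> W"
    and W_proper: "W \<noteq> funs"
begin

lemma const_notin_M: "c \<noteq> 0 \<Longrightarrow> fls_const (to_ac c) \<notin> M"
  using const_W[of "inverse c"] by (auto simp: M_def fls_inverse_const)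

lemma evk_W:
  assumes "xs None \<in> W" "ys None \<in> W"
  shows "evk None g \<in> W"
  by (induction g rule: poly2_induct)
    (use assms in \<open>auto simp: evk_base evk.homs const_W intro: W_add W_mult\<close>)

lemma exists_nonzero_M: "\<exists>x\<in>M. x \<noteq> 0"
proof -
  obtain z where "z \<in> funs" "z \<notin> W" using W_proper W_E by blast
  moreover from this have "inverse z \<in> W" "z \<noteq> 0" using W_val W_0 by auto
  ultimately show ?thesis by (intro bexI[of _ "inverse z"]) (auto simp: M_def)
qed

text \<open>The point is found one coordinate at a time. The norm yields a nonzero polynomial in x
  lying in \<open>M\<close>, and a is a root of one of least degree. If every point over a failed to
  be the centre, the product of the witnesses would vanish on the whole fibre without lying in
  \<open>M\<close>.\<close>

lemma affine_center:
  assumes x: "xs None \<in> W" and y: "ys None \<in> W"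
  shows "\<exists>a b. on_curve (Some (a, b)) \<and> (\<forall>g. valk a b g = 0 \<longrightarrow> evk None g \<in> M)"
proof -
  note W = evk_W[OF assms]
  let ?I = "\<lambda>D :: 'k poly. evk None [:D:] \<in> M"
  have hom_const: "evk None [:c * d:] = evk None [:c:] * evk None [:d:]" for c d
    using evk.hom_mult[of None "[:c:]" "[:d:]"] by (simp add: mult.commute)
  have ex: "\<exists>D. D \<noteq> 0 \<and> ?I D"
  proof -
    obtain z where z: "z \<in> M" "z \<noteq> 0" using exists_nonzero_M by blast
    have "z \<in> funs" using M_W[OF z(1)] W_E by (rule subsetD[rotated])
    then obtain g h where gh: "z = evk None g / evk None h" "\<not> Cv dvd h"
      unfolding funs_def by blast
    then have hnz: "evk None h \<noteq> 0" by (simp add: evk_None_eq_0_iff)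
    have "z * evk None h \<in> M" using z(1) W by (rule M_absorb)
    then have g: "evk None g \<in> M" using gh hnz by simp
    have "\<not> Cv dvd g" using z(2) gh by (simp add: evk_None_eq_0_iff[symmetric])
    then obtain c D where D: "Cv dvd g * c - [:D:]" "D \<noteq> 0" using norm_ex[of g] by blast
    have "evk None [:D:] = evk None g * evk None c"
      using evk_cong[OF _ D(1), of None] by (simp add: evk.homs)
    then show ?thesis using g W D(2) M_absorb by auto
  qed
  define n where "n = (LEAST n. \<exists>D. D \<noteq> 0 \<and> ?I D \<and> degree D = n)"
  have "\<exists>D. D \<noteq> 0 \<and> ?I D \<and> degree D = n"
    unfolding n_def by (rule LeastI_ex) (use ex in blast)
  then obtain D where D: "D \<noteq> 0" "?I D" "degree D = n" by blast
  have min: "n \<le> degree D'" if "D' \<noteq> 0" "?I D'" for D'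
    unfolding n_def by (rule Least_le) (use that in blast)
  have "degree D \<noteq> 0"
  proof
    assume "degree D = 0"
    then obtain c where c: "D = [:c:]" "c \<noteq> 0" using D(1) by (auto elim: degree_eq_zeroE)
    then show False using D(2) const_notin_M[of c] evk_base(1)[of None c] by (simp add: cst2_def)
  qed
  moreover have "degree (map_poly to_ac D) = degree D" by (rule degree_map_poly) simp
  ultimately obtain a where a: "poly (map_poly to_ac D) a = 0"
    using alg_closed_imp_poly_has_root[of "map_poly to_ac D"] by auto
  interpret e: cr_hom "\<lambda>p. poly (map_poly to_ac p) a"
    by (intro cr_hom_ev1 cr_hom_to_ac)
  define m where "m = (LEAST n. \<exists>c :: 'k poly. c \<noteq> 0 \<and> poly (map_poly to_ac c) a = 0 \<and> degree c = n)"
  have "\<exists>c :: 'k poly. c \<noteq> 0 \<and> poly (map_poly to_ac c) a = 0 \<and> degree c = m"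
    unfolding m_def by (rule LeastI_ex) (use D(1) a in blast)
  then obtain P :: "'k poly" where P: "P \<noteq> 0" "poly (map_poly to_ac P) a = 0" "degree P = m" by blast
  have minm: "m \<le> degree c" if "c \<noteq> 0" "poly (map_poly to_ac c) a = 0" for c :: "'k poly"
    unfolding m_def by (rule Least_le) (use that in blast)
  have P_dvd: "P dvd c" if "poly (map_poly to_ac c) a = 0" for c
  proof (rule ccontr)
    assume "\<not> P dvd c"
    then have nz: "c mod P \<noteq> 0" by (simp add: mod_eq_0_iff_dvd)
    have "poly (map_poly to_ac (c div P * P + c mod P)) a = 0" using that by simp
    then have "poly (map_poly to_ac (c mod P)) a = 0"
      unfolding e.hom_add e.hom_mult P(2) by simp
    then have "m \<le> degree (c mod P)" using nz by (intro minm)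
    moreover have "degree (c mod P) < degree P"
      using degree_mod_less[OF P(1), of c] nz by blast
    ultimately show False using P(3) by simp
  qed
  have degP: "degree P \<noteq> 0"
  proof
    assume "degree P = 0"
    then obtain c where "P = [:c:]" "c \<noteq> 0" using P(1) by (auto elim: degree_eq_zeroE)
    then show False using P(2) by (simp add: map_poly_pCons)
  qed
  \<comment> \<open>\<open>P\<close> is the minimal polynomial of a. Since \<open>D\<close> has
    least degree among the nonzero polynomials in x that lie in \<open>M\<close>, its cofactor lies
    outside, and primeness leaves \<open>P\<close>.\<close>
  have P_M: "?I P"
  proof -
    obtain e where e: "D = P * e" using P_dvd[OF a] by (rule dvdE)
    then have ne: "e \<noteq> 0" using D(1) by auto
    have "degree D = degree P + degree e"
      unfolding e by (rule degree_mult_eq) (use P(1) ne in auto)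
    then have "\<not> ?I e" using min[of e] ne degP D(3) by auto
    then show ?thesis
      using D(2) M_prime[OF W W, of "[:P:]" "[:e:]"] by (auto simp: e hom_const)
  qed
  have vanish: "?I c" if "poly (map_poly to_ac c) a = 0" for c
    using P_dvd[OF that] M_absorb[OF P_M W] by (auto simp: hom_const elim!: dvdE)
  have "\<exists>b. b ^ q + b = a ^ (q + 1) \<and> (\<forall>g. valk a b g = 0 \<longrightarrow> evk None g \<in> M)"
  proof (rule ccontr)
    assume "\<not> ?thesis"
    then have "\<forall>b\<in>{b. b ^ q + b = a ^ (q + 1)}. \<exists>g. valk a b g = 0 \<and> evk None g \<notin> M"
      by blast
    from bchoice[OF this] obtain g where g: "\<And>b. b ^ q + b = a ^ (q + 1) \<Longrightarrow>
      valk a b (g b) = 0 \<and> evk None (g b) \<notin> M"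
      by blast
    let ?B = "{b. b ^ q + b = a ^ (q + 1)}"
    have fin: "finite ?B"
    proof -
      let ?p = "monom 1 q + [:- (a ^ (q + 1)), 1:]"
      have "degree ?p = q"
        using q_ge_2 by (subst degree_add_eq_left) (auto simp: degree_monom_eq)
      then have "?p \<noteq> 0" using q_pos by auto
      from poly_roots_finite[OF this] show ?thesis
        by (simp add: poly_monom algebra_simps)
    qed
    \<comment> \<open>By primeness \<open>G\<close> stays outside \<open>M\<close>. But it vanishes
      over a, so the coefficients of its remainder modulo \<open>Cv\<close> are multiples of
      \<open>P\<close>, which forces it into \<open>M\<close>.\<close>
    define G where "G = prod g ?B"
    have G_M: "evk None G \<notin> M"
    proof -
      have "evk None (g b) \<in> W \<and> evk None (g b) \<notin> M" if "b \<in> ?B" for b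
        using W g that by blast
      from prod_notin_M[of ?B "\<lambda>b. evk None (g b)", OF this] show ?thesis
        unfolding G_def evk.hom_prod by blast
    qed
    have G_van: "valk a b G = 0" if "b \<in> ?B" for b
      unfolding G_def valk.hom_prod using fin that g by (intro prod_zero) auto
    obtain r where r: "Cv dvd G - r" "r = 0 \<or> degree r < degree (Cv :: 'k poly poly)"
      using monic_division[OF Cv_monic(2)] .
    have deg_r: "degree r < q" using r(2) q_pos by (auto simp: Cv_monic)
    have r_van: "val2 a b (map_poly2 to_ac r) = 0" if "b ^ q + b = a ^ (q + 1)" for b
    proof -
      obtain s where s: "G - r = Cv * s" using r(1) by (rule dvdE)
      have "valk a b (G - r) = valk a b Cv * valk a b s" unfolding s by (rule valk.hom_mult)
      moreover have "valk a b Cv = 0" using that by (simp add: Cv_def valk.homs valk_base)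
      ultimately have "valk a b G = valk a b r" by (simp add: valk.homs)
      then show ?thesis using G_van that by (simp add: valk_def)
    qed
    have coeffs: "?I (coeff r j)" for j
    proof (rule vanish)
      have "poly (coeff (map_poly2 to_ac r) j) a = 0"
        by (rule fiber_vanish) (use deg_r r_van in \<open>auto simp: degree_map2_to_ac\<close>)
      then show "poly (map_poly to_ac (coeff r j)) a = 0"
        by (simp add: map_poly2_def coeff_map_poly)
    qed
    have "r = (\<Sum>j\<le>degree r. [:coeff r j:] * Y2 ^ j)"
      using poly_as_sum_of_monoms[of r] by (simp add: monom_altdef Y2_def)
    then have "evk None r = (\<Sum>j\<le>degree r. evk None [:coeff r j:] * evk None (Y2 ^ j))"
      by (metis (no_types, lifting) evk.hom_mult evk.hom_sum sum.cong)
    also have "\<dots> \<in> M" using coeffs W by (intro M_sum M_absorb)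
    finally have "evk None r \<in> M" .
    then show False using G_M evk_cong[OF _ r(1), of None] by simp
  qed
  then show ?thesis unfolding on_curve.simps by (rule exI[of _ a])
qed

text \<open>Numerator and denominator are powers of the same t up to functions that are nonzero at
  the centre. Such functions are units of \<open>W\<close>, so comparing the exponents of t
  suffices.\<close>

lemma affine_place:
  assumes x: "xs None \<in> W" and y: "ys None \<in> W"
  shows "\<exists>a b. on_curve (Some (a, b)) \<and> (\<forall>g h. \<not> Cv dvd h \<longrightarrow> evk (Some (a, b)) g = 0 \<or>
    fls_subdegree (evk (Some (a, b)) h) \<le> fls_subdegree (evk (Some (a, b)) g) \<longrightarrow>
    evk None g / evk None h \<in> W)"
proof -
  note W = evk_W[OF assms]
  obtain a b where R: "on_curve (Some (a, b))"
    and center: "\<And>g. valk a b g = 0 \<Longrightarrow> evk None g \<in> M"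
    using affine_center[OF assms] by blast
  \<comment> \<open>The value lies in a finite field, so g^(Q^m - 1) - 1 vanishes at the centre and
    belongs to \<open>M\<close>. With g in \<open>M\<close>, this would put 1 into
    \<open>M\<close>.\<close>
  have unit: "evk None g \<notin> M" if "valk a b g \<noteq> 0" for g
  proof
    assume gM: "evk None g \<in> M"
    obtain m where m: "m > 0" "valk a b g ^ (Q ^ m) = valk a b g" using K_periodic by blast
    have N2: "Q ^ m \<ge> 2" using m(1) Q_ge self_le_power[of Q m] by linarith
    have "valk a b g * valk a b g ^ (Q ^ m - 1) = valk a b g"
      using m(2) N2 by (cases "Q ^ m") auto
    then have "valk a b g ^ (Q ^ m - 1) = 1" using that by simp
    then have "valk a b (g ^ (Q ^ m - 1) - 1) = 0" by (simp add: valk.homs)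
    then have "evk None (g ^ (Q ^ m - 1) - 1) \<in> M" by (rule center)
    then have 1: "evk None g ^ (Q ^ m - 1) - 1 \<in> M" by (simp add: evk.homs)
    have 2: "evk None g ^ (Q ^ m - 1) \<in> M" using N2 by (intro M_power[OF gM]) simp
    have "evk None g ^ (Q ^ m - 1) - (evk None g ^ (Q ^ m - 1) - 1) \<in> M"
      by (rule M_diff[OF 2 1])
    then show False using one_notin_M by simp
  qed
  obtain t where t: "fls_subdegree (evk (Some (a, b)) t) = 1"
    and t_local: "\<And>g. valk a b g = 0 \<Longrightarrow> \<exists>h g1. valk a b h \<noteq> 0 \<and> Cv dvd g * h - t * g1"
    using local_uniformizer[OF R] by blast
  have struct: "\<exists>h g'. valk a b h \<noteq> 0 \<and> valk a b g' \<noteq> 0 \<and>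
    Cv dvd g * h - t ^ nat (fls_subdegree (evk (Some (a, b)) g)) * g'" if "\<not> Cv dvd g" for g
    by (rule local_structure[OF R t t_local that])
  have "evk None g / evk None h \<in> W" if hd: "\<not> Cv dvd h" and
    le: "evk (Some (a, b)) g = 0 \<or>
      fls_subdegree (evk (Some (a, b)) h) \<le> fls_subdegree (evk (Some (a, b)) g)" for g h
  proof (cases "Cv dvd g")
    case True
    then have "evk None g = 0" by (simp only: evk_None_eq_0_iff)
    then show ?thesis using W_0 by simp
  next
    case False
    define m n where "m = nat (fls_subdegree (evk (Some (a, b)) g))"
      and "n = nat (fls_subdegree (evk (Some (a, b)) h))"
    have "n \<le> m" using le False evk_eq_0_iff[OF R] by (auto simp: m_def n_def)
    obtain h1 g1 where 1: "valk a b h1 \<noteq> 0" "valk a b g1 \<noteq> 0" "Cv dvd g * h1 - t ^ m * g1"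
      using struct[OF False] unfolding m_def by blast
    obtain h2 g2 where 2: "valk a b h2 \<noteq> 0" "valk a b g2 \<noteq> 0" "Cv dvd h * h2 - t ^ n * g2"
      using struct[OF hd] unfolding n_def by blast
    have inv: "inverse (evk None h1) \<in> W \<and> evk None h1 \<noteq> 0" "inverse (evk None h2) \<in> W \<and> evk None h2 \<noteq> 0"
      "inverse (evk None g2) \<in> W \<and> evk None g2 \<noteq> 0"
      using 1 2 unit W by (auto intro!: inverse_W)
    have t0: "evk None t \<noteq> 0" using t evk_eq_0_iff[OF R, of t] by (auto simp: evk_None_eq_0_iff)
    have eg: "evk None g * evk None h1 = evk None t ^ m * evk None g1"
      using evk_cong[OF _ 1(3), of None] by (simp add: evk.homs)
    have eh: "evk None h * evk None h2 = evk None t ^ n * evk None g2"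
      using evk_cong[OF _ 2(3), of None] by (simp add: evk.homs)
    have h0: "evk None h \<noteq> 0" using hd by (simp add: evk_None_eq_0_iff)
    have "evk None g / evk None h = (evk None g * evk None h1) / (evk None h * evk None h2)
        * (evk None h2 / evk None h1)"
      using inv h0 by (simp add: field_simps)
    also have "\<dots> = (evk None t ^ m * evk None g1) / (evk None t ^ n * evk None g2) * (evk None h2 / evk None h1)"
      unfolding eg eh ..
    also have "\<dots> = evk None t ^ (m - n) * evk None g1 * inverse (evk None g2) * evk None h2 * inverse (evk None h1)"
      using inv t0 \<open>n \<le> m\<close> by (simp add: power_diff field_simps)
    also have "\<dots> \<in> W" using inv W by (intro W_mult W_power) auto
    finally show ?thesis .
  qed
  then show ?thesis using R by blast
qed

text \<open>
  With \<open>t = x/y\<close>, each monomial \<open>x\<^sup>i y\<^sup>j\<close> is \<open>t\<close> to the power \<open>-(q i + (q + 1) j)\<close> times a unit with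
  residue \<open>1\<close>, so every polynomial in \<open>x\<close> and \<open>y\<close> is a power of \<open>t\<close> times a unit.
\<close>

lemma infinite_place:
  assumes y: "ys None \<notin> W" and h: "\<not> Cv dvd h"
    and le: "evk None g = 0 \<or> fls_subdegree (evk None h) \<le> fls_subdegree (evk None g)"
  shows "evk None g / evk None h \<in> W"
proof -
  define w where "w = inverse (ys None)"
  have y_E: "ys None \<in> funs" and x_E: "xs None \<in> funs"
    using evk_in_funs[of Y2] evk_in_funs[of X2] by (simp_all add: evk_base)
  have y0: "ys None \<noteq> 0" using w_inf(2) by (simp add: ys.simps)
  have x0: "xs None \<noteq> 0" using w_inf(2) by (simp add: xs.simps)
  have wW: "w \<in> W" using W_val[OF y_E y0] y by (simp add: w_def)
  then have wM: "w \<in> M" using y y0 by (simp add: M_def w_def)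
  define t where "t = xs None / ys None"
  have eq: "xs None ^ (q + 1) = ys None ^ q + ys None" using point_eq[of None] by simp
  have tq: "t ^ (q + 1) = w + w ^ q"
  proof -
    have "t ^ (q + 1) = ys None ^ q / ys None ^ (q + 1) + ys None / ys None ^ (q + 1)"
      unfolding t_def power_divide eq add_divide_distrib ..
    moreover have "ys None ^ q / ys None ^ (q + 1) = w" "ys None / ys None ^ (q + 1) = w ^ q"
      using y0 by (simp_all add: w_def divide_inverse power_inverse)
    ultimately show ?thesis by simp
  qed
  have tqM: "t ^ (q + 1) \<in> M"
    unfolding tq using wM q_pos by (intro M_add M_power) auto
  have t_E: "t \<in> funs" unfolding t_def divide_inverse using x_E y_E by (intro funs_mult funs_inverse)
  have tW: "t \<in> W" using integral_W[OF t_E, of q] M_W[OF tqM] by simp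
  have tM: "t \<in> M" using power_notin_M[OF tW] tqM by blast
  have t0: "t \<noteq> 0" using x0 y0 by (simp add: t_def)
  have st: "fls_subdegree t = 1"
    using w_inf by (simp add: t_def fls_divide_subdegree xs.simps ys.simps)
  have sw: "fls_subdegree w = int q + 1"
    using w_inf by (simp add: w_def ys.simps)
  define u where "u = 1 + w ^ (q - 1)"
  have wq: "w * w ^ (q - 1) = w ^ q"
    by (subst mult.commute, rule power_minus_mult[OF q_pos])
  have yt: "ys None * t ^ (q + 1) = u"
  proof -
    have "w * u = w + w ^ q" using wq by (simp add: u_def algebra_simps)
    then have "w * u = t ^ (q + 1)" using tq by simp
    then show ?thesis using y0 by (simp add: w_def field_simps)
  qed
  have xt: "xs None * t ^ q = u"
  proof -
    have "xs None = t * ys None" using y0 by (simp add: t_def)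
    then show ?thesis using yt by (simp add: mult_ac)
  qed
  \<comment> \<open>Elements whose residue modulo \<open>M\<close> and whose constant coefficient
    are given by the same s in \<open>k\<close>. This links the abstract ring \<open>W\<close> to
    the expansion: order 0 gives a nonzero s, hence a unit of \<open>W\<close>.\<close>
  define P where "P = (\<lambda>z. z \<in> W \<and> fls_subdegree z \<ge> 0 \<and>
    (\<exists>s. z - fls_const (to_ac s) \<in> M \<and> z $$ 0 = to_ac s))"
  have P_const: "P (fls_const (to_ac c))" for c
    using const_W M_0 by (auto simp: P_def)
  have nth_nonneg: "z $$ k = 0" if "fls_subdegree z \<ge> 0" "k < 0" for z :: "'k alg_closure fls" and k
    using that by (intro fls_eq0_below_subdegree) simp
  have P_add: "P (z + z')" if "P z" "P z'" for z z'
  proof -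
    from that obtain s s' where s: "z - fls_const (to_ac s) \<in> M" "z $$ 0 = to_ac s"
      "z' - fls_const (to_ac s') \<in> M" "z' $$ 0 = to_ac s'" unfolding P_def by blast
    have "(z - fls_const (to_ac s)) + (z' - fls_const (to_ac s')) = z + z' - fls_const (to_ac (s + s'))"
      by (simp flip: fls_plus_const)
    then have "z + z' - fls_const (to_ac (s + s')) \<in> M" using M_add s by metis
    moreover have "fls_subdegree (z + z') \<ge> 0"
      using that nth_nonneg by (intro fls_subdegree_ge0I) (auto simp: P_def)
    ultimately show ?thesis using that W_add s by (auto simp: P_def intro!: exI[of _ "s + s'"])
  qed
  have P_mult: "P (z * z')" if "P z" "P z'" for z z'
  proof -
    from that obtain s s' where s: "z - fls_const (to_ac s) \<in> M" "z $$ 0 = to_ac s"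
      "z' - fls_const (to_ac s') \<in> M" "z' $$ 0 = to_ac s'" unfolding P_def by blast
    have "(z - fls_const (to_ac s)) * z' + fls_const (to_ac s) * (z' - fls_const (to_ac s'))
        = z * z' - fls_const (to_ac (s * s'))"
      by (simp add: algebra_simps)
    moreover have "(z - fls_const (to_ac s)) * z' + fls_const (to_ac s) * (z' - fls_const (to_ac s')) \<in> M"
      using s that const_W by (intro M_add M_absorb M_absorb') (auto simp: P_def)
    ultimately have "z * z' - fls_const (to_ac (s * s')) \<in> M" by simp
    moreover have "fls_subdegree (z * z') \<ge> 0"
      using that by (cases "z = 0 \<or> z' = 0") (auto simp: P_def)
    moreover have "(z * z') $$ 0 = z $$ 0 * z' $$ 0"
      using that by (intro fls_mult_nth_0) (auto simp: P_def)
    ultimately show ?thesis using that W_mult s by (auto simp: P_def intro!: exI[of _ "s * s'"])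
  qed
  have P_M: "P z" if "z \<in> M" "fls_subdegree z > 0" for z
    using that M_W[OF that(1)] by (auto simp: P_def intro!: exI[of _ 0])
  have P_power: "P (z ^ n)" if "P z" for z n
    using that P_const[of 1] P_mult by (induction n) auto
  have P_sum: "P (sum f A)" if "\<And>i. i \<in> A \<Longrightarrow> P (f i)" for f :: "nat \<times> nat \<Rightarrow> _" and A
    using that P_const[of 0] P_add by (induction A rule: infinite_finite_induct) auto
  have Pt: "P t" using tM st by (intro P_M) auto
  have Pu: "P u"
  proof -
    have "P w" using wM sw by (intro P_M) auto
    then show ?thesis unfolding u_def using P_const[of 1] P_add P_power by simp
  qed
  have unit: "\<exists>m::nat. int m = - fls_subdegree (evk None f) \<and> P (t ^ m * evk None f) \<and> t ^ m * evk None f \<notin> M"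
    if nf: "\<not> Cv dvd f" for f
  proof -
    obtain r where r: "Cv dvd f - r" "r = 0 \<or> degree r < degree (Cv :: 'k poly poly)"
      using monic_division[OF Cv_monic(2)] .
    have fr: "evk None f = evk None r" using evk_cong[OF _ r(1)] by simp
    have r0: "r \<noteq> 0" using nf r(1) by auto
    then have deg_r: "degree r < q" using r(2) by (simp add: Cv_monic)
    define r' where "r' = map_poly2 to_ac r"
    have r': "r' \<noteq> 0" "degree r' < q" using r0 deg_r by (auto simp: r'_def map_poly2_to_ac_eq_0_iff degree_map2_to_ac)
    have coeff_r': "coeff (coeff r' j) i = to_ac (coeff (coeff r j) i)" for i j
      by (simp add: r'_def cr_hom.coeff_map2[OF cr_hom_to_ac])
    have er: "evk None r = evR None r'" by (simp add: evk_def r'_def)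
    note ord = inf_order[OF r']
    obtain i0 j0 where "(i0, j0) \<in> supp2 r'" using supp2_nonempty[OF r'(1)] by auto
    then have "coeff (coeff r' j0) i0 \<noteq> 0" by (simp add: supp2_def)
    from ord(2)[OF this] have "- fls_subdegree (evR None r') \<ge> 0"
      by (rule order_trans[OF of_nat_0_le_iff])
    then obtain m where m: "int m = - fls_subdegree (evR None r')"
      using zero_le_imp_eq_int by metis
    have "t ^ m * evk None r = (\<Sum>(i, j)\<in>supp2 r'. fls_const (coeff (coeff r' j) i) * u ^ (i + j) * t ^ (m - (q * i + (q + 1) * j)))"
      unfolding er unfolding evR_def ev2_supp2[OF cr_hom_fls_const] sum_distrib_left
    proof (rule sum.cong[OF refl], clarify)
      fix i j assume "(i, j) \<in> supp2 r'"
      then have "int (q * i + (q + 1) * j) \<le> int m" using ord(2) m by (auto simp: supp2_def)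
      then have le: "q * i + (q + 1) * j \<le> m" by linarith
      have "t ^ m = t ^ (m - (q * i + (q + 1) * j)) * ((t ^ q) ^ i * (t ^ (q + 1)) ^ j)"
        unfolding power_mult[symmetric] power_add[symmetric] using le by simp
      then have "t ^ m * (fls_const (coeff (coeff r' j) i) * xs None ^ i * ys None ^ j) =
        fls_const (coeff (coeff r' j) i) * ((xs None * t ^ q) ^ i * (ys None * t ^ (q + 1)) ^ j)
          * t ^ (m - (q * i + (q + 1) * j))"
        by (simp add: power_mult_distrib mult_ac del: power_Suc)
      also have "\<dots> = fls_const (coeff (coeff r' j) i) * u ^ (i + j) * t ^ (m - (q * i + (q + 1) * j))"
        by (simp only: xt yt power_add[of u])
      finally show "t ^ m * (fls_const (coeff (coeff r' j) i) * xs None ^ i * ys None ^ j) =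
        fls_const (coeff (coeff r' j) i) * u ^ (i + j) * t ^ (m - (q * i + (q + 1) * j))" .
    qed
    also have "P \<dots>"
      by (intro P_sum) (auto simp: coeff_r' intro!: P_mult P_const P_power Pu Pt)
    finally have Pm: "P (t ^ m * evk None r)" .
    have nz: "t ^ m * evk None r \<noteq> 0" using t0 ord(1) by (simp add: er)
    have sd: "fls_subdegree (t ^ m * evk None r) = 0"
      using t0 ord(1) st m by (simp add: er fls_subdegree_pow)
    obtain s where s: "t ^ m * evk None r - fls_const (to_ac s) \<in> M" "(t ^ m * evk None r) $$ 0 = to_ac s"
      using Pm unfolding P_def by blast
    have "s \<noteq> 0" using s(2) nth_fls_subdegree_nonzero[OF nz] unfolding sd by auto
    have "t ^ m * evk None r \<notin> M"
    proof
      assume "t ^ m * evk None r \<in> M"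
      from M_diff[OF this s(1)] show False using const_notin_M[OF \<open>s \<noteq> 0\<close>] by simp
    qed
    then show ?thesis using m Pm fr er by auto
  qed
  show ?thesis
  proof (cases "Cv dvd g")
    case True
    then have "evk None g = 0" by (simp only: evk_None_eq_0_iff)
    then show ?thesis using W_0 by simp
  next
    case False
    then have g0: "evk None g \<noteq> 0" by (simp add: evk_None_eq_0_iff)
    have h0: "evk None h \<noteq> 0" using h by (simp add: evk_None_eq_0_iff)
    obtain m where m: "int m = - fls_subdegree (evk None g)" "P (t ^ m * evk None g)"
      using unit[OF False] by blast
    obtain n where n: "int n = - fls_subdegree (evk None h)" "P (t ^ n * evk None h)" "t ^ n * evk None h \<notin> M"
      using unit[OF h] by blast
    have "m \<le> n" using m n le g0 by simp
    have inv: "inverse (t ^ n * evk None h) \<in> W" using inverse_W[of "t ^ n * evk None h"] n by (auto simp: P_def)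
    have "evk None g / evk None h = t ^ (n - m) * (t ^ m * evk None g) * inverse (t ^ n * evk None h)"
      using h0 t0 \<open>m \<le> n\<close> by (simp add: power_diff field_simps)
    also have "\<dots> \<in> W"
    proof -
      have "t ^ m * evk None g \<in> W" using m(2) by (simp add: P_def)
      from W_mult[OF W_mult[OF W_power[OF tW] this] inv] show ?thesis .
    qed
    finally show ?thesis .
  qed
qed

text \<open>If y lies in \<open>W\<close>, then x is integral and the centre is finite; otherwise
  1/y lies in \<open>M\<close> and the centre is the point at infinity. The conclusion says that
  \<open>W\<close> contains the valuation ring of the point.\<close>

theorem place_center:
  "\<exists>R. on_curve R \<and> (\<forall>g h. \<not> Cv dvd h \<longrightarrow> evk R g = 0 \<or>
    fls_subdegree (evk R h) \<le> fls_subdegree (evk R g) \<longrightarrow> evk None g / evk None h \<in> W)"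
proof (cases "ys None \<in> W")
  case True
  have "xs None ^ Suc q = ys None ^ q + ys None" using point_eq[of None] by simp
  also have "\<dots> \<in> W" using True by (intro W_add W_power)
  finally have "xs None \<in> W"
    using integral_W[of "xs None" q] evk_in_funs[of X2] by (simp add: evk_base)
  then show ?thesis using affine_place True by blast
next
  case False
  then show ?thesis using infinite_place by (intro exI[of _ None]) auto
qed

end

section \<open>Places given by discrete valuations\<close>

text \<open>The value of \<open>v\<close> at zero is left open, so the axioms exclude zero and the
  ring and ideal below admit it explicitly.\<close>

locale disc_val = Ring.field F for F :: "('a, 'b) ring_scheme" (structure) +
  fixes v :: "'a \<Rightarrow> int"
  assumes v_mult: "\<And>x y. x \<in> carrier F \<Longrightarrow> y \<in> carrier F \<Longrightarrow> x \<noteq> \<zero> \<Longrightarrow> y \<noteq> \<zero> \<Longrightarrow> v (x \<otimes> y) = v x + v y"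
    and v_add: "\<And>x y. x \<in> carrier F \<Longrightarrow> y \<in> carrier F \<Longrightarrow> x \<noteq> \<zero> \<Longrightarrow> y \<noteq> \<zero> \<Longrightarrow> x \<oplus> y \<noteq> \<zero> \<Longrightarrow>
      min (v x) (v y) \<le> v (x \<oplus> y)"
    and v_uniformizer: "\<exists>t\<in>carrier F. t \<noteq> \<zero> \<and> v t = 1"
begin

definition VR :: "'a set" where "VR = {z \<in> carrier F. z = \<zero> \<or> 0 \<le> v z}"
definition VM :: "'a set" where "VM = {z \<in> carrier F. z = \<zero> \<or> 0 < v z}"

lemma inv_closed: "x \<in> carrier F \<Longrightarrow> x \<noteq> \<zero> \<Longrightarrow> inv x \<in> carrier F"
  and inv_nonzero: "x \<in> carrier F \<Longrightarrow> x \<noteq> \<zero> \<Longrightarrow> inv x \<noteq> \<zero>"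
  and inv_right: "x \<in> carrier F \<Longrightarrow> x \<noteq> \<zero> \<Longrightarrow> x \<otimes> inv x = \<one>"
  and inv_left: "x \<in> carrier F \<Longrightarrow> x \<noteq> \<zero> \<Longrightarrow> inv x \<otimes> x = \<one>"
proof -
  assume x: "x \<in> carrier F" "x \<noteq> \<zero>"
  then have "x \<in> Units F" using field_Units by blast
  then show *: "inv x \<in> carrier F" "x \<otimes> inv x = \<one>" "inv x \<otimes> x = \<one>" by auto
  show "inv x \<noteq> \<zero>"
  proof
    assume "inv x = \<zero>"
    then have "\<one> = \<zero>" using *(2) x by simp
    then show False by simp
  qed
qed

lemma v_one: "v \<one> = 0"
  using v_mult[of \<one> \<one>] by simp

lemma v_inv: "x \<in> carrier F \<Longrightarrow> x \<noteq> \<zero> \<Longrightarrow> v (inv x) = - v x"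
  using v_mult[of x "inv x"] inv_closed[of x] inv_nonzero[of x] inv_right[of x] v_one by simp

lemma v_minus: "x \<in> carrier F \<Longrightarrow> x \<noteq> \<zero> \<Longrightarrow> v (\<ominus> x) = v x"
proof -
  assume x: "x \<in> carrier F" "x \<noteq> \<zero>"
  have m1: "\<ominus> \<one> \<noteq> \<zero>" by (metis minus_minus minus_zero one_closed zero_not_one)
  have "v (\<ominus> \<one> \<otimes> \<ominus> \<one>) = v (\<ominus> \<one>) + v (\<ominus> \<one>)" using m1 by (intro v_mult) auto
  moreover have "\<ominus> \<one> \<otimes> \<ominus> \<one> = \<one>" by (simp add: l_minus)
  ultimately have "v (\<ominus> \<one>) = 0" using v_one by simp
  moreover have "\<ominus> x = \<ominus> \<one> \<otimes> x" using x by (simp add: l_minus)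
  ultimately show "v (\<ominus> x) = v x" using v_mult[of "\<ominus> \<one>" x] x m1 by simp
qed

lemma VR_carrier: "VR \<subseteq> carrier F"
  by (auto simp: VR_def)

lemma VR_subring: "subring VR F"
proof (rule subringI)
  show "VR \<subseteq> carrier F" by (rule VR_carrier)
  show "\<one> \<in> VR" by (simp add: VR_def v_one)
  show "\<ominus> h \<in> VR" if "h \<in> VR" for h
    using that v_minus[of h] by (cases "h = \<zero>") (auto simp: VR_def)
  show "h1 \<otimes> h2 \<in> VR" if "h1 \<in> VR" "h2 \<in> VR" for h1 h2
    using that v_mult[of h1 h2] by (cases "h1 = \<zero> \<or> h2 = \<zero>") (auto simp: VR_def)
  show "h1 \<oplus> h2 \<in> VR" if "h1 \<in> VR" "h2 \<in> VR" for h1 h2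
    using that v_add[of h1 h2] by (cases "h1 = \<zero> \<or> h2 = \<zero> \<or> h1 \<oplus> h2 = \<zero>") (auto simp: VR_def)
qed

abbreviation Vr where "Vr \<equiv> F\<lparr>carrier := VR\<rparr>"

lemma Vr_cring: "cring Vr"
  using VR_subring VR_carrier m_comm
  by (intro subcring_iff[OF VR_carrier, THEN iffD1] subcringI) (auto dest: subsetD)

lemma VM_PIdl: "t \<in> carrier F \<Longrightarrow> t \<noteq> \<zero> \<Longrightarrow> v t = 1 \<Longrightarrow> VM = PIdl\<^bsub>Vr\<^esub> t"
proof -
  assume t: "t \<in> carrier F" "t \<noteq> \<zero>" "v t = 1"
  show "VM = PIdl\<^bsub>Vr\<^esub> t"
  proof (intro equalityI subsetI)
    fix z assume z: "z \<in> VM"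
    then have zc: "z \<in> carrier F" by (simp add: VM_def)
    have "z \<otimes> inv t \<in> VR"
      using z t v_mult[of z "inv t"] v_inv[of t] inv_closed[of t] inv_nonzero[of t]
      by (cases "z = \<zero>") (auto simp: VM_def VR_def)
    moreover have "z = (z \<otimes> inv t) \<otimes> t"
      using t zc inv_closed[of t] inv_left[of t] by (simp add: m_assoc)
    ultimately show "z \<in> PIdl\<^bsub>Vr\<^esub> t" unfolding cgenideal_def by auto
  next
    fix z assume "z \<in> PIdl\<^bsub>Vr\<^esub> t"
    then obtain x where "x \<in> VR" "z = x \<otimes> t" unfolding cgenideal_def by auto
    then show "z \<in> VM"
      using t v_mult[of x t] by (cases "x = \<zero>") (auto simp: VM_def VR_def)
  qed
qed

lemma PIdl_VM_D:
  assumes "t \<in> VR" "VM = PIdl\<^bsub>Vr\<^esub> t"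
  shows "t \<noteq> \<zero> \<and> v t = 1"
proof -
  from v_uniformizer obtain p where p: "p \<in> carrier F" "p \<noteq> \<zero>" "v p = 1" by (elim bexE conjE)
  then have "p \<in> VM" by (simp add: VM_def)
  then have "p \<in> PIdl\<^bsub>Vr\<^esub> t" unfolding assms(2) .
  then obtain x where x: "x \<in> VR" "p = x \<otimes> t" unfolding cgenideal_def by auto
  have tc: "t \<in> carrier F" "x \<in> carrier F" using assms(1) x(1) by (auto simp: VR_def)
  have nz: "t \<noteq> \<zero>" "x \<noteq> \<zero>" using x(2) p(2) tc by auto
  have "1 = v x + v t" using x(2) p(3) v_mult[of x t] tc nz by simp
  moreover have "v x \<ge> 0" using x nz by (simp add: VR_def)
  moreover have "t \<in> VM" using assms ring.cgenideal_self[OF cring.axioms(1)[OF Vr_cring], of t] by simp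
  then have "v t \<ge> 1" using nz by (auto simp: VM_def)
  ultimately show ?thesis using nz by simp
qed

lemma Units_Vr: "Units Vr = {z \<in> carrier F. z \<noteq> \<zero> \<and> v z = 0}"
proof (intro equalityI subsetI)
  fix z assume "z \<in> Units Vr"
  then obtain y where y: "z \<in> VR" "y \<in> VR" "y \<otimes> z = \<one>" by (auto simp: Units_def)
  then have c: "y \<in> carrier F" "z \<in> carrier F" by (auto simp: VR_def)
  have nz: "y \<noteq> \<zero>" "z \<noteq> \<zero>" using y(3) c by auto
  have "v y + v z = 0" using v_mult[of y z] c nz y(3) v_one by simp
  then show "z \<in> {z \<in> carrier F. z \<noteq> \<zero> \<and> v z = 0}" using y nz by (auto simp: VR_def)
next
  fix z assume z: "z \<in> {z \<in> carrier F. z \<noteq> \<zero> \<and> v z = 0}"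
  then have "inv z \<in> VR" using inv_closed v_inv by (simp add: VR_def)
  then show "z \<in> Units Vr"
    using z inv_left inv_right by (auto simp: Units_def VR_def intro!: bexI[of _ "inv z"])
qed

lemma VM_ideal: "ideal VM Vr"
proof -
  from v_uniformizer obtain t where t: "t \<in> carrier F" "t \<noteq> \<zero>" "v t = 1" by (elim bexE conjE)
  have "t \<in> carrier Vr" using t by (simp add: VR_def)
  then show ?thesis
    unfolding VM_PIdl[OF t] by (rule cring.cgenideal_ideal[OF Vr_cring])
qed

lemma proper_ideal_subset:
  assumes "ideal J Vr" "J \<noteq> VR"
  shows "J \<subseteq> VM"
proof
  interpret J: ideal J Vr by fact
  fix z assume z: "z \<in> J"
  then have zV: "z \<in> VR" using J.a_subset by auto
  show "z \<in> VM"
  proof (rule ccontr)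
    assume "z \<notin> VM"
    then have u: "z \<noteq> \<zero>" "v z = 0" using zV by (auto simp: VM_def VR_def)
    have zc: "z \<in> carrier F" using zV VR_carrier by blast
    have "inv z \<in> VR" using inv_closed[OF zc u(1)] v_inv[OF zc u(1)] u by (simp add: VR_def)
    then have "inv z \<otimes> z \<in> J" using J.I_l_closed[OF z] by simp
    then have "\<one> \<in> J" using inv_left[OF zc u(1)] by simp
    have "VR \<subseteq> J"
    proof
      fix x assume "x \<in> VR"
      then show "x \<in> J" using J.I_l_closed[OF \<open>\<one> \<in> J\<close>, of x] VR_carrier by auto
    qed
    then show False using assms(2) J.a_subset by auto
  qed
qed

lemma one_notin_VM: "\<one> \<notin> VM"
  by (simp add: VM_def v_one)

lemma one_in_VR: "\<one> \<in> VR"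
  by (simp add: VR_def v_one)

lemma VM_maximal: "maximalideal VM Vr"
proof (rule maximalidealI[OF VM_ideal])
  show "carrier Vr \<noteq> VM" using one_notin_VM one_in_VR by auto
  show "J = VM \<or> J = carrier Vr" if "ideal J Vr" "VM \<subseteq> J" "J \<subseteq> carrier Vr" for J
    using proper_ideal_subset[OF that(1)] that by auto
qed

lemma maximal_unique:
  assumes "maximalideal J Vr"
  shows "J = VM"
proof -
  interpret J: maximalideal J Vr by fact
  have "J \<noteq> VR" using J.I_notcarr by auto
  then have "J \<subseteq> VM" using proper_ideal_subset[OF J.is_ideal] by blast
  moreover have "VM \<subseteq> carrier Vr" by (auto simp: VM_def VR_def)
  ultimately have "VM = J \<or> VM = carrier Vr" by (intro J.I_maximal VM_ideal)
  then show ?thesis using one_notin_VM one_in_VR by auto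
qed

lemma valuation_ring_VR:
  assumes "K \<subseteq> carrier F" "\<And>c. c \<in> K \<Longrightarrow> c \<noteq> \<zero> \<Longrightarrow> v c = 0"
  shows "valuation_ring F K VR"
proof -
  from v_uniformizer obtain t where t: "t \<in> carrier F" "t \<noteq> \<zero>" "v t = 1" by (elim bexE conjE)
  have KV: "K \<subseteq> VR"
  proof
    fix c assume "c \<in> K"
    then show "c \<in> VR" using assms(1) assms(2)[of c] by (cases "c = \<zero>") (auto simp: VR_def)
  qed
  moreover have "t \<in> VR" "t \<notin> K" using t assms(2) by (auto simp: VR_def)
  moreover have "inv t \<in> carrier F" "inv t \<notin> VR"
    using t inv_closed inv_nonzero v_inv by (auto simp: VR_def)
  ultimately show ?thesis
    unfolding valuation_ring_def
  proof (intro conjI ballI)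
    show "z \<in> VR \<or> inv z \<in> VR" if "z \<in> carrier F - {\<zero>}" for z
      using that inv_closed[of z] v_inv[of z] by (auto simp: VR_def)
  qed (use VR_subring VR_carrier in blast)+
qed

lemma place_VM:
  assumes "K \<subseteq> carrier F" "\<And>c. c \<in> K \<Longrightarrow> c \<noteq> \<zero> \<Longrightarrow> v c = 0"
  shows "place F K VM"
  unfolding place_def using valuation_ring_VR[OF assms] VM_maximal by blast

lemma place_ring_VM: "place_ring F VM = Vr"
proof -
  have "{z \<in> carrier F. z = \<zero> \<or> inv z \<notin> VM} = VR"
  proof (rule Set.set_eqI)
    fix z
    show "z \<in> {z \<in> carrier F. z = \<zero> \<or> inv z \<notin> VM} \<longleftrightarrow> z \<in> VR"
      using inv_closed[of z] inv_nonzero[of z] v_inv[of z]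
      by (cases "z \<in> carrier F \<and> z \<noteq> \<zero>") (auto simp: VR_def VM_def)
  qed
  then show ?thesis by (simp add: place_ring_def)
qed

text \<open>A discrete valuation ring is maximal among proper subrings: if v x < 0, any z is x^n
  times z/x^n, and the quotient has nonnegative valuation once n is at least the absolute value of v
  z. So \<open>V\<close> is \<open>VR\<close>, which has one maximal ideal.\<close>

lemma dominated:
  assumes "valuation_ring F K V" "VR \<subseteq> V" "maximalideal P (F\<lparr>carrier := V\<rparr>)"
  shows "P = VM"
proof -
  have V: "subring V F" "V \<subset> carrier F" using assms(1) by (auto simp: valuation_ring_def)
  from v_uniformizer obtain t where t: "t \<in> carrier F" "t \<noteq> \<zero>" "v t = 1" by (elim bexE conjE)
  have "V \<subseteq> VR"
  proof (rule ccontr)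
    assume "\<not> V \<subseteq> VR"
    then obtain x where x: "x \<in> V" "x \<notin> VR" by blast
    then have xc: "x \<in> carrier F" "x \<noteq> \<zero>" "v x < 0" using V by (auto simp: VR_def)
    have "carrier F \<subseteq> V"
    proof
      fix z assume z: "z \<in> carrier F"
      show "z \<in> V"
      proof (cases "z = \<zero>")
        case True
        then show ?thesis using subringE(2)[OF V(1)] by simp
      next
        case False
        have pow: "x [^] (n::nat) \<in> V \<and> x [^] n \<in> carrier F \<and> x [^] n \<noteq> \<zero> \<and> v (x [^] n) = int n * v x" for n
        proof (induction n)
          case 0
          then show ?case using subringE(3)[OF V(1)] by (simp add: v_one)
        next
          case (Suc n)
          then show ?case
            using xc x(1) subringE(6)[OF V(1)] v_mult[of "x [^] n" x] integral[of "x [^] n" x]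
            by (auto simp: algebra_simps)
        qed
        define n where "n = nat \<bar>v z\<bar>"
        have xn: "x [^] n \<in> V" "x [^] n \<in> carrier F" "x [^] n \<noteq> \<zero>" "v (x [^] n) = int n * v x"
          using pow[of n] by auto
        have "int n * v x \<le> - \<bar>v z\<bar>"
          using xc(3) mult_left_mono[of "v x" "- 1" "int n"] by (simp add: n_def)
        then have "z \<otimes> inv (x [^] n) \<in> VR"
          using z False xn v_mult[of z "inv (x [^] n)"] v_inv[of "x [^] n"] inv_closed[of "x [^] n"]
            inv_nonzero[of "x [^] n"] by (auto simp: VR_def)
        then have "(z \<otimes> inv (x [^] n)) \<otimes> x [^] n \<in> V"
          using assms(2) xn(1) subringE(6)[OF V(1)] by blast
        then show ?thesis
          using z xn inv_closed[of "x [^] n"] inv_left[of "x [^] n"] by (simp add: m_assoc)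
      qed
    qed
    then show False using V(2) by auto
  qed
  then have "V = VR" using assms(2) by auto
  then show ?thesis using maximal_unique assms(3) by simp
qed

lemma v_nat_pow:
  assumes "t \<in> carrier F" "t \<noteq> \<zero>"
  shows "t [^] (n::nat) \<in> carrier F \<and> t [^] n \<noteq> \<zero> \<and> v (t [^] n) = int n * v t"
proof (induction n)
  case 0
  then show ?case by (simp add: v_one)
next
  case (Suc n)
  then show ?case
    using assms v_mult[of "t [^] n" t] integral[of "t [^] n" t]
    by (auto simp: algebra_simps)
qed

lemma v_int_pow:
  assumes "t \<in> carrier F" "t \<noteq> \<zero>"
  shows "t [^] (n::int) \<in> carrier F \<and> t [^] n \<noteq> \<zero> \<and> v (t [^] n) = n * v t"
proof (cases "n < 0")
  case True
  define y where "y = t [^] nat (- n)"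
  have tn: "t [^] n = inv y" unfolding int_pow_def2 y_def using True by (simp only: if_True)
  have "y \<in> carrier F" "y \<noteq> \<zero>" "v y = - n * v t"
    using v_nat_pow[OF assms, of "nat (- n)"] True by (auto simp: y_def)
  then show ?thesis
    unfolding tn using v_inv[of y] inv_closed[of y] inv_nonzero[of y] by simp
next
  case False
  have tn: "t [^] n = t [^] nat n" unfolding int_pow_def2 using False by (simp only: if_False)
  show ?thesis unfolding tn using v_nat_pow[OF assms, of "nat n"] False by simp
qed

text \<open>Generators of \<open>VM\<close> have valuation 1 and units have valuation 0, which
  forces the exponent in the definite description.\<close>

lemma valuation_eq:
  assumes z: "z \<in> carrier F" "z \<noteq> \<zero>"
  shows "valuation F VM z = v z"
  unfolding valuation_def place_ring_VM
proof (rule the_equality)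
  from v_uniformizer obtain t where t: "t \<in> carrier F" "t \<noteq> \<zero>" "v t = 1" by (elim bexE conjE)
  have tn: "t [^] v z \<in> carrier F" "t [^] v z \<noteq> \<zero>" "v (t [^] v z) = v z"
    using v_int_pow[OF t(1,2), of "v z"] t(3) by auto
  have i: "inv (t [^] v z) \<in> carrier F" "inv (t [^] v z) \<noteq> \<zero>" "v (inv (t [^] v z)) = - v z"
    using inv_closed inv_nonzero v_inv tn by auto
  let ?u = "inv (t [^] v z) \<otimes> z"
  have "?u \<noteq> \<zero>" using z i integral by blast
  then have "?u \<in> Units Vr"
    unfolding Units_Vr using z i v_mult[OF i(1) z(1) i(2) z(2)] by simp
  moreover have "z = t [^] v z \<otimes> ?u"
    using z i tn inv_right[OF tn(1,2)] by (simp add: m_assoc[symmetric])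
  moreover have "t \<in> carrier Vr" using t by (simp add: VR_def)
  ultimately show "\<exists>t\<in>carrier Vr. \<exists>u\<in>Units Vr. VM = PIdl\<^bsub>Vr\<^esub> t \<and> z = t [^] v z \<otimes> u"
    using VM_PIdl[OF t] by blast
next
  fix n :: int assume "\<exists>t\<in>carrier Vr. \<exists>u\<in>Units Vr. VM = PIdl\<^bsub>Vr\<^esub> t \<and> z = t [^] n \<otimes> u"
  then obtain t u where tu: "t \<in> VR" "u \<in> Units Vr" "VM = PIdl\<^bsub>Vr\<^esub> t" "z = t [^] n \<otimes> u" by auto
  have t: "t \<in> carrier F" "t \<noteq> \<zero>" "v t = 1" using PIdl_VM_D[OF tu(1,3)] tu(1) VR_carrier by auto
  have u: "u \<in> carrier F" "u \<noteq> \<zero>" "v u = 0" using tu(2) unfolding Units_Vr by auto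
  show "n = v z"
    using v_int_pow[OF t(1,2), of n] t(3) u v_mult[of "t [^] n" u] unfolding tu(4) by auto
qed

end

section \<open>Homogeneous polynomials and the function field\<close>

lemma homogeneous_0: "homogeneous d 0"
  by (simp add: homogeneous_def)

lemma homogeneous_add: "homogeneous d a \<Longrightarrow> homogeneous d b \<Longrightarrow> homogeneous d (a + b)"
  unfolding homogeneous_def by (metis (no_types, lifting) add.left_neutral coeff_add)

lemma homogeneous_minus: "homogeneous d a \<Longrightarrow> homogeneous d (- a)"
  by (simp add: homogeneous_def)

lemma homogeneous_diff: "homogeneous d a \<Longrightarrow> homogeneous d b \<Longrightarrow> homogeneous d (a - b)"
  using homogeneous_add[of d a "- b"] homogeneous_minus[of d b] by simp

lemma homogeneous_mult:
  assumes a: "homogeneous d a" and b: "homogeneous e b"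
  shows "homogeneous (d + e) (a * b)"
  unfolding homogeneous_def
proof (intro allI impI)
  fix i j l assume "coeff (coeff (coeff (a * b) l) j) i \<noteq> 0"
  then have "(\<Sum>l'\<le>l. \<Sum>j'\<le>j. \<Sum>i'\<le>i. coeff (coeff (coeff a l') j') i' *
      coeff (coeff (coeff b (l - l')) (j - j')) (i - i')) \<noteq> 0"
    by (simp add: coeff_mult coeff_sum)
  then obtain l' j' i' where le: "l' \<le> l" "j' \<le> j" "i' \<le> i" and
    nz: "coeff (coeff (coeff a l') j') i' * coeff (coeff (coeff b (l - l')) (j - j')) (i - i') \<noteq> 0"
    by (meson atMost_iff sum.not_neutral_contains_not_neutral)
  have "i' + j' + l' = d" using a nz unfolding homogeneous_def by auto
  moreover have "(i - i') + (j - j') + (l - l') = e" using b nz unfolding homogeneous_def by auto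
  ultimately show "i + j + l = d + e" using le by linarith
qed

lemma homogeneous_const3: "homogeneous 0 (const3 c)"
  and homogeneous_1: "homogeneous 0 1"
  and homogeneous_varX: "homogeneous 1 varX"
  and homogeneous_varY: "homogeneous 1 varY"
  and homogeneous_varZ: "homogeneous 1 varZ"
  by (auto simp: homogeneous_def const3_def varX_def varY_def varZ_def one_pCons coeff_pCons
      split: nat.splits if_splits)

lemma homogeneous_power: "homogeneous d a \<Longrightarrow> homogeneous (n * d) (a ^ n)"
  by (induction n) (auto simp: homogeneous_1 homogeneous_mult)

abbreviation dehom :: "'k::field poly3 \<Rightarrow> 'k poly poly" where
  "dehom a \<equiv> poly a 1"

interpretation dehom: cr_hom "dehom :: 'k::field poly3 \<Rightarrow> _"
  by (rule cr_hom_poly)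

lemma dehom_base: "dehom (const3 c) = cst2 c" "dehom varX = X2" "dehom varY = Y2" "dehom varZ = 1"
  by (simp_all add: const3_def varX_def varY_def varZ_def cst2_def X2_def Y2_def)

text \<open>For given exponents of X and Y the degree fixes that of Z, so setting Z = 1 merges no
  monomials.\<close>

lemma dehom_eq_0:
  assumes "homogeneous d a" "dehom a = 0"
  shows "a = 0"
proof (rule ccontr)
  assume "a \<noteq> 0"
  then obtain l where "coeff a l \<noteq> 0" by (metis leading_coeff_0_iff)
  then obtain j where "coeff (coeff a l) j \<noteq> 0" by (metis leading_coeff_0_iff)
  then obtain i where nz: "coeff (coeff (coeff a l) j) i \<noteq> 0" by (metis leading_coeff_0_iff)
  have other: "coeff (coeff (coeff a l') j) i = 0" if "l' \<noteq> l" for l'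
    using assms(1) nz that unfolding homogeneous_def by (metis add_left_cancel)
  have "coeff (coeff (dehom a) j) i = (\<Sum>l'\<le>degree a. coeff (coeff (coeff a l') j) i)"
    by (simp add: poly_altdef coeff_sum)
  also have "\<dots> = (\<Sum>l'\<in>{l}. coeff (coeff (coeff a l') j) i)"
    using \<open>coeff a l \<noteq> 0\<close> other by (intro sum.mono_neutral_right) (auto intro: le_degree)
  finally show False using assms(2) nz by simp
qed

lemma dehom_inj: "homogeneous d a \<Longrightarrow> homogeneous d b \<Longrightarrow> dehom a = dehom b \<Longrightarrow> a = b"
  using dehom_eq_0[OF homogeneous_diff, of d a b] by (simp add: dehom.hom_diff)

lemma homogeneous_raise: "homogeneous d a \<Longrightarrow> homogeneous (d + n) (a * varZ ^ n)"
  using homogeneous_mult[of d a n "varZ ^ n"] homogeneous_power[OF homogeneous_varZ, of n] by simp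

lemma dehom_raise: "dehom (a * varZ ^ n) = dehom a"
  by (simp add: dehom.homs dehom_base)

lemma homogenization_ex: "\<exists>d a. homogeneous d a \<and> dehom a = g"
proof (induction g rule: poly2_induct)
  case (const c)
  then show ?case using homogeneous_const3 dehom_base(1) by blast
next
  case X
  then show ?case using homogeneous_varX dehom_base(2) by blast
next
  case Y
  then show ?case using homogeneous_varY dehom_base(3) by blast
next
  case (add f g)
  then obtain d a e b where *: "homogeneous d a" "dehom a = f" "homogeneous e b" "dehom b = g" by blast
  have "homogeneous (d + e) (a * varZ ^ e + b * varZ ^ d)"
    using homogeneous_raise[OF *(1), of e] homogeneous_raise[OF *(3), of d]
    by (intro homogeneous_add) (simp_all add: add.commute)
  moreover have "dehom (a * varZ ^ e + b * varZ ^ d) = f + g"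
    using * by (simp only: dehom.hom_add dehom_raise)
  ultimately show ?case by blast
next
  case (mult f g)
  then obtain d a e b where *: "homogeneous d a" "dehom a = f" "homogeneous e b" "dehom b = g" by blast
  then have "homogeneous (d + e) (a * b) \<and> dehom (a * b) = f * g"
    by (simp add: homogeneous_mult)
  then show ?case by blast
qed

lemma UN_constant_eq2:
  assumes "x \<in> A" "y \<in> B" "\<And>x y. x \<in> A \<Longrightarrow> y \<in> B \<Longrightarrow> f x y = c"
  shows "(\<Union>x\<in>A. \<Union>y\<in>B. f x y) = c"
  using assms by auto

text \<open>The ring laws are pulled back along an injection into a field type, where they hold by
  simplification.\<close>

lemma field_via_embedding:
  fixes G :: "('a, 'c) ring_scheme" (structure) and \<phi> :: "'a \<Rightarrow> 'b::field"
  assumes inj: "inj_on \<phi> (carrier G)"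
    and one: "\<one> \<in> carrier G" "\<phi> \<one> = 1" and zero: "\<zero> \<in> carrier G" "\<phi> \<zero> = 0"
    and add: "\<And>x y. x \<in> carrier G \<Longrightarrow> y \<in> carrier G \<Longrightarrow> x \<oplus> y \<in> carrier G \<and> \<phi> (x \<oplus> y) = \<phi> x + \<phi> y"
    and mult: "\<And>x y. x \<in> carrier G \<Longrightarrow> y \<in> carrier G \<Longrightarrow> x \<otimes> y \<in> carrier G \<and> \<phi> (x \<otimes> y) = \<phi> x * \<phi> y"
    and neg: "\<And>x. x \<in> carrier G \<Longrightarrow> \<exists>y\<in>carrier G. \<phi> y = - \<phi> x"
    and inv: "\<And>x. x \<in> carrier G \<Longrightarrow> \<phi> x \<noteq> 0 \<Longrightarrow> \<exists>y\<in>carrier G. \<phi> y = inverse (\<phi> x)"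
  shows "Ring.field G"
proof -
  have eqI: "x = y" if "\<phi> x = \<phi> y" "x \<in> carrier G" "y \<in> carrier G" for x y
    using inj that by (auto dest: inj_onD)
  have "abelian_group G"
  proof (rule abelian_groupI)
    show "\<exists>y\<in>carrier G. y \<oplus> x = \<zero>" if x: "x \<in> carrier G" for x
    proof -
      obtain y where y: "y \<in> carrier G" "\<phi> y = - \<phi> x" using neg[OF x] by (elim bexE)
      then have "y \<oplus> x = \<zero>" using x zero add by (intro eqI) auto
      with y show ?thesis by (intro bexI)
    qed
  qed (use zero add in \<open>auto intro!: eqI simp: add_ac\<close>)
  moreover have "comm_monoid G"
    by (rule comm_monoidI) (use one mult in \<open>auto intro!: eqI simp: mult_ac\<close>)
  ultimately have "cring G"
    by (rule cringI) (use add mult in \<open>auto intro!: eqI simp: algebra_simps\<close>)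
  then show ?thesis
  proof (rule cring.cring_fieldI)
    have "\<zero> \<notin> Units G"
    proof
      assume "\<zero> \<in> Units G"
      then obtain y where y: "y \<in> carrier G" "y \<otimes> \<zero> = \<one>" by (auto simp: Units_def)
      then have "\<phi> (y \<otimes> \<zero>) = \<phi> \<one>" by simp
      then show False using mult[OF y(1) zero(1)] one zero by simp
    qed
    moreover have "x \<in> Units G" if x: "x \<in> carrier G" "x \<noteq> \<zero>" for x
    proof -
      have nz: "\<phi> x \<noteq> 0" using x zero eqI by metis
      obtain y where y: "y \<in> carrier G" "\<phi> y = inverse (\<phi> x)" using inv[OF x(1) nz] by (elim bexE)
      then have "y \<otimes> x = \<one>" "x \<otimes> y = \<one>"
        using x one mult nz by (auto intro!: eqI)
      with y x show ?thesis by (auto simp: Units_def)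
    qed
    ultimately show "Units G = carrier G - {\<zero>}" by (auto simp: Units_def)
  qed
qed

section \<open>Curve functions represented by fractions of forms\<close>

context hermitian
begin

definition H :: "'k poly3" where "H = hermitian_form q"

lemma dehom_H: "dehom H = - Cv"
  by (simp add: H_def hermitian_form_def Cv_def dehom.homs dehom_base)

lemma homogeneous_H: "homogeneous (q + 1) H"
proof -
  have "homogeneous (q + 1) (varX ^ (q + 1) :: 'k poly3)"
    using homogeneous_power[OF homogeneous_varX, of "q + 1"] by simp
  moreover have "homogeneous (q + 1) (varY ^ q * varZ :: 'k poly3)"
    using homogeneous_mult[OF homogeneous_power[OF homogeneous_varY, of q] homogeneous_varZ] by simp
  moreover have "homogeneous (q + 1) (varY * varZ ^ q :: 'k poly3)"
    using homogeneous_mult[OF homogeneous_varY homogeneous_power[OF homogeneous_varZ, of q]] by simp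
  ultimately show ?thesis
    unfolding H_def hermitian_form_def by (intro homogeneous_diff)
qed

text \<open>At Z = 0 the form becomes X^(q+1), which is nonzero, so every factor Z of a multiple of
  H divides the cofactor.\<close>

lemma H_dvd_cancel_varZ: "H dvd a * varZ ^ n \<Longrightarrow> H dvd a"
proof (induction n)
  case (Suc n)
  then obtain w where w: "a * varZ ^ Suc n = H * w" by (auto elim!: dvdE)
  have "poly (a * varZ ^ Suc n) 0 = 0" by (simp add: varZ_def)
  then have "poly H 0 * poly w 0 = 0" unfolding w by simp
  moreover have "poly H 0 \<noteq> 0"
  proof -
    have "poly varX 0 = (X2 :: 'k poly poly)" "poly varZ 0 = (0 :: 'k poly poly)"
      by (simp_all add: varX_def X2_def varZ_def)
    then have "poly H 0 = X2 ^ (q + 1)"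
      using q_pos by (simp add: H_def hermitian_form_def power_0_left)
    then show ?thesis by (simp add: X2_def)
  qed
  ultimately have "poly w 0 = 0" by simp
  then obtain w' where "w = varZ * w'"
    using poly_eq_0_iff_dvd[of w 0] by (auto simp: varZ_def elim!: dvdE)
  then have "varZ * (a * varZ ^ n) = varZ * (H * w')" using w by (simp add: mult_ac)
  then have "a * varZ ^ n = H * w'" by (simp add: varZ_def)
  then show ?case using Suc.IH by simp
qed simp

text \<open>The affine cofactor can be homogenised up to a power of Z, and such powers
  cancel.\<close>

lemma H_dvd_iff:
  assumes "homogeneous d a"
  shows "H dvd a \<longleftrightarrow> Cv dvd dehom a"
proof
  assume "H dvd a"
  then obtain w where "a = H * w" by (rule dvdE)
  then have "dehom a = - Cv * dehom w" by (simp add: dehom_H)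
  then show "Cv dvd dehom a" by simp
next
  assume "Cv dvd dehom a"
  then obtain s where s: "dehom a = Cv * s" by (rule dvdE)
  obtain e S' where S': "homogeneous e S'" "dehom S' = - s" using homogenization_ex[of "- s"] by blast
  have "a * varZ ^ (q + 1 + e) = H * S' * varZ ^ d"
  proof (rule dehom_inj)
    show "homogeneous (d + (q + 1 + e)) (a * varZ ^ (q + 1 + e))"
      by (rule homogeneous_raise[OF assms])
    show "homogeneous (d + (q + 1 + e)) (H * S' * varZ ^ d)"
      using homogeneous_raise[OF homogeneous_mult[OF homogeneous_H S'(1)], of d]
      by (simp add: add.commute)
    show "dehom (a * varZ ^ (q + 1 + e)) = dehom (H * S' * varZ ^ d)"
      unfolding dehom_raise dehom.hom_mult[of H] dehom_H S'(2) s by simp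
  qed
  then have "H dvd a * varZ ^ (q + 1 + e)" by (simp add: mult.assoc)
  then show "H dvd a" by (rule H_dvd_cancel_varZ)
qed

abbreviation fr where "fr \<equiv> curve_fractions H"
abbreviation cls where "cls p \<equiv> curve_rel H `` {p}"
abbreviation G where "G \<equiv> curve_function_field H"

fun pval :: "'k alg_closure point \<Rightarrow> 'k poly3 \<times> 'k poly3 \<Rightarrow> 'k alg_closure fls" where
  "pval R (a, b) = evk R (dehom a) / evk R (dehom b)"

lemma fr_iff: "(a, b) \<in> fr \<longleftrightarrow> (\<exists>d. homogeneous d a \<and> homogeneous d b) \<and> \<not> Cv dvd dehom b"
  using H_dvd_iff by (auto simp: curve_fractions_def)

lemma fr_nonzero: "(a, b) \<in> fr \<Longrightarrow> on_curve R \<Longrightarrow> evk R (dehom b) \<noteq> 0"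
  by (simp add: fr_iff evk_eq_0_iff)

text \<open>The cross difference is again a form, so its divisibility by H can be tested by
  expansion at any single point. Equality of classes becomes equality in a field.\<close>

lemma rel_iff:
  assumes R: "on_curve R"
  shows "(p, p') \<in> curve_rel H \<longleftrightarrow> p \<in> fr \<and> p' \<in> fr \<and> pval R p = pval R p'"
proof -
  obtain a b c d where p: "p = (a, b)" "p' = (c, d)" by (cases p, cases p')
  have "H dvd a * d - c * b \<longleftrightarrow> pval R (a, b) = pval R (c, d)" if fr: "(a, b) \<in> fr" "(c, d) \<in> fr"
  proof -
    obtain m n where hom: "homogeneous m a" "homogeneous m b" "homogeneous n c" "homogeneous n d"
      using fr by (auto simp: fr_iff)
    have "homogeneous (m + n) (a * d - c * b)"
      using homogeneous_mult[OF hom(1,4)] homogeneous_mult[OF hom(3,2)]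
      by (intro homogeneous_diff) (simp_all add: add.commute)
    then have "H dvd a * d - c * b \<longleftrightarrow> evk R (dehom (a * d - c * b)) = 0"
      by (simp add: H_dvd_iff evk_eq_0_iff[OF R])
    also have "\<dots> \<longleftrightarrow> pval R (a, b) = pval R (c, d)"
      using fr_nonzero[OF that(1) R] fr_nonzero[OF that(2) R]
      by (simp add: dehom.homs evk.homs frac_eq_eq)
    finally show ?thesis .
  qed
  then show ?thesis by (auto simp: p curve_rel_def)
qed

lemma cls_iff: "on_curve R \<Longrightarrow> p \<in> fr \<Longrightarrow> p' \<in> cls p \<longleftrightarrow> p' \<in> fr \<and> pval R p' = pval R p"
  by (auto simp: rel_iff)

lemma cls_eq_iff:
  assumes "on_curve R" "p \<in> fr" "p' \<in> fr"
  shows "cls p = cls p' \<longleftrightarrow> pval R p = pval R p'"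
proof
  assume "cls p = cls p'"
  then have "p \<in> cls p'" using cls_iff[OF assms(1,2), of p] assms(2) by auto
  then show "pval R p = pval R p'" using cls_iff[OF assms(1,3)] by simp
next
  assume "pval R p = pval R p'"
  then show "cls p = cls p'" using cls_iff[OF assms(1,2)] cls_iff[OF assms(1,3)] by auto
qed

text \<open>
  Expansion at the point \<open>R\<close> embeds the function field into \<open>K((t))\<close>; any representative of the
  class may be chosen.
\<close>

definition iota :: "'k alg_closure point \<Rightarrow> 'k curve_function \<Rightarrow> 'k alg_closure fls" where
  "iota R c = pval R (SOME p. p \<in> c)"

lemma iota_cls:
  assumes "on_curve R" "p \<in> fr"
  shows "iota R (cls p) = pval R p"
proof -
  have "p \<in> cls p" using cls_iff[OF assms, of p] assms(2) by simp
  then have "(SOME p'. p' \<in> cls p) \<in> cls p" by (rule someI)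
  then show ?thesis using cls_iff[OF assms] by (simp add: iota_def)
qed

lemma carrier_G: "carrier G = cls ` fr"
  by (auto simp: curve_function_field_def quotient_def)

lemma pair_mult: "p \<in> fr \<Longrightarrow> p' \<in> fr \<Longrightarrow> (fst p * fst p', snd p * snd p') \<in> fr"
  by (cases p, cases p') (auto simp: fr_iff Cv_dvd_mult intro: homogeneous_mult)

lemma pair_add: "p \<in> fr \<Longrightarrow> p' \<in> fr \<Longrightarrow> (fst p * snd p' + fst p' * snd p, snd p * snd p') \<in> fr"
proof -
  assume *: "p \<in> fr" "p' \<in> fr"
  obtain a b c d where p: "p = (a, b)" "p' = (c, d)" by (cases p, cases p')
  obtain m n where hom: "homogeneous m a" "homogeneous m b" "homogeneous n c" "homogeneous n d"
    using * by (auto simp: fr_iff p)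
  have "homogeneous (m + n) (a * d + c * b)" "homogeneous (m + n) (b * d)"
    using homogeneous_mult[OF hom(1,4)] homogeneous_mult[OF hom(3,2)] homogeneous_mult[OF hom(2,4)]
    by (auto simp: add.commute intro: homogeneous_add)
  then show ?thesis using * by (auto simp: p fr_iff Cv_dvd_mult)
qed

lemma pval_mult: "pval R (fst p * fst p', snd p * snd p') = pval R p * pval R p'"
  by (cases p, cases p') (simp add: dehom.homs evk.homs)

lemma pval_add:
  assumes "on_curve R" "p \<in> fr" "p' \<in> fr"
  shows "pval R (fst p * snd p' + fst p' * snd p, snd p * snd p') = pval R p + pval R p'"
  using assms fr_nonzero[OF _ assms(1)]
  by (cases p, cases p') (simp add: dehom.homs evk.homs add_frac_eq)

text \<open>The operation is a union over all representatives; multiplicativity of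
  \<open>pval\<close> shows that each pair contributes the same class.\<close>

lemma cls_mult:
  assumes "p \<in> fr" "p' \<in> fr"
  shows "cls p \<otimes>\<^bsub>G\<^esub> cls p' = cls (fst p * fst p', snd p * snd p')"
proof -
  let ?c = "cls (fst p * fst p', snd p * snd p')"
  have "cls (fst r * fst r', snd r * snd r') = ?c" if "r \<in> cls p" "r' \<in> cls p'" for r r'
  proof -
    have r: "r \<in> fr" "r' \<in> fr" "pval None r = pval None p" "pval None r' = pval None p'"
      using that assms by (simp_all only: cls_iff[of None] on_curve.simps)
    show ?thesis
      using cls_eq_iff[OF _ pair_mult[OF r(1,2)] pair_mult[OF assms], of None]
      unfolding pval_mult by (simp only: r(3,4) on_curve.simps)
  qed
  moreover have "p \<in> cls p" "p' \<in> cls p'" using cls_iff[of None] assms by auto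
  ultimately show ?thesis
    unfolding curve_function_field_def ring_record_simps monoid.simps case_prod_beta
    by (intro UN_constant_eq2) blast+
qed

lemma cls_add:
  assumes "p \<in> fr" "p' \<in> fr"
  shows "cls p \<oplus>\<^bsub>G\<^esub> cls p' = cls (fst p * snd p' + fst p' * snd p, snd p * snd p')"
proof -
  let ?c = "cls (fst p * snd p' + fst p' * snd p, snd p * snd p')"
  have "cls (fst r * snd r' + fst r' * snd r, snd r * snd r') = ?c" if "r \<in> cls p" "r' \<in> cls p'" for r r'
  proof -
    have r: "r \<in> fr" "r' \<in> fr" "pval None r = pval None p" "pval None r' = pval None p'"
      using that assms by (simp_all only: cls_iff[of None] on_curve.simps)
    show ?thesis
      using cls_eq_iff[OF _ pair_add[OF r(1,2)] pair_add[OF assms], of None]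
        pval_add[of None, OF _ r(1,2)] pval_add[of None, OF _ assms]
      by (simp only: r(3,4) on_curve.simps)
  qed
  moreover have "p \<in> cls p" "p' \<in> cls p'" using cls_iff[of None] assms by auto
  ultimately show ?thesis
    unfolding curve_function_field_def ring_record_simps monoid.simps case_prod_beta
    by (intro UN_constant_eq2) blast+
qed

end

section \<open>The places of the function field\<close>

context hermitian
begin

lemma carrier_repr:
  assumes "z \<in> carrier G"
  shows "\<exists>g h. \<not> Cv dvd h \<and> (\<forall>R. on_curve R \<longrightarrow> iota R z = evk R g / evk R h)"
proof -
  obtain a b where z: "z = cls (a, b)" "(a, b) \<in> fr" using assms unfolding carrier_G by auto
  show ?thesis
  proof (intro exI conjI allI impI)
    show "\<not> Cv dvd dehom b" using z(2) by (simp add: fr_iff)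
    show "iota R z = evk R (dehom a) / evk R (dehom b)" if "on_curve R" for R
      unfolding z(1) iota_cls[OF that z(2)] by simp
  qed
qed

lemma element_ex:
  assumes "\<not> Cv dvd h"
  shows "\<exists>z\<in>carrier G. \<forall>R. on_curve R \<longrightarrow> iota R z = evk R g / evk R h"
proof -
  obtain d a where a: "homogeneous d a" "dehom a = g" using homogenization_ex[of g] by blast
  obtain e b where b: "homogeneous e b" "dehom b = h" using homogenization_ex[of h] by blast
  \<comment> \<open>Exchanging the exponents brings both forms to the common degree d + e.\<close>
  let ?p = "(a * varZ ^ e, b * varZ ^ d)"
  have "homogeneous (d + e) (a * varZ ^ e)" "homogeneous (d + e) (b * varZ ^ d)"
    using homogeneous_raise[OF a(1), of e] homogeneous_raise[OF b(1), of d] by (simp_all add: add.commute)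
  then have p: "?p \<in> fr" using assms unfolding fr_iff dehom_raise a b by blast
  show ?thesis
  proof (intro bexI allI impI)
    show "cls ?p \<in> carrier G" unfolding carrier_G using p by (rule imageI)
    show "iota R (cls ?p) = evk R g / evk R h" if "on_curve R" for R
      unfolding iota_cls[OF that p] pval.simps dehom_raise a b ..
  qed
qed

lemma iota_inj:
  assumes R: "on_curve R"
  shows "inj_on (iota R) (carrier G)"
proof (rule inj_onI)
  fix x y assume *: "x \<in> carrier G" "y \<in> carrier G" "iota R x = iota R y"
  obtain p p' where p: "x = cls p" "y = cls p'" "p \<in> fr" "p' \<in> fr" using * unfolding carrier_G by auto
  show "x = y"
    using *(3) iota_cls[OF R p(3)] iota_cls[OF R p(4)] cls_eq_iff[OF R p(3,4)] unfolding p(1,2) by simp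
qed

lemma one_zero_fr: "(1, 1) \<in> fr" "(0, 1) \<in> fr"
  using Cv_not_dvd_1 homogeneous_1 homogeneous_0 by (auto simp: fr_iff)

lemma iota_one: "\<one>\<^bsub>G\<^esub> \<in> carrier G \<and> (on_curve R \<longrightarrow> iota R \<one>\<^bsub>G\<^esub> = 1)"
proof -
  have "\<one>\<^bsub>G\<^esub> = cls (1, 1)" by (simp add: curve_function_field_def)
  then show ?thesis using one_zero_fr iota_cls[of R "(1, 1)"] by (auto simp: carrier_G evk.homs)
qed

lemma iota_zero: "\<zero>\<^bsub>G\<^esub> \<in> carrier G \<and> (on_curve R \<longrightarrow> iota R \<zero>\<^bsub>G\<^esub> = 0)"
proof -
  have "\<zero>\<^bsub>G\<^esub> = cls (0, 1)" by (simp add: curve_function_field_def)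
  then show ?thesis using one_zero_fr iota_cls[of R "(0, 1)"] by (auto simp: carrier_G evk.homs)
qed

lemma iota_add:
  assumes "x \<in> carrier G" "y \<in> carrier G"
  shows "x \<oplus>\<^bsub>G\<^esub> y \<in> carrier G \<and> (on_curve R \<longrightarrow> iota R (x \<oplus>\<^bsub>G\<^esub> y) = iota R x + iota R y)"
proof -
  obtain p p' where p: "x = cls p" "y = cls p'" "p \<in> fr" "p' \<in> fr" using assms unfolding carrier_G by auto
  show ?thesis
    unfolding p(1,2) cls_add[OF p(3,4)] carrier_G
    using pair_add[OF p(3,4)] iota_cls[of R] p(3,4) pval_add[of R, OF _ p(3,4)] by auto
qed

lemma iota_mult:
  assumes "x \<in> carrier G" "y \<in> carrier G"
  shows "x \<otimes>\<^bsub>G\<^esub> y \<in> carrier G \<and> (on_curve R \<longrightarrow> iota R (x \<otimes>\<^bsub>G\<^esub> y) = iota R x * iota R y)"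
proof -
  obtain p p' where p: "x = cls p" "y = cls p'" "p \<in> fr" "p' \<in> fr" using assms unfolding carrier_G by auto
  show ?thesis
    unfolding p(1,2) cls_mult[OF p(3,4)] carrier_G
    using pair_mult[OF p(3,4)] iota_cls[of R] p(3,4) pval_mult[of R p p'] by auto
qed

lemma iota_neg:
  assumes "x \<in> carrier G"
  shows "\<exists>y\<in>carrier G. \<forall>R. on_curve R \<longrightarrow> iota R y = - iota R x"
proof -
  obtain g h where gh: "\<not> Cv dvd h" "\<And>R. on_curve R \<Longrightarrow> iota R x = evk R g / evk R h"
    using carrier_repr[OF assms] by blast
  obtain y where "y \<in> carrier G" "\<And>R. on_curve R \<Longrightarrow> iota R y = evk R (- g) / evk R h"
    using element_ex[OF gh(1)] by blast
  then show ?thesis using gh by (intro bexI[of _ y]) (auto simp: evk.homs)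
qed

lemma iota_inverse:
  assumes "x \<in> carrier G"
  shows "\<exists>y\<in>carrier G. \<forall>R. on_curve R \<longrightarrow> iota R y = inverse (iota R x)"
proof -
  obtain g h where gh: "\<not> Cv dvd h" "\<And>R. on_curve R \<Longrightarrow> iota R x = evk R g / evk R h"
    using carrier_repr[OF assms] by blast
  show ?thesis
  proof (cases "Cv dvd g")
    case True
    then have "iota R x = 0" if "on_curve R" for R using gh(2)[OF that] evk_eq_0_iff[OF that, of g] by simp
    then show ?thesis using iota_zero by (intro bexI[of _ "\<zero>\<^bsub>G\<^esub>"]) auto
  next
    case False
    obtain y where "y \<in> carrier G" "\<And>R. on_curve R \<Longrightarrow> iota R y = evk R h / evk R g"
      using element_ex[OF False] by blast
    then show ?thesis using gh by (intro bexI[of _ y]) auto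
  qed
qed

lemma field_G: "Ring.field G"
proof (rule field_via_embedding[where \<phi> = "iota None"])
  show "inj_on (iota None) (carrier G)" by (rule iota_inj) simp
  show "\<exists>y\<in>carrier G. iota None y = - iota None x" if "x \<in> carrier G" for x
    using iota_neg[OF that] on_curve.simps(1) by blast
  show "\<exists>y\<in>carrier G. iota None y = inverse (iota None x)" if "x \<in> carrier G" for x
    using iota_inverse[OF that] on_curve.simps(1) by blast
qed (use iota_one[of None] iota_zero[of None] iota_add[of _ _ None] iota_mult[of _ _ None] in auto)

lemma iota_eq_0_iff: "on_curve R \<Longrightarrow> z \<in> carrier G \<Longrightarrow> iota R z = 0 \<longleftrightarrow> z = \<zero>\<^bsub>G\<^esub>"
  using inj_onD[OF iota_inj[of R], of z "\<zero>\<^bsub>G\<^esub>"] iota_zero[of R] by metis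

lemma iota_inv:
  assumes "on_curve R" "z \<in> carrier G" "z \<noteq> \<zero>\<^bsub>G\<^esub>"
  shows "inv\<^bsub>G\<^esub> z \<in> carrier G \<and> iota R (inv\<^bsub>G\<^esub> z) = inverse (iota R z)"
proof -
  interpret F: Ring.field G by (rule field_G)
  have z: "z \<in> Units G" using assms F.field_Units by blast
  then have i: "inv\<^bsub>G\<^esub> z \<in> carrier G" "z \<otimes>\<^bsub>G\<^esub> inv\<^bsub>G\<^esub> z = \<one>\<^bsub>G\<^esub>" by auto
  have "iota R z * iota R (inv\<^bsub>G\<^esub> z) = 1"
    using iota_mult[OF assms(2) i(1), of R] i(2) iota_one[of R] assms(1) by simp
  then show ?thesis using i inverse_unique by metis
qed

definition vR :: "'k alg_closure point \<Rightarrow> 'k curve_function \<Rightarrow> int" where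
  "vR R z = fls_subdegree (iota R z)"

lemma disc_val_vR:
  assumes R: "on_curve R"
  shows "disc_val G (vR R)"
proof -
  interpret F: Ring.field G by (rule field_G)
  show ?thesis
  proof
    show "vR R (x \<otimes>\<^bsub>G\<^esub> y) = vR R x + vR R y"
      if "x \<in> carrier G" "y \<in> carrier G" "x \<noteq> \<zero>\<^bsub>G\<^esub>" "y \<noteq> \<zero>\<^bsub>G\<^esub>" for x y
      using that iota_mult[OF that(1,2), of R] iota_eq_0_iff[OF R] R by (simp add: vR_def)
    show "min (vR R x) (vR R y) \<le> vR R (x \<oplus>\<^bsub>G\<^esub> y)"
      if "x \<in> carrier G" "y \<in> carrier G" "x \<noteq> \<zero>\<^bsub>G\<^esub>" "y \<noteq> \<zero>\<^bsub>G\<^esub>" "x \<oplus>\<^bsub>G\<^esub> y \<noteq> \<zero>\<^bsub>G\<^esub>" for x y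
    proof -
      have "iota R (x \<oplus>\<^bsub>G\<^esub> y) \<noteq> 0" using that iota_add[OF that(1,2), of R] iota_eq_0_iff[OF R] by auto
      then show ?thesis
        using iota_add[OF that(1,2), of R] R fls_plus_subdegree[of "iota R x" "iota R y"] by (simp add: vR_def)
    qed
    show "\<exists>t\<in>carrier G. t \<noteq> \<zero>\<^bsub>G\<^esub> \<and> vR R t = 1"
    proof -
      have "\<exists>g h. \<not> Cv dvd h \<and> fls_subdegree (evk R g / evk R h) = 1"
      proof (cases R)
        case None
        have "\<not> Cv dvd (Y2 :: 'k poly poly)"
          using w_inf(2) by (simp add: evk_base ys.simps flip: evk_None_eq_0_iff)
        moreover have "fls_subdegree (evk R X2 / evk R Y2) = 1"
          using w_inf None by (simp add: evk_base xs.simps ys.simps fls_divide_subdegree)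
        ultimately show ?thesis by blast
      next
        case (Some p)
        obtain a b where p: "p = (a, b)" by (cases p)
        obtain t where "fls_subdegree (evk R t) = 1"
          using local_uniformizer[of a b] R Some p by metis
        then show ?thesis
          by (intro exI[of _ t] exI[of _ 1]) (simp add: evk.homs Cv_not_dvd_1)
      qed
      then obtain g h where gh: "\<not> Cv dvd h" "fls_subdegree (evk R g / evk R h) = 1" by blast
      obtain t where t: "t \<in> carrier G" "\<And>R. on_curve R \<Longrightarrow> iota R t = evk R g / evk R h"
        using element_ex[OF gh(1)] by blast
      have "vR R t = 1" using t(2)[OF R] gh(2) by (simp add: vR_def)
      moreover have "t \<noteq> \<zero>\<^bsub>G\<^esub>" using calculation iota_zero[of R] R by (auto simp: vR_def)
      ultimately show ?thesis using t(1) by (intro bexI[of _ t] conjI)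
    qed
  qed
qed

section \<open>The correspondence between points and places\<close>

abbreviation KG where "KG \<equiv> curve_constants H"
abbreviation PR where "PR R \<equiv> disc_val.VM G (vR R)"
abbreviation OR where "OR R \<equiv> disc_val.VR G (vR R)"

lemma const_fr: "(const3 c, 1) \<in> fr"
  using Cv_not_dvd_1 homogeneous_1 homogeneous_const3 by (auto simp: fr_iff)

lemma KG_carrier: "KG \<subseteq> carrier G"
  unfolding curve_constants_def carrier_G using const_fr by auto

lemma iota_const: "on_curve R \<Longrightarrow> iota R (cls (const3 c, 1)) = fls_const (to_ac c)"
  using iota_cls[OF _ const_fr] by (simp add: dehom_base evk_base evk.homs)

lemma iota_KG: "on_curve R \<Longrightarrow> iota R ` KG = range (\<lambda>c. fls_const (to_ac c))"
  unfolding curve_constants_def by (auto simp: image_image iota_const)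

lemma vR_const: "on_curve R \<Longrightarrow> c \<in> KG \<Longrightarrow> vR R c = 0"
  unfolding curve_constants_def by (auto simp: vR_def iota_const)

lemma place_PR: "on_curve R \<Longrightarrow> place G KG (PR R)"
  using disc_val.place_VM[OF disc_val_vR KG_carrier] vR_const by blast

lemma valuation_PR:
  "on_curve R \<Longrightarrow> z \<in> carrier G \<Longrightarrow> z \<noteq> \<zero>\<^bsub>G\<^esub> \<Longrightarrow> valuation G (PR R) z = vR R z"
  by (rule disc_val.valuation_eq[OF disc_val_vR])

lemma iota_funs: "z \<in> carrier G \<Longrightarrow> iota None z \<in> funs"
  using carrier_repr[of z] funsI on_curve.simps(1) by metis

text \<open>The valuation ring is carried into \<open>K((t))\<close> by expansion at infinity. There
  it contains the ring of some point, and domination gives equality.\<close>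

lemma place_imp_PR:
  assumes "place G KG P"
  shows "\<exists>R. on_curve R \<and> P = PR R"
proof -
  obtain V where V: "valuation_ring G KG V" "maximalideal P (G\<lparr>carrier := V\<rparr>)"
    using assms by (auto simp: place_def)
  have sub: "subring V G" and KV: "KG \<subset> V" and VG: "V \<subset> carrier G"
    and val: "\<And>z. z \<in> carrier G \<Longrightarrow> z \<noteq> \<zero>\<^bsub>G\<^esub> \<Longrightarrow> z \<in> V \<or> inv\<^bsub>G\<^esub> z \<in> V"
    using V(1) by (auto simp: valuation_ring_def)
  define W where "W = iota None ` V"
  interpret F: Ring.field G by (rule field_G)
  have in_V: "z \<in> V" if "z \<in> carrier G" "iota None z \<in> W" for z
    using that VG inj_onD[OF iota_inj[of None]] unfolding W_def by fastforce
  have funs_ex: "\<exists>z\<in>carrier G. iota None z = x" if "x \<in> funs" for x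
  proof -
    obtain g h where "x = evk None g / evk None h" "\<not> Cv dvd h"
      using \<open>x \<in> funs\<close> unfolding funs_def by blast
    then show ?thesis using element_ex[of h g] on_curve.simps(1) by metis
  qed
  interpret herm_val q ty W
  proof (unfold_locales)
    show "W \<subseteq> funs" unfolding W_def using VG iota_funs by auto
    show "1 \<in> W" using subringE(3)[OF sub] iota_one[of None] unfolding W_def by force
    show "x + y \<in> W" if xy: "x \<in> W" "y \<in> W" for x y
    proof -
      obtain a b where ab: "a \<in> V" "b \<in> V" "x = iota None a" "y = iota None b"
        using xy unfolding W_def by blast
      then have "a \<in> carrier G" "b \<in> carrier G" using VG by blast+
      then have "x + y = iota None (a \<oplus>\<^bsub>G\<^esub> b)" using iota_add[of a b None] ab by simp
      then show ?thesis using subringE(7)[OF sub ab(1,2)] unfolding W_def by blast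
    qed
    show "x * y \<in> W" if xy: "x \<in> W" "y \<in> W" for x y
    proof -
      obtain a b where ab: "a \<in> V" "b \<in> V" "x = iota None a" "y = iota None b"
        using xy unfolding W_def by blast
      then have "a \<in> carrier G" "b \<in> carrier G" using VG by blast+
      then have "x * y = iota None (a \<otimes>\<^bsub>G\<^esub> b)" using iota_mult[of a b None] ab by simp
      then show ?thesis using subringE(6)[OF sub ab(1,2)] unfolding W_def by blast
    qed
    show "- x \<in> W" if x: "x \<in> W" for x
    proof -
      obtain a where a: "a \<in> V" "x = iota None a" using x unfolding W_def by blast
      have ac: "a \<in> carrier G" using a(1) VG by blast
      have "iota None (\<ominus>\<^bsub>G\<^esub> a) + x = 0"
        using iota_add[of "\<ominus>\<^bsub>G\<^esub> a" a None] ac a(2) iota_zero[of None] by (simp add: F.l_neg)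
      then have "- x = iota None (\<ominus>\<^bsub>G\<^esub> a)" by (metis add_eq_0_iff2)
      then show ?thesis using subringE(5)[OF sub a(1)] unfolding W_def by blast
    qed
    show "x \<in> W \<or> inverse x \<in> W" if "x \<in> funs" "x \<noteq> 0" for x
    proof -
      obtain z where z: "z \<in> carrier G" "iota None z = x" using funs_ex[OF \<open>x \<in> funs\<close>] by (elim bexE)
      have "z \<noteq> \<zero>\<^bsub>G\<^esub>" using z \<open>x \<noteq> 0\<close> iota_zero[of None] by auto
      then have "z \<in> V \<or> inv\<^bsub>G\<^esub> z \<in> V" "iota None (inv\<^bsub>G\<^esub> z) = inverse x"
        using val[OF z(1)] iota_inv[of None z] z by simp_all
      then show ?thesis unfolding W_def using z(2) by (metis imageI)
    qed
    show "fls_const (to_ac c) \<in> W" for c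
    proof -
      have "cls (const3 c, 1) \<in> V" using KV unfolding curve_constants_def by blast
      then show ?thesis unfolding W_def using iota_const[of None c] by (metis imageI on_curve.simps(1))
    qed
    show "W \<noteq> funs"
    proof
      assume "W = funs"
      then have "carrier G \<subseteq> V" using in_V iota_funs by blast
      then show False using VG by blast
    qed
  qed (auto intro: funs_mult funs_inverse)
  obtain R where R: "on_curve R" and RW: "\<And>g h. \<not> Cv dvd h \<Longrightarrow> evk R g = 0 \<or>
    fls_subdegree (evk R h) \<le> fls_subdegree (evk R g) \<Longrightarrow> evk None g / evk None h \<in> W"
    using place_center by blast
  have "OR R \<subseteq> V"
  proof
    fix z assume z: "z \<in> OR R"
    then have zc: "z \<in> carrier G" "z = \<zero>\<^bsub>G\<^esub> \<or> 0 \<le> vR R z"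
      unfolding disc_val.VR_def[OF disc_val_vR[OF R]] by auto
    obtain g h where gh: "\<not> Cv dvd h" "\<And>R. on_curve R \<Longrightarrow> iota R z = evk R g / evk R h"
      using carrier_repr[OF zc(1)] by blast
    have h0: "evk R h \<noteq> 0" using gh(1) evk_eq_0_iff[OF R] by simp
    have "evk R g = 0 \<or> fls_subdegree (evk R h) \<le> fls_subdegree (evk R g)"
    proof (cases "evk R g = 0")
      case False
      then have "iota R z \<noteq> 0" using gh(2)[OF R] h0 by simp
      then have "z \<noteq> \<zero>\<^bsub>G\<^esub>" using iota_zero[of R] R by auto
      then show ?thesis
        using zc(2) False h0 by (simp add: vR_def gh(2)[OF R] fls_divide_subdegree)
    qed simp
    then have "iota None z \<in> W" using RW[OF gh(1)] gh(2)[of None] by simp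
    then show "z \<in> V" using in_V zc(1) by blast
  qed
  then have "P = PR R" by (rule disc_val.dominated[OF disc_val_vR[OF R] V(1) _ V(2)])
  with R show ?thesis by blast
qed

end

section \<open>Frobenius conjugation and places of degree three\<close>

context hermitian
begin

section \<open>Frobenius acting on expansions\<close>

definition conj_fls :: "'k alg_closure fls \<Rightarrow> 'k alg_closure fls" where
  "conj_fls f = Abs_fls (\<lambda>n. (f $$ n) ^ Q)"

lemma Q_nz: "Q > 0"
  using Q_ge by simp

lemma pow_Q_add: "((x::'k alg_closure) + y) ^ Q = x ^ Q + y ^ Q"
  using frob_add[of x y 2] by (simp add: Q_def)

lemma cr_hom_pow_Q: "cr_hom (\<lambda>x::'k alg_closure. x ^ Q)"
  unfolding Q_def by (rule frob_cr_hom) simp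

lemma conj_nth: "conj_fls f $$ n = (f $$ n) ^ Q"
  unfolding conj_fls_def
proof (rule nth_Abs_fls_lower_bound)
  show "\<forall>n<fls_subdegree f. (f $$ n) ^ Q = 0" using Q_nz by (simp add: power_0_left)
qed

lemma conj_subdegree: "fls_subdegree (conj_fls f) = fls_subdegree f"
proof (cases "f = 0")
  case True
  then have "conj_fls f = 0" using Q_nz by (intro fls_eqI) (simp add: conj_nth power_0_left)
  then show ?thesis using True by simp
next
  case False
  then show ?thesis
    using Q_nz by (intro fls_subdegree_eqI) (auto simp: conj_nth power_0_left)
qed

sublocale conj_fls: cr_hom conj_fls
proof
  show "conj_fls (f + g) = conj_fls f + conj_fls g" for f g
    by (rule fls_eqI) (simp add: conj_nth pow_Q_add)
  show "conj_fls (f * g) = conj_fls f * conj_fls g" for f g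
    by (rule fls_eqI)
      (simp add: conj_nth fls_times_nth(1) conj_subdegree cr_hom.homs[OF cr_hom_pow_Q])
  show "conj_fls 1 = 1"
    using Q_nz by (intro fls_eqI) (auto simp: conj_nth power_0_left)
qed

lemma conj_divide: "conj_fls (f / g) = conj_fls f / conj_fls g"
proof (cases "g = 0")
  case False
  then have "conj_fls (f / g) * conj_fls g = conj_fls f" by (simp flip: conj_fls.hom_mult)
  moreover have "conj_fls g \<noteq> 0"
  proof -
    have "conj_fls g $$ fls_subdegree g \<noteq> 0" using False by (simp add: conj_nth)
    then show ?thesis by auto
  qed
  ultimately show ?thesis by (simp add: field_simps)
qed (simp add: conj_fls.hom_0)

lemma conj_base: "conj_fls (fls_const c) = fls_const (c ^ Q)" "conj_fls fls_X = fls_X"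
  using Q_nz by (auto intro!: fls_eqI simp: conj_nth power_0_left)

text \<open>The difference D satisfies D^q = -D. If it is nonzero, its order equals q times itself
  and so is 0, but the constant terms agree.\<close>

lemma as_unique:
  fixes f g :: "'k alg_closure fls"
  assumes "f ^ q + f = g ^ q + g" "\<And>n. n \<le> 0 \<Longrightarrow> f $$ n = g $$ n"
  shows "f = g"
proof (rule ccontr)
  assume "f \<noteq> g"
  then have nz: "f - g \<noteq> 0" by simp
  have "(f - g) ^ q = f ^ q - g ^ q" by (rule frob1_diff) simp
  then have "(f - g) ^ q = - (f - g)"
    using assms(1) by (metis add_diff_cancel_left' add_diff_eq diff_add_eq minus_diff_eq add.commute)
  then have "fls_subdegree ((f - g) ^ q) = fls_subdegree (f - g)" by (metis fls_uminus_subdegree)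
  then have "int q * fls_subdegree (f - g) = fls_subdegree (f - g)" by (simp add: fls_subdegree_pow)
  then have "fls_subdegree (f - g) = 0" using q_ge_2 by (cases "fls_subdegree (f - g) = 0") auto
  moreover have "(f - g) $$ fls_subdegree (f - g) \<noteq> 0" by (rule nth_fls_subdegree_nonzero[OF nz])
  ultimately have "(f - g) $$ 0 \<noteq> 0" by metis
  then show False using assms(2)[of 0] by simp
qed

fun conjR :: "'k alg_closure point \<Rightarrow> 'k alg_closure point" where
  "conjR None = None"
| "conjR (Some (a, b)) = Some (a ^ Q, b ^ Q)"

lemma on_curve_conjR: "on_curve R \<Longrightarrow> on_curve (conjR R)"
proof (cases R)
  case (Some p)
  obtain a b where p: "p = (a, b)" by (cases p)
  assume "on_curve R"
  then have "b ^ q + b = a ^ (q + 1)" using Some p by simp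
  then have "(b ^ q + b) ^ Q = (a ^ (q + 1)) ^ Q" by simp
  then have "(b ^ Q) ^ q + b ^ Q = (a ^ Q) ^ (q + 1)"
    by (simp only: pow_Q_add power_mult[symmetric] mult.commute)
  then show ?thesis using Some p by simp
qed simp

text \<open>The conjugated series solves the equation belonging to the conjugate point and has the
  right constant term, so uniqueness identifies it.\<close>

lemma conj_xs_ys:
  assumes "on_curve R"
  shows "conj_fls (xs R) = xs (conjR R)" "conj_fls (ys R) = ys (conjR R)"
proof -
  have "conj_fls (xs R) = xs (conjR R) \<and> conj_fls (ys R) = ys (conjR R)"
  proof (cases R)
    case None
    have w0: "w_inf $$ n = 0" if "n \<le> 0" for n
      using that w_inf(3) by (intro fls_eq0_below_subdegree) simp
    have "conj_fls w_inf = w_inf"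
    proof (rule as_unique)
      show "conj_fls w_inf ^ q + conj_fls w_inf = w_inf ^ q + w_inf"
        using arg_cong[OF w_inf(1), of conj_fls] unfolding conj_fls.homs conj_base by (simp only: w_inf(1))
    qed (use w0 Q_nz in \<open>simp add: conj_nth power_0_left\<close>)
    then show ?thesis using None by (simp add: xs.simps ys.simps conj_divide conj_base conj_fls.hom_1)
  next
    case (Some p)
    obtain a b where p: "p = (a, b)" by (cases p)
    let ?R = "Some (a, b)"
    have x: "conj_fls (xs ?R) = xs (conjR ?R)"
      by (simp add: xs.simps conj_fls.homs conj_base)
    have "conj_fls (ys ?R) = ys (conjR ?R)"
    proof (rule as_unique)
      have "conj_fls (ys ?R) ^ q + conj_fls (ys ?R) = conj_fls (ys ?R ^ q + ys ?R)" by (simp only: conj_fls.homs)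
      also have "\<dots> = conj_fls (xs ?R ^ (q + 1))"
        using point_eq[OF assms] Some p by simp
      also have "\<dots> = xs (conjR ?R) ^ (q + 1)" by (simp only: conj_fls.homs x)
      also have "\<dots> = ys (conjR ?R) ^ q + ys (conjR ?R)"
        using point_eq[OF on_curve_conjR[OF assms]] Some p by simp
      finally show "conj_fls (ys ?R) ^ q + conj_fls (ys ?R) = ys (conjR ?R) ^ q + ys (conjR ?R)" .
    next
      fix n :: int assume "n \<le> 0"
      then show "conj_fls (ys ?R) $$ n = ys (conjR ?R) $$ n"
        using fps_to_fls_nonpos_nth[OF as_sol(1)[OF w_aff_0]] Q_nz
        by (simp add: ys.simps conj_nth fps_to_fls_plus power_0_left)
    qed
    then show ?thesis using x Some p by simp
  qed
  then show "conj_fls (xs R) = xs (conjR R)" "conj_fls (ys R) = ys (conjR R)" by auto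
qed

lemma conj_evk:
  assumes "on_curve R"
  shows "conj_fls (evk R g) = evk (conjR R) g"
proof -
  have c: "to_ac (c::'k) ^ Q = to_ac c" for c
    using k_pow_Q[of c] by (metis to_ac_power)
  have h: "cr_hom (\<lambda>c::'k. fls_const (to_ac c))"
    by (rule cr_hom_comp[OF cr_hom_fls_const cr_hom_to_ac])
  interpret h: cr_hom "\<lambda>c::'k. fls_const (to_ac c)" by (rule h)
  have "conj_fls (evk R g) = ev2 (\<lambda>c. fls_const (to_ac c)) (conj_fls (evk R X2)) (conj_fls (evk R Y2)) g"
    by (rule h.ev2_unique[OF cr_hom_comp[OF conj_fls.cr_hom_axioms evk.cr_hom_axioms]])
      (simp add: evk_base conj_base c)
  also have "\<dots> = ev2 (\<lambda>c. fls_const (to_ac c)) (evk (conjR R) X2) (evk (conjR R) Y2) g"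
    by (simp only: evk_base conj_xs_ys[OF assms])
  also have "\<dots> = evk (conjR R) g"
    by (rule h.ev2_unique[OF evk.cr_hom_axioms, symmetric]) (simp add: evk_base)
  finally show ?thesis .
qed

lemma conj_iota:
  assumes "on_curve R" "z \<in> carrier G"
  shows "conj_fls (iota R z) = iota (conjR R) z"
proof -
  obtain g h where "\<And>R. on_curve R \<Longrightarrow> iota R z = evk R g / evk R h"
    using carrier_repr[OF assms(2)] by blast
  then show ?thesis
    using assms(1) on_curve_conjR[OF assms(1)] by (simp add: conj_divide conj_evk)
qed

lemma vR_conjR: "on_curve R \<Longrightarrow> z \<in> carrier G \<Longrightarrow> vR (conjR R) z = vR R z"
  using conj_iota[of R z] by (metis vR_def conj_subdegree)

text \<open>The degree is used only through the size of the residue field. The induction also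
  carries closure under differences and scalars: it shows that each element of a line extension has
  only one representation.\<close>

lemma dimension_card:
  fixes \<rho> :: "'c \<Rightarrow> 'k alg_closure" and Rk :: "'c ring"
  assumes "ring Rk"
    and add: "\<And>x y. x \<in> carrier Rk \<Longrightarrow> y \<in> carrier Rk \<Longrightarrow> \<rho> (x \<oplus>\<^bsub>Rk\<^esub> y) = \<rho> x + \<rho> y"
    and mult: "\<And>x y. x \<in> carrier Rk \<Longrightarrow> y \<in> carrier Rk \<Longrightarrow> \<rho> (x \<otimes>\<^bsub>Rk\<^esub> y) = \<rho> x * \<rho> y"
    and inj: "inj_on \<rho> (carrier Rk)"
    and K: "K \<subseteq> carrier Rk" "\<rho> ` K = range to_ac"
    and dim: "ring.dimension Rk n K E"
  shows "card (\<rho> ` E) = Q ^ n"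
proof -
  interpret ring Rk by fact
  have "E \<subseteq> carrier Rk \<and> card (\<rho> ` E) = Q ^ n \<and> finite (\<rho> ` E) \<and>
    (\<forall>x\<in>\<rho> ` E. \<forall>y\<in>\<rho> ` E. x - y \<in> \<rho> ` E) \<and> (\<forall>c. \<forall>x\<in>\<rho> ` E. to_ac c * x \<in> \<rho> ` E)"
    using dim K
  proof (induction rule: dimension.induct)
    case zero_dim
    have "\<rho> \<zero>\<^bsub>Rk\<^esub> = 0"
      using add[OF zero_closed zero_closed] unfolding l_zero[OF zero_closed] by (simp only: add_cancel_right_right)
    then show ?case by simp
  next
    case (Suc_dim v E n K)
    note K = Suc_dim.prems
    let ?A = "\<rho> ` E"
    have IH: "E \<subseteq> carrier Rk" "card ?A = Q ^ n" "finite ?A"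
      "\<And>x y. x \<in> ?A \<Longrightarrow> y \<in> ?A \<Longrightarrow> x - y \<in> ?A" "\<And>c x. x \<in> ?A \<Longrightarrow> to_ac c * x \<in> ?A"
      using Suc_dim.IH[OF K] by auto
    have vA: "\<rho> v \<notin> ?A"
      using Suc_dim.hyps(1,2) IH(1) inj by (auto dest: inj_onD)
    let ?f = "\<lambda>(c, x). to_ac c * \<rho> v + x"
    have im: "\<rho> ` line_extension K v E = ?f ` (UNIV \<times> ?A)"
    proof (intro equalityI subsetI)
      fix y assume "y \<in> \<rho> ` line_extension K v E"
      then obtain k e where ke: "k \<in> K" "e \<in> E" "y = \<rho> (k \<otimes>\<^bsub>Rk\<^esub> v \<oplus>\<^bsub>Rk\<^esub> e)"
        by (auto simp: line_extension_mem_iff)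
      have "\<rho> k \<in> range to_ac" using ke(1) K(2) by blast
      then obtain c where c: "\<rho> k = to_ac c" by auto
      have "y = to_ac c * \<rho> v + \<rho> e"
        using ke K(1) IH(1) Suc_dim.hyps(1) add mult c by (auto dest!: subsetD)
      then show "y \<in> ?f ` (UNIV \<times> ?A)" using ke(2) by auto
    next
      fix y assume "y \<in> ?f ` (UNIV \<times> ?A)"
      then obtain c e where ce: "e \<in> E" "y = to_ac c * \<rho> v + \<rho> e" by auto
      have "to_ac c \<in> \<rho> ` K" using K(2) by simp
      then obtain k where k: "k \<in> K" "\<rho> k = to_ac c" by auto
      have "y = \<rho> (k \<otimes>\<^bsub>Rk\<^esub> v \<oplus>\<^bsub>Rk\<^esub> e)"
        using ce k K(1) IH(1) Suc_dim.hyps(1) add mult by (auto dest!: subsetD)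
      moreover have "k \<otimes>\<^bsub>Rk\<^esub> v \<oplus>\<^bsub>Rk\<^esub> e \<in> line_extension K v E"
        unfolding line_extension_mem_iff using ce(1) k(1) by blast
      ultimately show "y \<in> \<rho> ` line_extension K v E" by blast
    qed
    have "inj_on ?f (UNIV \<times> ?A)"
    proof (rule inj_onI)
      fix s s' assume s: "s \<in> UNIV \<times> ?A" "s' \<in> UNIV \<times> ?A" "?f s = ?f s'"
      obtain c x c' x' where ss: "s = (c, x)" "s' = (c', x')" by (cases s, cases s')
      have xx: "x \<in> ?A" "x' \<in> ?A" using s ss by auto
      have eq: "to_ac (c - c') * \<rho> v = x' - x" using s(3) ss by (simp add: algebra_simps)
      have "c = c'"
      proof (rule ccontr)
        assume "c \<noteq> c'"
        then have "\<rho> v = to_ac (inverse (c - c')) * (x' - x)"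
          unfolding eq[symmetric] by simp
        then show False using vA IH(4)[OF xx(2,1)] IH(5) by metis
      qed
      then show "s = s'" using eq ss by simp
    qed
    then have card: "card (\<rho> ` line_extension K v E) = Q ^ Suc n"
      unfolding im using IH(2) card_k by (simp add: card_image card_cartesian_product Q_def)
    have fin: "finite (\<rho> ` line_extension K v E)"
      unfolding im using IH(3) finite_k by simp
    have sub: "line_extension K v E \<subseteq> carrier Rk"
    proof
      fix x assume "x \<in> line_extension K v E"
      then obtain k e where "k \<in> K" "e \<in> E" "x = k \<otimes>\<^bsub>Rk\<^esub> v \<oplus>\<^bsub>Rk\<^esub> e"
        by (auto simp: line_extension_mem_iff)
      moreover from this have "k \<in> carrier Rk" "e \<in> carrier Rk" using K(1) IH(1) by blast+
      ultimately show "x \<in> carrier Rk" using Suc_dim.hyps(1) by simp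
    qed
    have diff: "x - y \<in> ?f ` (UNIV \<times> ?A)" if "x \<in> ?f ` (UNIV \<times> ?A)" "y \<in> ?f ` (UNIV \<times> ?A)" for x y
    proof -
      obtain c e c' e' where *: "x = to_ac c * \<rho> v + e" "y = to_ac c' * \<rho> v + e'" "e \<in> ?A" "e' \<in> ?A"
        using \<open>x \<in> _\<close> \<open>y \<in> _\<close> by auto
      have "x - y = ?f (c - c', e - e')" unfolding * by (simp add: algebra_simps)
      then show ?thesis using IH(4)[OF *(3,4)] by blast
    qed
    have scale: "to_ac d * x \<in> ?f ` (UNIV \<times> ?A)" if "x \<in> ?f ` (UNIV \<times> ?A)" for d x
    proof -
      obtain c e where *: "x = to_ac c * \<rho> v + e" "e \<in> ?A"
        using \<open>x \<in> _\<close> by auto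
      have "to_ac d * x = ?f (d * c, to_ac d * e)" unfolding * by (simp add: algebra_simps)
      then show ?thesis using IH(5)[OF *(2)] by blast
    qed
    have d: "\<forall>x\<in>\<rho> ` line_extension K v E. \<forall>y\<in>\<rho> ` line_extension K v E. x - y \<in> \<rho> ` line_extension K v E"
      unfolding im by (intro ballI diff)
    have s: "\<forall>c. \<forall>x\<in>\<rho> ` line_extension K v E. to_ac c * x \<in> \<rho> ` line_extension K v E"
      unfolding im by (intro allI ballI scale)
    show ?case by (rule conjI[OF sub conjI[OF card conjI[OF fin conjI[OF d s]]]])
  qed
  then show ?thesis by blast
qed

section \<open>Residues and the degree of a place\<close>

definition res :: "'k alg_closure point \<Rightarrow> 'k curve_function \<Rightarrow> 'k alg_closure" where
  "res R z = iota R z $$ 0"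

lemma OR_iff: "on_curve R \<Longrightarrow> z \<in> OR R \<longleftrightarrow> z \<in> carrier G \<and> fls_subdegree (iota R z) \<ge> 0"
  using disc_val.VR_def[OF disc_val_vR] iota_zero[of R] by (auto simp: vR_def)

lemma PR_iff: "on_curve R \<Longrightarrow> z \<in> PR R \<longleftrightarrow> z \<in> OR R \<and> res R z = 0"
proof -
  assume R: "on_curve R"
  have "z \<in> PR R \<longleftrightarrow> z \<in> carrier G \<and> (iota R z = 0 \<or> fls_subdegree (iota R z) > 0)"
    unfolding disc_val.VM_def[OF disc_val_vR[OF R]] using iota_eq_0_iff[OF R] by (auto simp: vR_def)
  also have "\<dots> \<longleftrightarrow> z \<in> carrier G \<and> fls_subdegree (iota R z) \<ge> 0 \<and> res R z = 0"
    using fls_subdegree_pos_iff[of "iota R z"] by (auto simp: res_def)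
  finally show ?thesis by (simp add: OR_iff[OF R])
qed

lemma res_add: "on_curve R \<Longrightarrow> x \<in> OR R \<Longrightarrow> y \<in> OR R \<Longrightarrow> res R (x \<oplus>\<^bsub>G\<^esub> y) = res R x + res R y"
  using iota_add[of x y R] by (simp add: OR_iff res_def)

lemma res_mult: "on_curve R \<Longrightarrow> x \<in> OR R \<Longrightarrow> y \<in> OR R \<Longrightarrow> res R (x \<otimes>\<^bsub>G\<^esub> y) = res R x * res R y"
  using iota_mult[of x y R] by (simp add: OR_iff res_def fls_mult_nth_0)

text \<open>Taking constant coefficients identifies the residue field with a set of values in the
  closure, where it can be counted.\<close>

lemma degree_card:
  assumes R: "on_curve R" and deg: "has_degree G KG (PR R) n"
  shows "card (res R ` OR R) = Q ^ n"
proof -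
  interpret dv: disc_val G "vR R" by (rule disc_val_vR[OF R])
  let ?V = "G\<lparr>carrier := OR R\<rparr>"
  let ?Rk = "?V Quot PR R"
  interpret I: ideal "PR R" ?V by (rule dv.VM_ideal)
  have ringRk: "ring ?Rk" by (rule I.quotient_is_ring)
  define \<rho> where "\<rho> = (\<lambda>A. res R (SOME z. z \<in> A))"
  have carr: "carrier ?Rk = (\<lambda>z. PR R +>\<^bsub>?V\<^esub> z) ` OR R"
    by (auto simp: FactRing_def A_RCOSETS_def RCOSETS_def a_r_coset_def)
  have rho: "\<rho> (PR R +>\<^bsub>?V\<^esub> z) = res R z" if z: "z \<in> OR R" for z
  proof -
    have "z \<in> PR R +>\<^bsub>?V\<^esub> z" using I.a_rcos_self[of z] z by simp
    then have "(SOME z'. z' \<in> PR R +>\<^bsub>?V\<^esub> z) \<in> PR R +>\<^bsub>?V\<^esub> z" by (rule someI)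
    then obtain p where p: "p \<in> PR R" "(SOME z'. z' \<in> PR R +>\<^bsub>?V\<^esub> z) = p \<oplus>\<^bsub>G\<^esub> z"
      by (auto simp: a_r_coset_def r_coset_def)
    have "p \<in> OR R" "res R p = 0" using p(1) PR_iff[OF R] by auto
    then show ?thesis using p(2) z by (simp add: \<rho>_def res_add[OF R])
  qed
  have "card (\<rho> ` carrier ?Rk) = Q ^ n"
  proof (rule dimension_card[OF ringRk])
    show "\<rho> (x \<oplus>\<^bsub>?Rk\<^esub> y) = \<rho> x + \<rho> y" if xy: "x \<in> carrier ?Rk" "y \<in> carrier ?Rk" for x y
    proof -
      obtain a b where ab: "x = PR R +>\<^bsub>?V\<^esub> a" "y = PR R +>\<^bsub>?V\<^esub> b" "a \<in> OR R" "b \<in> OR R"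
        using xy unfolding carr by auto
      have "x \<oplus>\<^bsub>?Rk\<^esub> y = PR R +>\<^bsub>?V\<^esub> (a \<oplus>\<^bsub>G\<^esub> b)"
        using I.a_rcos_sum[of a b] ab by (simp add: FactRing_def)
      moreover have "a \<oplus>\<^bsub>G\<^esub> b \<in> OR R" using ab subringE(7)[OF dv.VR_subring] by blast
      ultimately show ?thesis using ab rho res_add[OF R] by simp
    qed
    show "\<rho> (x \<otimes>\<^bsub>?Rk\<^esub> y) = \<rho> x * \<rho> y" if xy: "x \<in> carrier ?Rk" "y \<in> carrier ?Rk" for x y
    proof -
      obtain a b where ab: "x = PR R +>\<^bsub>?V\<^esub> a" "y = PR R +>\<^bsub>?V\<^esub> b" "a \<in> OR R" "b \<in> OR R"
        using xy unfolding carr by auto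
      have "x \<otimes>\<^bsub>?Rk\<^esub> y = PR R +>\<^bsub>?V\<^esub> (a \<otimes>\<^bsub>G\<^esub> b)"
        using I.rcoset_mult_add[of a b] ab by (simp add: FactRing_def)
      moreover have "a \<otimes>\<^bsub>G\<^esub> b \<in> OR R" using ab subringE(6)[OF dv.VR_subring] by blast
      ultimately show ?thesis using ab rho res_mult[OF R] by simp
    qed
    show "inj_on \<rho> (carrier ?Rk)"
    proof (rule inj_onI)
      fix x y assume xy: "x \<in> carrier ?Rk" "y \<in> carrier ?Rk" "\<rho> x = \<rho> y"
      obtain a b where ab: "x = PR R +>\<^bsub>?V\<^esub> a" "y = PR R +>\<^bsub>?V\<^esub> b" "a \<in> OR R" "b \<in> OR R"
        using xy unfolding carr by auto
      have eq: "res R a = res R b" using xy(3) ab rho by simp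
      have mb: "\<ominus>\<^bsub>G\<^esub> b \<in> OR R" using ab subringE(5)[OF dv.VR_subring] by blast
      have bc: "a \<in> carrier G" "b \<in> carrier G" using ab dv.VR_carrier by auto
      have "res R (\<ominus>\<^bsub>G\<^esub> b) + res R b = res R \<zero>\<^bsub>G\<^esub>"
        using res_add[OF R mb ab(4)] bc by (simp add: dv.l_neg)
      also have "\<dots> = 0" using iota_zero[of R] R by (simp add: res_def)
      finally have "res R (a \<oplus>\<^bsub>G\<^esub> \<ominus>\<^bsub>G\<^esub> b) = 0"
        using res_add[OF R ab(3) mb] eq by (simp add: add.commute)
      then have "a \<oplus>\<^bsub>G\<^esub> \<ominus>\<^bsub>G\<^esub> b \<in> PR R"
        using PR_iff[OF R] subringE(7)[OF dv.VR_subring ab(3) mb] by simp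
      then have "a \<in> PR R +>\<^bsub>?V\<^esub> b"
        using bc unfolding a_r_coset_def r_coset_def
        by (auto intro!: bexI[of _ "a \<oplus>\<^bsub>G\<^esub> \<ominus>\<^bsub>G\<^esub> b"] simp: dv.a_assoc dv.l_neg)
      then show "x = y" using I.a_repr_independence'[of a b] ab by simp
    qed
    have KO: "KG \<subseteq> OR R"
      using KG_carrier vR_const[OF R] dv.VR_def by auto
    show "(\<lambda>c. PR R +>\<^bsub>?V\<^esub> c) ` KG \<subseteq> carrier ?Rk" unfolding carr using KO by auto
    have "\<rho> ` (\<lambda>c. PR R +>\<^bsub>?V\<^esub> c) ` KG = res R ` KG"
      using KO rho by (auto simp: image_image intro!: image_cong)
    also have "\<dots> = (\<lambda>z. z $$ 0) ` (iota R ` KG)" by (simp add: image_image res_def)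
    also have "\<dots> = range to_ac" unfolding iota_KG[OF R] by (auto simp: image_image)
    finally show "\<rho> ` (\<lambda>c. PR R +>\<^bsub>?V\<^esub> c) ` KG = range to_ac" .
    show "ring.dimension ?Rk n ((\<lambda>c. PR R +>\<^bsub>?V\<^esub> c) ` KG) (carrier ?Rk)"
      using deg unfolding has_degree_def dv.place_ring_VM .
  qed
  moreover have "\<rho> ` carrier ?Rk = res R ` OR R"
    unfolding carr image_image using rho by (rule image_cong[OF refl])
  ultimately show ?thesis by simp
qed

text \<open>There are Q^3 residues, more than the Q fixed points of Frobenius, so the point is not
  rational and in particular not at infinity. Multiplication by a nonzero residue permutes the
  nonzero residues, so each residue, and thus each coordinate, satisfies c^(Q^3) = c.\<close>

lemma degree3_point:
  assumes "place G KG P" "has_degree G KG P 3"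
  shows "\<exists>a b. on_curve (Some (a, b)) \<and> P = PR (Some (a, b)) \<and> a ^ Q \<noteq> a \<and> a ^ (Q ^ 3) = a \<and> b ^ (Q ^ 3) = b"
proof -
  obtain R where R: "on_curve R" "P = PR R" using place_imp_PR[OF assms(1)] by blast
  interpret dv: disc_val G "vR R" by (rule disc_val_vR[OF R(1)])
  let ?A = "res R ` OR R"
  have card: "card ?A = Q ^ 3" using degree_card[OF R(1)] assms(2) R(2) by simp
  have Q3: "Q ^ 3 > Q" using Q_ge power_strict_increasing[of 1 3 Q] by simp
  have fin: "finite ?A" using card Q_nz by (intro card_ge_0_finite) simp
  have ne: "conjR R \<noteq> R"
  proof
    assume "conjR R = R"
    have "?A \<subseteq> {z. z ^ Q = z}"
    proof clarify
      fix z assume "z \<in> OR R"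
      then have "z \<in> carrier G" using dv.VR_carrier by blast
      then show "res R z ^ Q = res R z"
        using conj_iota[OF R(1), of z] \<open>conjR R = R\<close> conj_nth[of "iota R z" 0] by (simp add: res_def)
    qed
    then have "card ?A \<le> card {z :: 'k alg_closure. z ^ Q = z}"
      using card_poly_fixed[OF Q_ge, where 'b = "'k alg_closure"] by (intro card_mono) auto
    then show False using card Q3 card_poly_fixed[OF Q_ge, where 'b = "'k alg_closure"] by linarith
  qed
  have fixed: "c ^ (Q ^ 3) = c" if c: "c \<in> ?A" for c
  proof (cases "c = 0")
    case False
    let ?B = "?A - {0}"
    have zA: "0 \<in> ?A"
    proof -
      have "res R \<zero>\<^bsub>G\<^esub> = 0" using iota_zero[of R] R(1) by (simp add: res_def)
      then show ?thesis using subringE(2)[OF dv.VR_subring] by (metis imageI)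
    qed
    have cB: "(\<lambda>x. c * x) ` ?B \<subseteq> ?B"
    proof (rule image_subsetI)
      fix x assume "x \<in> ?B"
      then obtain z where z: "z \<in> OR R" "x = res R z" "res R z \<noteq> 0" by blast
      obtain y where "y \<in> OR R" "c = res R y" using c by blast
      then have "c * res R z = res R (y \<otimes>\<^bsub>G\<^esub> z)" "y \<otimes>\<^bsub>G\<^esub> z \<in> OR R"
        using z(1) res_mult[OF R(1)] subringE(6)[OF dv.VR_subring] by auto
      then show "c * x \<in> ?B" using False z(2,3) by auto
    qed
    have inj: "inj_on (\<lambda>x. c * x) ?B" using False by (auto intro: inj_onI)
    have "(\<lambda>x. c * x) ` ?B = ?B"
      using cB fin inj by (intro card_subset_eq) (auto simp: card_image)
    then have "\<Prod>?B = (\<Prod>x\<in>?B. c * x)" using prod.reindex[OF inj, of "\<lambda>x. x"] by simp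
    also have "\<dots> = c ^ card ?B * \<Prod>?B" by (simp add: prod.distrib)
    finally have "c ^ card ?B = 1" using fin by simp
    moreover have "Q ^ 3 = Suc (card ?B)" using card zA fin Q3 by simp
    ultimately show ?thesis by (simp only: power_Suc) simp
  qed (use Q_nz in simp)
  obtain a b where ab: "R = Some (a, b)" using ne by (cases R rule: conjR.cases) auto
  have val_A: "valk a b g \<in> ?A" for g
  proof -
    obtain z where z: "z \<in> carrier G" "iota R z = evk R g / evk R 1"
      using element_ex[OF Cv_not_dvd_1, of g] R(1) by blast
    then have i: "iota R z = evk R g" by (simp add: evk.homs)
    then have "res R z = valk a b g" "z \<in> OR R"
      using z(1) R(1) evk_affine_nth0[of a b g] evk_affine_ge0[of a b g] by (auto simp: res_def ab OR_iff)
    then show ?thesis by (metis imageI)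
  qed
  have "a ^ (Q ^ 3) = a" "b ^ (Q ^ 3) = b"
    using fixed[OF val_A[of X2]] fixed[OF val_A[of Y2]] by (simp_all add: valk_base)
  \<comment> \<open>The q-th power of the curve equation is b^Q + b^q = a^Q a^q. If a were rational,
    comparison with the equation itself would make b rational too.\<close>
  moreover have "a ^ Q \<noteq> a"
  proof
    assume a: "a ^ Q = a"
    have c: "b ^ q + b = a ^ (q + 1)" using R(1) ab by simp
    have "(b ^ q + b) ^ q = b ^ Q + b ^ q" by (simp add: frob1_add Q_def power2_eq_square flip: power_mult)
    moreover have "(a ^ (q + 1)) ^ q = a ^ Q * a ^ q"
      by (simp add: Q_def power2_eq_square power_mult_distrib mult.commute flip: power_mult)
    ultimately have "b ^ Q + b ^ q = a * a ^ q" unfolding c using a by simp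
    moreover have "a * a ^ q = b + b ^ q" using c by (simp add: add.commute)
    ultimately have "b ^ Q = b" by (metis add_right_cancel)
    then show False using ne a ab by simp
  qed
  ultimately show ?thesis using R ab by blast
qed

end

section \<open>Tangent lines\<close>

context hermitian
begin

text \<open>The slope is \<open>\<alpha> ^ q\<close> because q-th powers have derivative zero, and
  the curve equation rewrites the constant term \<open>\<alpha> ^ (q + 1) - \<beta>\<close> as
  \<open>\<beta> ^ q\<close>.\<close>

definition tangent :: "'k alg_closure \<Rightarrow> 'k alg_closure \<Rightarrow> 'k alg_closure poly poly" where
  "tangent \<alpha> \<beta> = cst2 (\<alpha> ^ q) * X2 - Y2 - cst2 (\<beta> ^ q)"

lemma tangent_altdef: "tangent \<alpha> \<beta> = [:[:- (\<beta> ^ q), \<alpha> ^ q:], - 1:]"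
  by (simp add: tangent_def cst2_def X2_def Y2_def one_pCons)

lemma pow_q_q: "((x::'k alg_closure) ^ q) ^ q = x ^ Q"
  by (simp add: Q_def power2_eq_square power_mult)

lemma curve_pow_q:
  fixes \<alpha> \<beta> :: "'k alg_closure"
  assumes "\<beta> ^ q + \<beta> = \<alpha> ^ (q + 1)"
  shows "\<beta> ^ Q + \<beta> ^ q = \<alpha> ^ Q * \<alpha> ^ q"
proof -
  have "(\<beta> ^ q + \<beta>) ^ q = (\<alpha> ^ q * \<alpha>) ^ q" using assms by (simp add: mult.commute)
  moreover have "(\<beta> ^ q + \<beta>) ^ q = \<beta> ^ Q + \<beta> ^ q" by (simp add: frob1_add pow_q_q)
  moreover have "(\<alpha> ^ q * \<alpha>) ^ q = \<alpha> ^ Q * \<alpha> ^ q" by (simp only: power_mult_distrib pow_q_q)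
  ultimately show ?thesis by simp
qed

lemma as_sol_nth1: "as_sol (w_aff \<alpha>) $ 1 = \<alpha> ^ q"
  using q_ge_2 as_sol_nth[OF w_aff_0, of \<alpha> 1] by (simp add: w_aff_def fps_X_power_nth)

lemma tangent_fps:
  "evR (Some (\<gamma>, \<delta>)) (tangent \<alpha> \<beta>) = fps_to_fls (fps_const (\<alpha> ^ q) * (fps_const \<gamma> + fps_X)
    - (fps_const \<delta> + as_sol (w_aff \<gamma>)) - fps_const (\<beta> ^ q))"
  by (simp add: tangent_def evR.homs evR_base xs.simps ys.simps fps_to_fls_plus fps_to_fls_minus
      fls_times_fps_to_fls)

text \<open>With y = \<open>\<beta>\<close> + s and x = \<open>\<alpha>\<close> + t, the equation
  for s turns the tangent into s^q - \<open>\<alpha>\<close> t^q - t^(q+1). Its lowest term is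
  (\<open>\<alpha> ^ Q - \<alpha>\<close>) t^q, nonzero exactly because the coordinate is not
  rational.\<close>

lemma tangent_contact:
  assumes R: "on_curve (Some (\<alpha>, \<beta>))" and ne: "\<alpha> ^ Q \<noteq> \<alpha>"
  shows "fls_subdegree (evR (Some (\<alpha>, \<beta>)) (tangent \<alpha> \<beta>)) = int q"
proof -
  let ?s = "as_sol (w_aff \<alpha>)"
  have c: "\<beta> ^ q + \<beta> = \<alpha> ^ q * \<alpha>" using R by (simp add: mult.commute)
  define F where "F = fps_const (\<alpha> ^ q) * (fps_const \<alpha> + fps_X) - (fps_const \<beta> + ?s) - fps_const (\<beta> ^ q)"
  have "fps_const (\<alpha> ^ q) * fps_const \<alpha> - fps_const \<beta> - fps_const (\<beta> ^ q) = 0"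
    using c by (simp add: algebra_simps flip: c)
  then have "F = fps_const (\<alpha> ^ q) * fps_X - ?s" by (simp add: F_def algebra_simps)
  also have "\<dots> = ?s ^ q - fps_const \<alpha> * fps_X ^ q - fps_X ^ (q + 1)"
    using as_sol(2)[OF w_aff_0, of \<alpha>] unfolding w_aff_def by (simp add: algebra_simps)
  finally have F: "F = ?s ^ q - fps_const \<alpha> * fps_X ^ q - fps_X ^ (q + 1)" .
  have Fn: "F $ n = (if q dvd n then (?s $ (n div q)) ^ q else 0) - (if n = q then \<alpha> else 0) -
      (if n = q + 1 then 1 else 0)" for n
    unfolding F fps_sub_nth fps_frob_nth[of ?s] fps_mult_left_const_nth fps_X_power_nth by simp
  have low: "F $ n = 0" if "n < q" for n
  proof (cases "q dvd n")
    case True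
    then have "n = 0" using that by (auto dest: dvd_imp_le)
    then show ?thesis using q_pos as_sol(1)[OF w_aff_0, of \<alpha>] by (simp add: Fn)
  qed (use that in \<open>simp add: Fn\<close>)
  have "F $ q = \<alpha> ^ Q - \<alpha>"
    using q_pos as_sol_nth1[of \<alpha>] by (simp add: Fn pow_q_q)
  then have "subdegree F = q" using ne low by (intro subdegreeI) auto
  moreover have "evR (Some (\<alpha>, \<beta>)) (tangent \<alpha> \<beta>) = fps_to_fls F"
    unfolding F_def by (rule tangent_fps)
  ultimately show ?thesis by (simp add: fls_subdegree_fls_to_fps)
qed

lemma tangent_val2: "val2 \<gamma> \<delta> (tangent \<alpha> \<beta>) = \<alpha> ^ q * \<gamma> - \<delta> - \<beta> ^ q"
  by (simp add: tangent_def val2.homs val2_base)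

lemma tangent_conj_val2:
  assumes R: "on_curve (Some (\<alpha>, \<beta>))"
  shows "val2 (\<alpha> ^ Q) (\<beta> ^ Q) (tangent \<alpha> \<beta>) = 0"
proof -
  have "\<beta> ^ Q + \<beta> ^ q = \<alpha> ^ Q * \<alpha> ^ q" using R by (intro curve_pow_q) simp
  then show ?thesis unfolding tangent_val2 by (simp add: algebra_simps)
qed

text \<open>The linear coefficient at the conjugate point is the difference of the two tangent
  slopes, the q-th power of \<open>\<alpha> - \<alpha> ^ Q\<close>.\<close>

lemma tangent_conj:
  assumes R: "on_curve (Some (\<alpha>, \<beta>))" and ne: "\<alpha> ^ Q \<noteq> \<alpha>"
  shows "fls_subdegree (evR (Some (\<alpha> ^ Q, \<beta> ^ Q)) (tangent \<alpha> \<beta>)) = 1"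
proof (rule fls_subdegree_eqI)
  have "(\<alpha> - \<alpha> ^ Q) ^ q = \<alpha> ^ q - (\<alpha> ^ Q) ^ q" by (rule frob1_diff) simp
  moreover have "(\<alpha> - \<alpha> ^ Q) ^ q \<noteq> 0" using ne q_pos by simp
  moreover have "evR (Some (\<alpha> ^ Q, \<beta> ^ Q)) (tangent \<alpha> \<beta>) $$ 1 = \<alpha> ^ q - (\<alpha> ^ Q) ^ q"
    unfolding tangent_fps using as_sol_nth1[of "\<alpha> ^ Q"] by simp
  ultimately show "evR (Some (\<alpha> ^ Q, \<beta> ^ Q)) (tangent \<alpha> \<beta>) $$ 1 \<noteq> 0" by metis
next
  fix k :: int assume "k < 1"
  then show "evR (Some (\<alpha> ^ Q, \<beta> ^ Q)) (tangent \<alpha> \<beta>) $$ k = 0"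
    using tangent_conj_val2[OF R] evR_affine_nth0[of "\<alpha> ^ Q" "\<beta> ^ Q" "tangent \<alpha> \<beta>"]
      evR_affine_ge0[of "\<alpha> ^ Q" "\<beta> ^ Q" "tangent \<alpha> \<beta>"]
    by (cases "k = 0") (auto intro: fls_eq0_below_subdegree)
qed

text \<open>Eliminating y between the line and the curve gives the factorisation
  (\<open>\<gamma> ^ q - \<alpha> ^ q\<close>)(\<open>\<gamma> - \<alpha> ^ Q\<close>) = 0; the line
  then determines y.\<close>

lemma tangent_other:
  assumes R: "on_curve (Some (\<alpha>, \<beta>))" and R': "on_curve (Some (\<gamma>, \<delta>))"
    and ne: "(\<gamma>, \<delta>) \<noteq> (\<alpha>, \<beta>)" "(\<gamma>, \<delta>) \<noteq> (\<alpha> ^ Q, \<beta> ^ Q)"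
  shows "val2 \<gamma> \<delta> (tangent \<alpha> \<beta>) \<noteq> 0"
proof
  assume "val2 \<gamma> \<delta> (tangent \<alpha> \<beta>) = 0"
  then have d: "\<delta> = \<alpha> ^ q * \<gamma> - \<beta> ^ q" unfolding tangent_val2 by (simp add: algebra_simps)
  have c: "\<beta> ^ q + \<beta> = \<alpha> ^ (q + 1)" "\<delta> ^ q + \<delta> = \<gamma> ^ (q + 1)" using R R' by simp_all
  have cq: "\<beta> ^ Q + \<beta> ^ q = \<alpha> ^ Q * \<alpha> ^ q" by (rule curve_pow_q[OF c(1)])
  have "\<delta> ^ q = \<alpha> ^ Q * \<gamma> ^ q - \<beta> ^ Q"
    unfolding d by (simp add: frob1_diff power_mult_distrib pow_q_q)
  then have "\<gamma> ^ q * \<gamma> = \<alpha> ^ Q * \<gamma> ^ q - \<beta> ^ Q + (\<alpha> ^ q * \<gamma> - \<beta> ^ q)"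
    using c(2) d by (simp add: mult.commute)
  then have "\<gamma> ^ q * \<gamma> - \<alpha> ^ Q * \<gamma> ^ q - \<alpha> ^ q * \<gamma> + (\<beta> ^ Q + \<beta> ^ q) = 0" by (simp add: algebra_simps)
  then have "(\<gamma> ^ q - \<alpha> ^ q) * (\<gamma> - \<alpha> ^ Q) = 0" unfolding cq by (simp add: algebra_simps)
  then have "(\<gamma> - \<alpha>) ^ q = 0 \<or> \<gamma> = \<alpha> ^ Q" by (simp add: frob1_diff)
  then consider "\<gamma> = \<alpha>" | "\<gamma> = \<alpha> ^ Q" by auto
  then show False
  proof cases
    case 1
    then have "\<delta> + \<beta> ^ q = \<beta> + \<beta> ^ q" using d c(1) by (simp add: algebra_simps)
    then have "\<delta> = \<beta>" by simp
    then show False using 1 ne by simp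
  next
    case 2
    then have "\<delta> + \<beta> ^ q = \<beta> ^ Q + \<beta> ^ q" using d cq by (simp add: algebra_simps)
    then have "\<delta> = \<beta> ^ Q" by simp
    then show False using 2 ne by simp
  qed
qed

lemma evR_affine_unit:
  "val2 \<gamma> \<delta> g \<noteq> 0 \<Longrightarrow> evR (Some (\<gamma>, \<delta>)) g \<noteq> 0 \<and> fls_subdegree (evR (Some (\<gamma>, \<delta>)) g) = 0"
proof -
  assume *: "val2 \<gamma> \<delta> g \<noteq> 0"
  then have nz: "evR (Some (\<gamma>, \<delta>)) g \<noteq> 0" using evR_affine_nth0[of \<gamma> \<delta> g] by auto
  then show ?thesis
    using evR_affine_pos[OF nz] evR_affine_ge0[of \<gamma> \<delta> g] * by linarith
qed

lemma tangent_inf: "evR None (tangent \<alpha> \<beta>) \<noteq> 0 \<and> fls_subdegree (evR None (tangent \<alpha> \<beta>)) = - (int q + 1)"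
proof -
  have y: "ys None \<noteq> 0" "fls_subdegree (ys None) = - (int q + 1)"
    using w_inf by (simp_all add: ys.simps fls_divide_subdegree)
  have x: "xs None \<noteq> 0" "fls_subdegree (xs None) = - int q"
    using w_inf by (simp_all add: xs.simps fls_divide_subdegree)
  define A where "A = fls_const (\<alpha> ^ q) * xs None - fls_const (\<beta> ^ q)"
  have low: "A $$ k = 0" if "k < - int q" for k
  proof -
    have "xs None $$ k = 0" using that x by (intro fls_eq0_below_subdegree) simp
    then show ?thesis using that by (simp add: A_def)
  qed
  have ev: "evR None (tangent \<alpha> \<beta>) = A - ys None"
    by (simp add: tangent_def evR.homs evR_base A_def)
  have "A $$ (- (int q + 1)) = 0" by (rule low) simp
  moreover have "ys None $$ (- (int q + 1)) \<noteq> 0"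
    using nth_fls_subdegree_nonzero[OF y(1)] unfolding y(2) .
  ultimately have "evR None (tangent \<alpha> \<beta>) $$ (- (int q + 1)) \<noteq> 0"
    unfolding ev by simp
  moreover have "evR None (tangent \<alpha> \<beta>) $$ k = 0" if "k < - (int q + 1)" for k
    unfolding ev using low[of k] y that by simp
  ultimately show ?thesis by (auto intro: fls_subdegree_eqI)
qed

subsection \<open>Restriction to a tangent line\<close>

definition on_line :: "'k alg_closure \<Rightarrow> 'k alg_closure \<Rightarrow> 'k alg_closure poly poly \<Rightarrow> 'k alg_closure poly" where
  "on_line \<alpha> \<beta> g = poly g [:- (\<beta> ^ q), \<alpha> ^ q:]"

lemma on_line_mult: "on_line \<alpha> \<beta> (f * g) = on_line \<alpha> \<beta> f * on_line \<alpha> \<beta> g"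
  by (simp add: on_line_def)

lemma on_line_0_iff: "on_line \<alpha> \<beta> g = 0 \<longleftrightarrow> tangent \<alpha> \<beta> dvd g"
proof -
  have "tangent \<alpha> \<beta> = - [:- [:- (\<beta> ^ q), \<alpha> ^ q:], 1:]" by (simp add: tangent_altdef)
  then show ?thesis
    unfolding on_line_def poly_eq_0_iff_dvd by (simp only: minus_dvd_iff)
qed

lemma on_line_diff: "tangent \<alpha> \<beta> dvd g - [:on_line \<alpha> \<beta> g:]"
  unfolding on_line_0_iff[symmetric] by (simp add: on_line_def)

lemma degree_on_line:
  assumes "\<And>i j. coeff (coeff g j) i \<noteq> 0 \<Longrightarrow> i + j \<le> d"
  shows "degree (on_line \<alpha> \<beta> g) \<le> d"
  unfolding on_line_def poly_altdef
proof (rule degree_sum_le)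
  fix j assume "j \<in> {..degree g}"
  show "degree (coeff g j * [:- (\<beta> ^ q), \<alpha> ^ q:] ^ j) \<le> d"
  proof (cases "coeff g j = 0")
    case False
    then have "degree (coeff g j) + j \<le> d" by (intro assms) simp
    moreover have "degree ([:- (\<beta> ^ q), \<alpha> ^ q:] ^ j) \<le> j"
      using degree_power_le[of "[:- (\<beta> ^ q), \<alpha> ^ q:]" j] by (auto intro: order_trans)
    ultimately show ?thesis
      using degree_mult_le[of "coeff g j" "[:- (\<beta> ^ q), \<alpha> ^ q:] ^ j"] by linarith
  qed simp
qed simp

text \<open>As x - \<open>\<alpha>\<close> is the local parameter at the point, the order of P(x)
  there is the multiplicity of the root.\<close>

lemma root_order:
  assumes "P \<noteq> 0" "\<And>k. k < int m \<Longrightarrow> evR (Some (\<alpha>, \<beta>)) [:P:] $$ k = 0"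
  shows "[:- \<alpha>, 1:] ^ m dvd P"
proof -
  let ?R = "Some (\<alpha>, \<beta>)"
  obtain P' where P': "P = [:- \<alpha>, 1:] ^ order \<alpha> P * P'" "\<not> [:- \<alpha>, 1:] dvd P'"
    using order_decomp[OF assms(1)] by blast
  have "val2 \<alpha> \<beta> [:P':] = poly P' \<alpha>" by (simp add: val2_def ev2_def map_poly_pCons)
  then have u: "evR ?R [:P':] \<noteq> 0" "fls_subdegree (evR ?R [:P':]) = 0"
    using evR_affine_unit[of \<alpha> \<beta> "[:P':]"] P'(2) by (simp_all add: poly_eq_0_iff_dvd)
  have "[:P:] = [:[:- \<alpha>, 1:]:] ^ order \<alpha> P * [:P':]"
    by (subst P'(1)) (simp only: cr_hom.hom_mult[OF cr_hom_const_poly] cr_hom.hom_power[OF cr_hom_const_poly])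
  moreover have "evR ?R [:[:- \<alpha>, 1:]:] = fls_X"
  proof -
    have "[:[:- \<alpha>, 1:]:] = X2 - cst2 \<alpha>" by (simp add: X2_def cst2_def)
    then show ?thesis by (simp add: evR.homs evR_base xs.simps fps_to_fls_plus)
  qed
  ultimately have "evR ?R [:P:] = fls_X ^ order \<alpha> P * evR ?R [:P':]" by (simp only: evR.homs)
  then have nz: "evR ?R [:P:] \<noteq> 0" and "fls_subdegree (evR ?R [:P:]) = int (order \<alpha> P)"
    using u by simp_all
  then have "m \<le> order \<alpha> P"
    using assms(2)[of "int (order \<alpha> P)"] nth_fls_subdegree_nonzero[OF nz] by force
  then show ?thesis by (simp add: order_divides)
qed

text \<open>
  The tangent agrees with the curve to order \<open>q\<close>, so the restriction of \<open>g\<close> to the line inherits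
  the zero of order \<open>v \<le> q\<close>; the conjugate point is one more zero on that line.
\<close>

lemma tangent_dvd:
  assumes R: "on_curve (Some (\<alpha>, \<beta>))" and ne: "\<alpha> ^ Q \<noteq> \<alpha>"
    and deg: "\<And>i j. coeff (coeff g j) i \<noteq> 0 \<Longrightarrow> i + j \<le> v"
    and v: "v \<le> q"
    and zero: "\<And>k. k < int v \<Longrightarrow> evR (Some (\<alpha>, \<beta>)) g $$ k = 0"
    and zero': "val2 (\<alpha> ^ Q) (\<beta> ^ Q) g = 0"
  shows "tangent \<alpha> \<beta> dvd g"
proof -
  let ?R = "Some (\<alpha>, \<beta>)" and ?P = "on_line \<alpha> \<beta> g"
  obtain s where s: "g - [:?P:] = tangent \<alpha> \<beta> * s" using on_line_diff by (rule dvdE)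
  have "?P = 0"
  proof (rule ccontr)
    assume nz: "?P \<noteq> 0"
    have low: "evR ?R [:?P:] $$ k = 0" if "k < int v" for k
    proof -
      have "evR ?R g - evR ?R [:?P:] = evR ?R (tangent \<alpha> \<beta>) * evR ?R s"
        using arg_cong[OF s, of "evR ?R"] by (simp only: evR.homs)
      moreover have "(evR ?R (tangent \<alpha> \<beta>) * evR ?R s) $$ k = 0"
        using tangent_contact[OF R ne] evR_affine_ge0[of \<alpha> \<beta> s] that v
        by (intro fls_times_nth_eq0) simp
      ultimately have "(evR ?R g - evR ?R [:?P:]) $$ k = 0" by simp
      then show ?thesis using zero[OF that] by simp
    qed
    obtain P' where P': "?P = [:- \<alpha>, 1:] ^ v * P'" using root_order[OF nz low] by (rule dvdE)
    have "val2 (\<alpha> ^ Q) (\<beta> ^ Q) g - val2 (\<alpha> ^ Q) (\<beta> ^ Q) [:?P:] = 0"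
      using arg_cong[OF s, of "val2 (\<alpha> ^ Q) (\<beta> ^ Q)"] tangent_conj_val2[OF R] by (simp only: val2.homs mult_zero_left)
    then have "poly ?P (\<alpha> ^ Q) = 0" using zero' by (simp add: val2_def ev2_def map_poly_pCons)
    then have "poly P' (\<alpha> ^ Q) = 0" unfolding P' using ne by simp
    moreover have P'0: "P' \<noteq> 0" using nz P' by auto
    ultimately have "degree P' > 0"
      by (metis bot_nat_0.not_eq_extremum degree_0_id pCons_0_0 poly_const_conv)
    moreover have "degree ?P = v + degree P'"
      unfolding P' using P'0 by (subst degree_mult_eq) (simp_all add: degree_power_eq)
    ultimately show False using degree_on_line[of g v \<alpha> \<beta>, OF deg] by simp
  qed
  then show ?thesis by (simp add: on_line_0_iff)
qed

end

section \<open>The gaps at a place of degree three\<close>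

context hermitian
begin

text \<open>The pole order at infinity allowed to a polynomial of total degree d, as y has a pole of
  order q + 1. Stating it by coefficients includes the zero series and makes sums immediate.\<close>

definition pole_bound :: "nat \<Rightarrow> 'k alg_closure poly poly \<Rightarrow> bool" where
  "pole_bound d g \<longleftrightarrow> (\<forall>k < - int ((q + 1) * d). evR None g $$ k = 0)"

lemma pole_bound_add: "pole_bound d f \<Longrightarrow> pole_bound d g \<Longrightarrow> pole_bound d (f + g)"
  by (simp add: pole_bound_def evR.homs)

lemma pole_bound_mono: "pole_bound d f \<Longrightarrow> d \<le> e \<Longrightarrow> pole_bound e f"
  unfolding pole_bound_def
proof (intro allI impI)
  fix k assume *: "\<forall>k < - int ((q + 1) * d). evR None f $$ k = 0" "d \<le> e" "k < - int ((q + 1) * e)"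
  have "int ((q + 1) * d) \<le> int ((q + 1) * e)" using *(2) by (simp only: of_nat_le_iff mult_le_mono2)
  then show "evR None f $$ k = 0" using * by simp
qed

lemma pole_bound_mult:
  assumes "pole_bound d f" "pole_bound e g"
  shows "pole_bound (d + e) (f * g)"
proof (cases "evR None f = 0 \<or> evR None g = 0")
  case True
  then show ?thesis by (auto simp: pole_bound_def evR.homs)
next
  case False
  have "- int ((q + 1) * d) \<le> fls_subdegree (evR None f)"
    using assms(1) False by (intro fls_subdegree_geI) (auto simp: pole_bound_def)
  moreover have "- int ((q + 1) * e) \<le> fls_subdegree (evR None g)"
    using assms(2) False by (intro fls_subdegree_geI) (auto simp: pole_bound_def)
  ultimately show ?thesis
    unfolding pole_bound_def evR.hom_mult
    by (intro allI impI fls_times_nth_eq0) (simp add: distrib_left)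
qed

lemma pole_bound_const: "pole_bound 0 (cst2 c)"
  by (simp add: pole_bound_def evR_base)

lemma pole_bound_power: "pole_bound 1 f \<Longrightarrow> pole_bound n (f ^ n)"
proof (induction n)
  case 0
  show ?case using pole_bound_const[of 1] by (simp add: pole_bound_def evR.homs evR_base)
next
  case (Suc n)
  then show ?case using pole_bound_mult[of 1 f n "f ^ n"] by simp
qed

lemma pole_bound_tangent: "pole_bound 1 (tangent \<alpha> \<beta>)"
  using tangent_inf[of \<alpha> \<beta>] by (simp add: pole_bound_def)

lemma pole_bound_linear: "pole_bound 1 (X2 - cst2 c)"
proof -
  have "fls_subdegree (xs None) = - int q"
    using w_inf by (simp add: xs.simps fls_divide_subdegree)
  then have "xs None $$ k = 0" if "k < - int (q + 1)" for k
    using that by (intro fls_eq0_below_subdegree) simp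
  then show ?thesis by (simp add: pole_bound_def evR.homs evR_base)
qed

definition conj2 :: "'k alg_closure poly poly \<Rightarrow> 'k alg_closure poly poly" where
  "conj2 = map_poly2 (\<lambda>c. c ^ Q)"

sublocale conj2: cr_hom conj2
  unfolding conj2_def by (intro cr_hom_map2 cr_hom_pow_Q)

lemma conj2_base: "conj2 (cst2 c) = cst2 (c ^ Q)" "conj2 X2 = X2" "conj2 Y2 = Y2"
  by (simp_all add: conj2_def cr_hom.map_poly2_base[OF cr_hom_pow_Q])

lemma conj2_tangent: "conj2 (tangent \<alpha> \<beta>) = tangent (\<alpha> ^ Q) (\<beta> ^ Q)"
proof -
  have "(x ^ q) ^ Q = (x ^ Q) ^ q" for x :: "'k alg_closure"
    by (simp add: mult.commute flip: power_mult)
  then show ?thesis by (simp add: tangent_def conj2.homs conj2_base)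
qed

text \<open>Galois descent: coefficients fixed by the Q-th power lie in \<open>k\<close>.\<close>

lemma conj2_descend:
  assumes "conj2 g = g"
  obtains g0 :: "'k poly poly" where "map_poly2 to_ac g0 = g"
proof
  have range: "coeff (coeff g j) i \<in> range to_ac" for i j
  proof -
    have "(coeff (coeff g j) i) ^ Q = coeff (coeff (conj2 g) j) i"
      by (simp add: conj2_def cr_hom.coeff_map2[OF cr_hom_pow_Q])
    then show ?thesis using assms fixed_iff by simp
  qed
  show "map_poly2 to_ac (map_poly (map_poly of_ac) g) = g"
    by (intro poly_eqI)
      (simp add: cr_hom.coeff_map2[OF cr_hom_to_ac] coeff_map_poly to_ac_of_ac[OF range])
qed

text \<open>\<open>E\<close> collects the points lying over one place. The function \<open>t\<close>
  is a separator: it has positive order at \<open>R0\<close> and at no point outside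
  \<open>E\<close>, so those points belong to other places.\<close>

lemma pole_iff:
  assumes R0: "on_curve R0" and f: "f \<in> carrier G" "f \<noteq> \<zero>\<^bsub>G\<^esub>" and n: "n > 0"
    and T: "t \<in> carrier G" "vR R0 t > 0"
    and T_other: "\<And>R. on_curve R \<Longrightarrow> R \<notin> E \<Longrightarrow> vR R t \<le> 0"
    and E: "\<And>R. R \<in> E \<Longrightarrow> on_curve R \<and> PR R = PR R0"
  shows "pole_divisor G KG f = multiple_of_place n (PR R0) \<longleftrightarrow>
    vR R0 f = - int n \<and> (\<forall>R. on_curve R \<and> R \<notin> E \<longrightarrow> vR R f \<ge> 0)"
proof -
  have t0: "t \<noteq> \<zero>\<^bsub>G\<^esub>" using T(2) iota_zero[of R0] R0 by (auto simp: vR_def)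
  have other: "PR R \<noteq> PR R0" if "on_curve R" "R \<notin> E" for R
  proof
    assume eq: "PR R = PR R0"
    have "t \<in> PR R0" using T by (simp add: disc_val.VM_def[OF disc_val_vR[OF R0]])
    then have "t \<in> PR R" using eq by simp
    then have "vR R t > 0" using t0 by (simp add: disc_val.VM_def[OF disc_val_vR[OF that(1)]])
    then show False using T_other[OF that] by simp
  qed
  have at: "pole_divisor G KG f (PR R) = max 0 (- vR R f)" if "on_curve R" for R
    using place_PR[OF that] valuation_PR[OF that f] by (simp add: pole_divisor_def)
  show ?thesis
  proof
    assume eq: "pole_divisor G KG f = multiple_of_place n (PR R0)"
    have "max 0 (- vR R0 f) = int n"
      using at[OF R0] by (simp add: eq multiple_of_place_def)
    moreover have "vR R f \<ge> 0" if "on_curve R" "R \<notin> E" for R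
      using at[OF that(1)] other[OF that] by (simp add: eq multiple_of_place_def max_def split: if_splits)
    ultimately show "vR R0 f = - int n \<and> (\<forall>R. on_curve R \<and> R \<notin> E \<longrightarrow> vR R f \<ge> 0)"
      using n by auto
  next
    assume v: "vR R0 f = - int n \<and> (\<forall>R. on_curve R \<and> R \<notin> E \<longrightarrow> vR R f \<ge> 0)"
    show "pole_divisor G KG f = multiple_of_place n (PR R0)"
    proof
      fix P
      show "pole_divisor G KG f P = multiple_of_place n (PR R0) P"
      proof (cases "P = PR R0")
        case True
        then show ?thesis using at[OF R0] v by (simp add: multiple_of_place_def)
      next
        case False
        show ?thesis
        proof (cases "place G KG P")
          case True
          then obtain R where R: "on_curve R" "P = PR R" using place_imp_PR by blast
          then have "R \<notin> E" using False E by auto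
          then show ?thesis using at[OF R(1)] v R False by (simp add: multiple_of_place_def)
        next
          case False
          then show ?thesis using \<open>P \<noteq> PR R0\<close> by (simp add: multiple_of_place_def pole_divisor_def)
        qed
      qed
    qed
  qed
qed

lemma PR_conjR: "on_curve R \<Longrightarrow> PR (conjR R) = PR R"
  using vR_conjR[of R] by (auto simp: disc_val.VM_def[OF disc_val_vR] on_curve_conjR)

lemma evk_conjR_subdegree: "on_curve R \<Longrightarrow> fls_subdegree (evk (conjR R) g) = fls_subdegree (evk R g)"
  using conj_evk[of R g] by (metis conj_subdegree)

end

section \<open>The three conjugate points and their tangents\<close>

locale degree3_point = hermitian q ty for q and ty :: "'k::field itself" +
  fixes a b :: "'k alg_closure"
  assumes on: "on_curve (Some (a, b))"
    and not_rational: "a ^ Q \<noteq> a"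
    and a3: "a ^ (Q ^ 3) = a" and b3: "b ^ (Q ^ 3) = b"
begin

definition pa :: "nat \<Rightarrow> 'k alg_closure" where "pa i = a ^ (Q ^ i)"
definition pb :: "nat \<Rightarrow> 'k alg_closure" where "pb i = b ^ (Q ^ i)"
abbreviation pt :: "nat \<Rightarrow> 'k alg_closure point" where "pt i \<equiv> Some (pa i, pb i)"
definition tline :: "nat \<Rightarrow> 'k alg_closure poly poly" where "tline i = tangent (pa i) (pb i)"

lemma p_Suc: "pa i ^ Q = pa (Suc i)" "pb i ^ Q = pb (Suc i)"
  by (simp_all add: pa_def pb_def mult.commute flip: power_mult)

lemma p_0: "pa 0 = a" "pb 0 = b"
  by (simp_all add: pa_def pb_def)

lemma p_3: "pa (i + 3) = pa i" "pb (i + 3) = pb i"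
proof -
  have "a ^ (Q ^ (i + 3)) = (a ^ (Q ^ 3)) ^ (Q ^ i)" "b ^ (Q ^ (i + 3)) = (b ^ (Q ^ 3)) ^ (Q ^ i)"
    by (simp_all add: power_add mult.commute flip: power_mult)
  then show "pa (i + 3) = pa i" "pb (i + 3) = pb i" by (simp_all add: pa_def pb_def a3 b3)
qed

lemma tline_3: "tline (i + 3) = tline i"
  by (simp only: tline_def p_3)

lemma conjR_pt: "conjR (pt i) = pt (Suc i)"
  by (simp add: p_Suc)

lemma on_pt: "on_curve (pt i)"
proof (induction i)
  case 0
  then show ?case using on by (simp add: p_0)
next
  case (Suc i)
  then show ?case using on_curve_conjR[of "pt i"] by (simp only: conjR_pt)
qed

lemma pow_Q_inj: "(x::'k alg_closure) ^ Q = y ^ Q \<Longrightarrow> x = y"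
proof -
  assume "x ^ Q = y ^ Q"
  moreover have "(x - y) ^ Q = x ^ Q - y ^ Q" by (rule cr_hom.hom_diff[OF cr_hom_pow_Q])
  ultimately have "(x - y) ^ Q = 0" by simp
  then show "x = y" by simp
qed

lemma pa_ne: "pa (Suc i) \<noteq> pa i" "pa (i + 2) \<noteq> pa i"
proof -
  have 1: "pa (Suc i) \<noteq> pa i" for i
  proof (induction i)
    case 0
    then show ?case using not_rational p_Suc(1)[of 0] by (simp add: p_0)
  next
    case (Suc i)
    then show ?case using pow_Q_inj[of "pa (Suc i)" "pa i"] by (auto simp: p_Suc)
  qed
  show "pa (Suc i) \<noteq> pa i" by (rule 1)
  show "pa (i + 2) \<noteq> pa i"
  proof
    assume "pa (i + 2) = pa i"
    then have "pa (i + 2) ^ Q = pa i ^ Q" by simp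
    then have "pa (i + 3) = pa (Suc i)" by (simp add: p_Suc numeral_3_eq_3)
    then show False using 1[of i] p_3(1)[of i] by simp
  qed
qed

lemma conj2_tl: "conj2 (tline i) = tline (Suc i)"
  by (simp add: tline_def conj2_tangent p_Suc)

lemma tline_own: "fls_subdegree (evR (pt i) (tline i)) = int q"
  unfolding tline_def by (rule tangent_contact[OF on_pt]) (simp add: p_Suc pa_ne)

lemma tline_next: "fls_subdegree (evR (pt (Suc i)) (tline i)) = 1"
  using tangent_conj[OF on_pt, of i] pa_ne(1)[of i] by (simp add: tline_def p_Suc)

lemma tline_other:
  assumes "on_curve (Some (c, d))" "(c, d) \<noteq> (pa i, pb i)" "(c, d) \<noteq> (pa (Suc i), pb (Suc i))"
  shows "val2 c d (tline i) \<noteq> 0"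
  unfolding tline_def using assms by (intro tangent_other[OF on_pt]) (simp_all add: p_Suc)

lemma tline_prev: "fls_subdegree (evR (pt i) (tline (Suc i))) = 0"
  using tline_other[OF on_pt[of i], of "Suc i"] pa_ne(1)[of i] pa_ne(2)[of i] evR_affine_unit[of "pa i" "pb i" "tline (Suc i)"]
  by simp

lemma tline_nonzero: "on_curve (Some (c, d)) \<Longrightarrow> evR (Some (c, d)) (tline i) \<noteq> 0"
proof -
  assume R: "on_curve (Some (c, d))"
  show ?thesis
  proof (cases "Some (c, d) = pt i \<or> Some (c, d) = pt (Suc i)")
    case True
    then show ?thesis using tline_own[of i] tline_next[of i] q_pos by auto
  next
    case False
    then show ?thesis using tline_other[OF R, of i] evR_affine_unit[of c d "tline i"] by auto
  qed
qed

definition TK :: "'k alg_closure poly poly" where "TK = tline 0 * tline 1 * tline 2"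

lemma conj2_TK: "conj2 TK = TK"
  using tline_3[of 0] by (simp add: TK_def conj2.homs conj2_tl numeral_2_eq_2 numeral_3_eq_3)

definition T0 :: "'k poly poly" where "T0 = (SOME g. map_poly2 to_ac g = TK)"

lemma T0: "map_poly2 to_ac T0 = TK"
proof -
  have "\<exists>g. map_poly2 to_ac g = TK" using conj2_descend[OF conj2_TK] by metis
  then show ?thesis unfolding T0_def by (rule someI_ex)
qed

lemma evk_T0: "evk R T0 = evR R TK"
  by (simp add: evk_def T0)

lemma T0_pt: "fls_subdegree (evk (pt i) T0) = int q + 1"
proof (induction i)
  case 0
  \<comment> \<open>The residual zero of this tangent is \<open>pt 3\<close>, which is
    \<open>pt 0\<close>.\<close>
  have "fls_subdegree (evR (pt 0) (tline 2)) = 1"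
    using tline_next[of 2] p_3[of 0] by (simp add: numeral_3_eq_3 numeral_2_eq_2)
  moreover have "evR (pt 0) (tline 0) \<noteq> 0" "evR (pt 0) (tline 1) \<noteq> 0" "evR (pt 0) (tline 2) \<noteq> 0"
    using tline_nonzero[OF on_pt] by auto
  ultimately show ?case
    using tline_own[of 0] tline_prev[of 0] by (simp add: evk_T0 TK_def evR.homs)
next
  case (Suc i)
  then show ?case using evk_conjR_subdegree[OF on_pt, of i T0] by (simp only: conjR_pt)
qed

definition pts where "pts = {pt 0, pt 1, pt 2}"

lemma T0_other:
  assumes "on_curve (Some (c, d))" "Some (c, d) \<notin> pts"
  shows "fls_subdegree (evk (Some (c, d)) T0) = 0"
proof -
  have p3: "pa 3 = pa 0" "pb 3 = pb 0" using p_3[of 0] by simp_all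
  have "val2 c d (tline i) \<noteq> 0" if "i \<in> {0, 1, 2}" for i
    using that assms p3 by (intro tline_other) (auto simp: pts_def numeral_2_eq_2 numeral_3_eq_3)
  then have "val2 c d TK \<noteq> 0" by (simp add: TK_def val2.homs)
  then show ?thesis using evR_affine_unit by (simp add: evk_T0)
qed

lemma T0_inf: "fls_subdegree (evk None T0) = - 3 * (int q + 1)" "evk None T0 \<noteq> 0"
  using tangent_inf by (simp_all add: evk_T0 TK_def evR.homs tline_def)

lemma T0_Cv: "\<not> Cv dvd T0"
  using T0_inf(2) by (simp add: evk_None_eq_0_iff)

lemma Cv_dvd_power: "Cv dvd (g :: 'k poly poly) ^ n \<Longrightarrow> Cv dvd g"
  by (induction n) (auto simp: Cv_not_dvd_1 Cv_dvd_mult)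

lemma pole_iff':
  assumes "f \<in> carrier G" "f \<noteq> \<zero>\<^bsub>G\<^esub>" "n > 0"
  shows "pole_divisor G KG f = multiple_of_place n (PR (pt 0)) \<longleftrightarrow>
    vR (pt 0) f = - int n \<and> (\<forall>R. on_curve R \<and> R \<notin> pts \<longrightarrow> vR R f \<ge> 0)"
proof -
  obtain t where t: "t \<in> carrier G" "\<And>R. on_curve R \<Longrightarrow> iota R t = evk R T0 / evk R 1"
    using element_ex[OF Cv_not_dvd_1, of T0] by blast
  have vt: "vR R t = fls_subdegree (evk R T0)" if "on_curve R" for R
    using t(2)[OF that] by (simp add: vR_def evk.homs)
  show ?thesis
  proof (rule pole_iff[OF on_pt assms t(1)])
    show "0 < vR (pt 0) t" using vt[OF on_pt] T0_pt[of 0] by simp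
    show "vR R t \<le> 0" if "on_curve R" "R \<notin> pts" for R
    proof (cases R)
      case None
      then show ?thesis using vt[OF that(1)] T0_inf by simp
    next
      case (Some p)
      then show ?thesis using vt[OF that(1)] that T0_other by (cases p) simp
    qed
    have "PR (pt (Suc i)) = PR (pt i)" for i
      using PR_conjR[OF on_pt, of i] by (simp only: conjR_pt)
    then have "PR (pt 1) = PR (pt 0)" "PR (pt 2) = PR (pt 0)"
      by (simp_all only: One_nat_def numeral_2_eq_2)
    then show "on_curve R \<and> PR R = PR (pt 0)" if "R \<in> pts" for R
      using that on_pt unfolding pts_def by blast
  qed
qed

end

section \<open>Constructing functions for non-gaps and excluding them for gaps\<close>

context degree3_point
begin

text \<open>The function is F/T^u. At infinity the denominator has a pole of order 3u(q + 1),
  exactly what the bound allows to F, so no pole appears there.\<close>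

lemma nongap_from_poly:
  assumes u: "u \<ge> 1" and v: "v \<le> q"
    and n: "int n = int u * (int q + 1) - int v"
    and F: "fls_subdegree (evk (pt 0) F) = int v" "evk (pt 0) F \<noteq> 0"
    and bound: "pole_bound (3 * u) (map_poly2 to_ac F)"
  shows "\<exists>f\<in>carrier G - {\<zero>\<^bsub>G\<^esub>}. pole_divisor G KG f = multiple_of_place n (PR (pt 0))"
proof -
  have "\<not> Cv dvd T0 ^ u" using Cv_dvd_power T0_Cv by blast
  then obtain f where f: "f \<in> carrier G" "\<And>R. on_curve R \<Longrightarrow> iota R f = evk R F / evk R (T0 ^ u)"
    using element_ex[of "T0 ^ u" F] by blast
  have Fnz: "evk R F \<noteq> 0" if "on_curve R" for R
    using F(2) evk_eq_0_iff[OF that] evk_eq_0_iff[OF on_pt] by simp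
  have Tnz: "evk R T0 \<noteq> 0" if "on_curve R" for R
    using T0_Cv evk_eq_0_iff[OF that] by simp
  have vf: "vR R f = fls_subdegree (evk R F) - int u * fls_subdegree (evk R T0)" if "on_curve R" for R
    using f(2)[OF that] Fnz[OF that] Tnz[OF that]
    by (simp add: vR_def evk.homs fls_divide_subdegree fls_subdegree_pow)
  have fnz: "f \<noteq> \<zero>\<^bsub>G\<^esub>"
  proof
    assume "f = \<zero>\<^bsub>G\<^esub>"
    then have "iota None f = 0" using iota_zero[of None] by simp
    then show False using f(2)[of None] Fnz[of None] Tnz[of None] by (simp add: evk.homs)
  qed
  have "int q + 1 \<le> int u * (int q + 1)" using u mult_right_mono[of 1 "int u" "int q + 1"] by simp
  then have npos: "n > 0" using n v by linarith
  have "vR (pt 0) f = - int n"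
    using vf[OF on_pt] F(1) T0_pt[of 0] n by simp
  moreover have "vR R f \<ge> 0" if R: "on_curve R" "R \<notin> pts" for R
  proof (cases R)
    case None
    have "- int ((q + 1) * (3 * u)) \<le> fls_subdegree (evk None F)"
      using bound Fnz[of None] by (intro fls_subdegree_geI) (auto simp: pole_bound_def evk_def)
    then show ?thesis using vf[OF R(1)] T0_inf(1) None by (simp add: algebra_simps)
  next
    case (Some p)
    then show ?thesis
      using vf[OF R(1)] T0_other R evk_affine_ge0[of "fst p" "snd p" F] by (cases p) simp
  qed
  ultimately show ?thesis
    using pole_iff'[OF f(1) fnz npos] f(1) fnz by (intro bexI[of _ f]) auto
qed

text \<open>At \<open>pt i\<close> and for \<open>c\<close> nonzero the order is v: the linear
  factor gives v - 1, \<open>tline (i + 1)\<close> gives 0, and \<open>tline (i + 2)\<close>, whose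
  residual zero is \<open>pt i\<close>, gives 1. Frobenius shifts i, so the sum over i = 0, 1, 2 is
  a trace.\<close>

definition summand :: "'k alg_closure \<Rightarrow> nat \<Rightarrow> nat \<Rightarrow> 'k alg_closure poly poly" where
  "summand c v i = cst2 (c ^ (Q ^ i)) * ((X2 - cst2 (pa i)) ^ (v - 1) * (tline (i + 1) * tline (i + 2)))"

lemma conj2_summand: "conj2 (summand c v i) = summand c v (Suc i)"
  by (simp add: summand_def conj2.homs conj2_base conj2_tl p_Suc mult.commute flip: power_mult)

lemma summand_3:
  assumes "c ^ (Q ^ 3) = c"
  shows "summand c v 3 = summand c v 0"
  using assms p_3[of 0] tline_3[of 1] tline_3[of 2] by (simp add: summand_def numeral_2_eq_2)

lemma pole_bound_summand: "v \<ge> 1 \<Longrightarrow> pole_bound (v + 1) (summand c v i)"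
proof -
  assume "v \<ge> 1"
  have "pole_bound (0 + ((v - 1) + (1 + 1))) (summand c v i)"
    unfolding summand_def tline_def
    by (intro pole_bound_mult pole_bound_const pole_bound_power pole_bound_linear pole_bound_tangent)
  then show ?thesis using \<open>v \<ge> 1\<close> by simp
qed

text \<open>
  The first summand vanishes to order exactly \<open>v\<close> at the point, the conjugate ones at least to
  order \<open>q\<close>. Only for \<open>v = q\<close> can leading terms cancel; the factor \<open>c\<close> prevents this.
\<close>

lemma trace_order:
  assumes v: "1 \<le> v" "v \<le> q"
  shows "\<exists>c. c ^ (Q ^ 3) = c \<and>
    evR (pt 0) (summand c v 0 + summand c v 1 + summand c v 2) \<noteq> 0 \<and>
    fls_subdegree (evR (pt 0) (summand c v 0 + summand c v 1 + summand c v 2)) = int v"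
proof -
  let ?R = "pt 0"
  have lin: "evR ?R (X2 - cst2 (pa 0)) = fls_X"
    by (simp add: evR.homs evR_base xs.simps fps_to_fls_plus)
  have tl2: "fls_subdegree (evR ?R (tline 2)) = 1"
    using tline_next[of 2] p_3[of 0] by (simp add: numeral_3_eq_3 numeral_2_eq_2)
  have nz: "evR ?R (tline i) \<noteq> 0" for i by (rule tline_nonzero[OF on_pt])
  have ge: "fls_subdegree (evR ?R g) \<ge> 0" for g by (rule evR_affine_ge0)
  have s: "evR ?R (summand c v i) = fls_const (c ^ (Q ^ i)) * evR ?R (summand 1 v i)" for c i
    by (simp add: summand_def evR.homs evR_base)
  have s0: "fls_subdegree (evR ?R (summand 1 v 0)) = int v" "evR ?R (summand 1 v 0) \<noteq> 0"
  proof -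
    have "summand 1 v 0 = (X2 - cst2 (pa 0)) ^ (v - 1) * (tline 1 * tline 2)"
      by (simp add: summand_def cst2_def one_pCons[symmetric] numeral_2_eq_2)
    then have eq: "evR ?R (summand 1 v 0) = fls_X ^ (v - 1) * (evR ?R (tline 1) * evR ?R (tline 2))"
      by (simp only: evR.hom_mult evR.hom_power lin)
    show "fls_subdegree (evR ?R (summand 1 v 0)) = int v" "evR ?R (summand 1 v 0) \<noteq> 0"
      unfolding eq using v nz tline_prev[of 0] tl2 by (simp_all add: fls_subdegree_pow)
  qed
  have s1: "evR ?R (summand 1 v 1) $$ k = 0" if "k \<le> int q" for k
  proof -
    have t3: "tline 3 = tline 0" using tline_3[of 0] by simp
    have "summand 1 v 1 = (X2 - cst2 (pa 1)) ^ (v - 1) * (tline 2 * tline 0)"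
      by (simp add: summand_def cst2_def one_pCons[symmetric] t3 flip: numeral_2_eq_2 numeral_3_eq_3)
    then have "evR ?R (summand 1 v 1) = evR ?R ((X2 - cst2 (pa 1)) ^ (v - 1)) * (evR ?R (tline 2) * evR ?R (tline 0))"
      by (simp only: evR.hom_mult)
    then show ?thesis
      using that ge[of "(X2 - cst2 (pa 1)) ^ (v - 1)"] nz tl2 tline_own[of 0]
      by (simp only:) (intro fls_times_nth_eq0, simp)
  qed
  \<comment> \<open>Here only order q is guaranteed, since \<open>tline 1\<close> does not vanish at
    \<open>pt 0\<close>; in the previous summand both tangents vanish there and give q + 1.\<close>
  have s2: "evR ?R (summand 1 v 2) $$ k = 0" if "k < int q" for k
  proof -
    have t34: "tline 3 = tline 0" "tline 4 = tline 1" using tline_3[of 0] tline_3[of 1] by simp_all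
    have "summand 1 v 2 = (X2 - cst2 (pa 2)) ^ (v - 1) * (tline 0 * tline 1)"
      by (simp add: summand_def cst2_def one_pCons[symmetric] t34)
    then have "evR ?R (summand 1 v 2) = evR ?R ((X2 - cst2 (pa 2)) ^ (v - 1)) * (evR ?R (tline 0) * evR ?R (tline 1))"
      by (simp only: evR.hom_mult)
    then show ?thesis
      using that ge[of "(X2 - cst2 (pa 2)) ^ (v - 1)"] nz tline_own[of 0] tline_prev[of 0]
      by (simp only:) (intro fls_times_nth_eq0, simp)
  qed
  define A B where "A = evR ?R (summand 1 v 0) $$ int v" and "B = evR ?R (summand 1 v 2) $$ int v"
  have A0: "A \<noteq> 0" using s0 nth_fls_subdegree_nonzero[OF s0(2)] by (simp add: A_def)
  define F where "F = (\<lambda>c. summand c v 0 + summand c v 1 + summand c v 2)"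
  have low: "evR ?R (F c) $$ k = 0" if "k < int v" for c k
    using that v(2) s0 s1[of k] s2[of k] by (simp add: F_def evR.homs s[of c])
  have top: "evR ?R (F c) $$ int v = c * A + c ^ (Q ^ 2) * B" for c
    using v(2) s1[of "int v"] by (simp add: F_def evR.homs s[of c] A_def B_def)
  \<comment> \<open>The choice c = 1 fails only for B = -A, and then c = a works because a differs
    from a^(Q^2).\<close>
  have "\<exists>c. c ^ (Q ^ 3) = c \<and> c * A + c ^ (Q ^ 2) * B \<noteq> 0"
  proof (cases "A + B = 0")
    case False
    then show ?thesis by (intro exI[of _ 1]) simp
  next
    case True
    then have "B = - A" by (simp add: eq_neg_iff_add_eq_0 add.commute)
    then have "a * A + a ^ (Q ^ 2) * B = (a - a ^ (Q ^ 2)) * A" by (simp add: algebra_simps)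
    moreover have "a - a ^ (Q ^ 2) \<noteq> 0" using pa_ne(2)[of 0] by (simp add: pa_def numeral_2_eq_2)
    ultimately show ?thesis using A0 a3 by (intro exI[of _ a]) auto
  qed
  then obtain c where c: "c ^ (Q ^ 3) = c" "evR ?R (F c) $$ int v \<noteq> 0" unfolding top by blast
  have "fls_subdegree (evR ?R (F c)) = int v" using c(2) low by (intro fls_subdegree_eqI)
  moreover have "evR ?R (F c) \<noteq> 0" using c(2) by auto
  ultimately show ?thesis using c(1) unfolding F_def by blast
qed

lemma nongap:
  assumes u: "u \<ge> 1" and v: "v \<le> q" and uv: "v < 3 * u"
    and n: "int n = int u * (int q + 1) - int v"
  shows "\<exists>f\<in>carrier G - {\<zero>\<^bsub>G\<^esub>}. pole_divisor G KG f = multiple_of_place n (PR (pt 0))"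
proof (cases "v = 0")
  case True
  show ?thesis
  proof (rule nongap_from_poly[OF u v n, of 1])
    show "fls_subdegree (evk (pt 0) 1) = int v" "evk (pt 0) 1 \<noteq> 0" using True by (simp_all add: evk.homs)
    show "pole_bound (3 * u) (map_poly2 to_ac 1)"
      using pole_bound_mono[OF pole_bound_const[of 1], of "3 * u"]
      unfolding lift.hom_1 cr_hom.hom_1[OF cr_hom_cst2] by simp
  qed
next
  case False
  then have v1: "1 \<le> v" by simp
  obtain c where c: "c ^ (Q ^ 3) = c"
    and F: "evR (pt 0) (summand c v 0 + summand c v 1 + summand c v 2) \<noteq> 0"
      "fls_subdegree (evR (pt 0) (summand c v 0 + summand c v 1 + summand c v 2)) = int v"
    using trace_order[OF v1 v] by blast
  let ?F = "summand c v 0 + summand c v 1 + summand c v 2"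
  have "conj2 ?F = ?F"
    using summand_3[OF c, of v] by (simp add: conj2.homs conj2_summand numeral_2_eq_2 numeral_3_eq_3)
  then obtain F0 :: "'k poly poly" where F0: "map_poly2 to_ac F0 = ?F" using conj2_descend by metis
  have "pole_bound (v + 1) ?F" using v1 by (intro pole_bound_add pole_bound_summand)
  then have "pole_bound (3 * u) ?F" by (rule pole_bound_mono) (use uv in simp)
  then show ?thesis
    using F F0 by (intro nongap_from_poly[OF u v n, of F0]) (simp_all add: evk_def)
qed

text \<open>The product f T^u has no finite poles. Clearing the denominator of f by its norm and
  cancelling the resulting polynomial in x shows that it is a polynomial F. On each tangent, degree
  at most 3u leaves too little room for the zeros of order v and the conjugate zero.\<close>

lemma gap:
  assumes u: "u \<ge> 1" and v: "v \<le> q" and uv: "3 * u \<le> v"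
    and n: "int n = int u * (int q + 1) - int v"
    and f: "f \<in> carrier G - {\<zero>\<^bsub>G\<^esub>}"
  shows "pole_divisor G KG f \<noteq> multiple_of_place n (PR (pt 0))"
proof
  assume "pole_divisor G KG f = multiple_of_place n (PR (pt 0))"
  have "int q + 1 \<le> int u * (int q + 1)" using u mult_right_mono[of 1 "int u" "int q + 1"] by simp
  then have npos: "n > 0" using n v by linarith
  have v0: "vR (pt 0) f = - int n" and vo: "\<And>R. on_curve R \<Longrightarrow> R \<notin> pts \<Longrightarrow> vR R f \<ge> 0"
    using \<open>pole_divisor G KG f = _\<close> pole_iff'[of f n] f npos by auto
  have v_pt: "vR (pt i) f = - int n" for i
  proof (induction i)
    case (Suc i)
    then show ?case using vR_conjR[OF on_pt, of f i] f by (simp only: conjR_pt Diff_iff)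
  qed (rule v0)
  obtain g h where gh: "\<not> Cv dvd h" "\<And>R. on_curve R \<Longrightarrow> iota R f = evk R g / evk R h"
    using carrier_repr[of f] f by blast
  obtain c D where D: "Cv dvd h * c - [:D:]" "D \<noteq> 0" using norm_ex[of h] gh(1) by blast
  have hnz: "evk R h \<noteq> 0" if "on_curve R" for R using gh(1) evk_eq_0_iff[OF that] by simp
  have fnz: "iota R f \<noteq> 0" if "on_curve R" for R using iota_eq_0_iff[OF that, of f] f by simp
  have Tnz: "evk R T0 \<noteq> 0" if "on_curve R" for R
    using T0_Cv evk_eq_0_iff[OF that] by simp
  obtain r where r: "Cv dvd g * T0 ^ u * c - r" "r = 0 \<or> degree r < degree (Cv :: 'k poly poly)"
    using monic_division[OF Cv_monic(2)] .
  define D' where "D' = map_poly to_ac D"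
  have D'0: "D' \<noteq> 0" using D(2) by (simp add: D'_def map_poly_eq_0_iff)
  have evD: "evk R [:D:] = evR R [:D':]" for R
    by (simp add: evk_def map_poly2_def map_poly_pCons D'_def)
  have Dnz: "evR R [:D':] \<noteq> 0" if "on_curve R" for R
  proof (cases R)
    case None
    then show ?thesis using D'0 q_pos inf_order(1)[of "[:D':]"] by simp
  next
    case (Some p)
    then show ?thesis using evR_const_poly_nonzero[OF D'0] by (cases p) simp
  qed
  define r' where "r' = map_poly2 to_ac r"
  have deg_r': "degree r' < q"
    using r(2) q_pos by (auto simp: r'_def degree_map2_to_ac Cv_monic)
  have evr: "evR R r' = evR R [:D':] * (iota R f * evk R T0 ^ u)" if "on_curve R" for R
  proof -
    have "evk R h * evk R c = evR R [:D':]"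
      using evk_cong[OF that D(1)] by (simp add: evk.homs evD)
    moreover have "evR R r' = evk R g * evk R T0 ^ u * evk R c"
      using evk_cong[OF that r(1)] unfolding r'_def evk_def[symmetric] by (simp add: evk.homs)
    moreover have "evk R g = iota R f * evk R h"
      using gh(2)[OF that] hnz[OF that] by simp
    then have "evk R g * evk R T0 ^ u * evk R c = (evk R h * evk R c) * (iota R f * evk R T0 ^ u)"
      by (simp only: mult_ac)
    ultimately show ?thesis by metis
  qed
  have reg: "fls_subdegree (iota (Some (x, y)) f * evk (Some (x, y)) T0 ^ u) \<ge> 0"
    if R: "on_curve (Some (x, y))" for x y
  proof -
    have sd: "fls_subdegree (iota (Some (x, y)) f * evk (Some (x, y)) T0 ^ u) =
        vR (Some (x, y)) f + int u * fls_subdegree (evk (Some (x, y)) T0)"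
      using fnz[OF R] Tnz[OF R] by (simp add: vR_def fls_subdegree_pow)
    show ?thesis
    proof (cases "Some (x, y) \<in> pts")
      case True
      then obtain i where "Some (x, y) = pt i" by (auto simp: pts_def)
      then show ?thesis unfolding sd using v_pt[of i] T0_pt[of i] n by simp
    next
      case False
      then show ?thesis unfolding sd using vo[OF R False] T0_other[OF R False] by simp
    qed
  qed
  have "\<exists>F. r' = smult D' F \<and> degree F < q"
  proof (rule regular_imp_polynomial[OF D'0 deg_r'])
    fix x y assume R: "on_curve (Some (x, y))"
    show "evR (Some (x, y)) r' = 0 \<or>
      fls_subdegree (evR (Some (x, y)) [:D':]) \<le> fls_subdegree (evR (Some (x, y)) r')"
      using reg[OF R] Dnz[OF R] fnz[OF R] Tnz[OF R] unfolding evr[OF R] by simp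
  qed
  then obtain F where F: "r' = smult D' F" "degree F < q" by blast
  have evF: "evR R F = iota R f * evk R T0 ^ u" if "on_curve R" for R
  proof -
    have "r' = [:D':] * F" using F(1) by simp
    then have "evR R [:D':] * evR R F = evR R [:D':] * (iota R f * evk R T0 ^ u)"
      using evr[OF that] by (simp only: evR.hom_mult)
    then show ?thesis using Dnz[OF that] by simp
  qed
  have sdF: "fls_subdegree (evR R F) = vR R f + int u * fls_subdegree (evk R T0)" if "on_curve R" for R
    unfolding evF[OF that] using fnz[OF that] Tnz[OF that] by (simp add: vR_def fls_subdegree_pow)
  have Fnz: "evR R F \<noteq> 0" if "on_curve R" for R
    unfolding evF[OF that] using fnz[OF that] Tnz[OF that] by simp
  have sd_pt: "fls_subdegree (evR (pt i) F) = int v" for i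
    using sdF[OF on_pt, of i] v_pt[of i] T0_pt[of i] n by simp
  have sd_inf: "- (3 * int u * (int q + 1)) \<le> fls_subdegree (evR None F)"
    using sdF[of None] vo[of None] T0_inf(1) by (simp add: pts_def algebra_simps)
  have coeffs: "q * i + (q + 1) * j \<le> 3 * u * (q + 1)" if "coeff (coeff F j) i \<noteq> 0" for i j
  proof -
    have "F \<noteq> 0" using that by auto
    from inf_order(2)[OF this F(2) that]
    have "int (q * i + (q + 1) * j) \<le> - fls_subdegree (evR None F)" .
    also have "\<dots> \<le> 3 * int u * (int q + 1)" using sd_inf by linarith
    also have "\<dots> = int (3 * u * (q + 1))" by (simp add: algebra_simps)
    finally show ?thesis by (simp only: of_nat_le_iff)
  qed
  \<comment> \<open>Pole order at most 3u(q + 1) with i + j > 3u forces q + j to be at most 3u. As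
    3u is at most q, this leaves j = 0, 3u = q and i = q + 1.\<close>
  have small: "i + j \<le> 3 * u \<or> (j = 0 \<and> i = q + 1 \<and> 3 * u = q)" if "coeff (coeff F j) i \<noteq> 0" for i j
  proof (rule disjCI)
    assume no: "\<not> (j = 0 \<and> i = q + 1 \<and> 3 * u = q)"
    show "i + j \<le> 3 * u"
    proof (rule ccontr)
      assume gt: "\<not> i + j \<le> 3 * u"
      have le: "q * (i + j) + j \<le> q * (3 * u) + 3 * u"
        using coeffs[OF that] by (simp add: algebra_simps)
      have "q * (3 * u + 1) \<le> q * (i + j)" using gt by (intro mult_le_mono2) simp
      then have "q + j \<le> 3 * u" using le by (simp add: algebra_simps)
      then have *: "j = 0" "3 * u = q" using v uv by linarith+
      then have "q * i \<le> q * (q + 1)" using le by (simp add: algebra_simps)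
      then have "i \<le> q + 1" using q_pos by (simp only: mult_le_cancel1)
      then show False using no gt * by simp
    qed
  qed
  \<comment> \<open>Adding e times the curve equation trades the exceptional x^(q+1) for y^q + y, of
    degree q = 3u, without changing any value on the curve.\<close>
  define e where "e = coeff (coeff F 0) (q + 1)"
  define F' where "F' = F + cst2 e * Cv"
  have coeff_Cv: "coeff (coeff (Cv :: 'k alg_closure poly poly) j) i =
      (if i = 0 \<and> j = q then 1 else 0) + (if i = 0 \<and> j = 1 then 1 else 0) - (if i = q + 1 \<and> j = 0 then 1 else 0)" for i j
  proof -
    have "Y2 ^ q = (monom (monom 1 0) q :: 'k alg_closure poly poly)"
      by (simp add: Y2_def monom_altdef flip: one_pCons)
    then have 1: "coeff (coeff (Y2 ^ q :: 'k alg_closure poly poly) j) i = (if i = 0 \<and> j = q then 1 else 0)"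
      by (simp add: coeff_monom)
    have 2: "coeff (coeff (Y2 :: 'k alg_closure poly poly) j) i = (if i = 0 \<and> j = 1 then 1 else 0)"
      by (auto simp: Y2_def coeff_pCons one_pCons split: nat.splits)
    have "X2 ^ (q + 1) = (monom (monom 1 (q + 1)) 0 :: 'k alg_closure poly poly)"
      unfolding X2_def monom_altdef
      by (simp add: cr_hom.hom_power[OF cr_hom_const_poly] del: power_Suc flip: one_pCons)
    then have 3: "coeff (coeff (X2 ^ (q + 1) :: 'k alg_closure poly poly) j) i = (if i = q + 1 \<and> j = 0 then 1 else 0)"
      by (simp add: coeff_monom)
    show ?thesis unfolding Cv_def coeff_add coeff_diff 1 2 3 ..
  qed
  have small': "i + j \<le> 3 * u" if "coeff (coeff F' j) i \<noteq> 0" for i j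
  proof (rule ccontr)
    assume gt: "\<not> i + j \<le> 3 * u"
    have c: "coeff (coeff F' j) i = coeff (coeff F j) i + e * coeff (coeff Cv j) i"
      by (simp add: F'_def cst2_def)
    show False
    proof (cases "coeff (coeff F j) i = 0")
      case True
      then have e0: "e \<noteq> 0" "coeff (coeff (Cv :: 'k alg_closure poly poly) j) i \<noteq> 0" using c that by auto
      then have "3 * u = q" using small[of 0 "q + 1"] v uv by (auto simp: e_def)
      then have "i = q + 1 \<and> j = 0" using e0(2) gt q_pos by (auto simp: coeff_Cv split: if_splits)
      then show False using True e0(1) by (simp add: e_def)
    next
      case False
      then have "j = 0 \<and> i = q + 1" using small[OF False] gt by simp
      then show False using that c q_pos by (simp add: coeff_Cv e_def)
    qed
  qed
  have evF': "evR R F' = evR R F" if "on_curve R" for R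
    using evR_Cv[OF that] by (simp add: F'_def evR.homs)
  have dvd: "tline i dvd F'" for i
    unfolding tline_def
  proof (rule tangent_dvd[OF on_pt, of i F' v])
    show "pa i ^ Q \<noteq> pa i" by (simp add: p_Suc pa_ne)
    show "i' + j' \<le> v" if "coeff (coeff F' j') i' \<noteq> 0" for i' j' using small'[OF that] uv by simp
    show "v \<le> q" by (rule v)
    show "evR (pt i) F' $$ k = 0" if "k < int v" for k
      unfolding evF'[OF on_pt] using that sd_pt[of i] by (intro fls_eq0_below_subdegree) simp
    have "evR (pt (Suc i)) F $$ 0 = 0"
      using sd_pt[of "Suc i"] u uv by (intro fls_eq0_below_subdegree) simp
    then show "val2 (pa i ^ Q) (pb i ^ Q) F' = 0"
      unfolding p_Suc evR_affine_nth0[symmetric] evF'[OF on_pt] .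
  qed
  obtain F1 where F1: "F' = tline 0 * F1" using dvd[of 0] by (rule dvdE)
  have "on_line (pa 2) (pb 2) (tline 0) * on_line (pa 2) (pb 2) F1 = 0"
    using dvd[of 2] unfolding F1 tline_def by (simp only: on_line_0_iff flip: on_line_mult)
  moreover have "on_line (pa 2) (pb 2) (tline 0) \<noteq> 0"
  proof
    assume "on_line (pa 2) (pb 2) (tline 0) = 0"
    \<comment> \<open>On the other tangent line this coefficient is the difference of the two
      slopes, which are q-th powers of distinct elements.\<close>
    then have "coeff (on_line (pa 2) (pb 2) (tline 0)) 1 = 0" by simp
    then have "pa 0 ^ q = pa 2 ^ q" by (simp add: on_line_def tline_def tangent_altdef)
    then have "pa 0 ^ Q = pa 2 ^ Q" by (metis pow_q_q)
    then show False using pow_Q_inj pa_ne(2)[of 0] by (metis add_0)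
  qed
  ultimately have "tline 2 dvd F1" by (simp add: on_line_0_iff tline_def)
  then obtain F2 where F2: "F1 = tline 2 * F2" by (rule dvdE)
  have ev: "evR (pt 0) F = evR (pt 0) (tline 0) * (evR (pt 0) (tline 2) * evR (pt 0) F2)"
    unfolding evF'[OF on_pt, symmetric] F1 F2 by (simp only: evR.hom_mult)
  have tl2: "fls_subdegree (evR (pt 0) (tline 2)) = 1"
    using tline_next[of 2] p_3[of 0] by (simp add: numeral_3_eq_3 numeral_2_eq_2)
  \<comment> \<open>At \<open>pt 0\<close> the factor \<open>tline 0\<close> contributes q and
    \<open>tline 2\<close> contributes 1, already more than v.\<close>
  have "int v = int q + 1 + fls_subdegree (evR (pt 0) F2)"
    using sd_pt[of 0] Fnz[OF on_pt, of 0] tline_own[of 0] tl2 unfolding ev by simp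
  then show False using evR_affine_ge0[of "pa 0" "pb 0" F2] v by simp
qed

lemma gaps_eq:
  "int ` gaps G KG (PR (pt 0)) =
    {u * (int q + 1) - v | u v :: int. 0 \<le> v \<and> v \<le> int q \<and> 0 < 3 * u \<and> 3 * u \<le> v}"
proof (intro equalityI subsetI)
  fix x assume "x \<in> int ` gaps G KG (PR (pt 0))"
  then obtain n where n: "x = int n" "n > 0"
    "\<not> (\<exists>f\<in>carrier G - {\<zero>\<^bsub>G\<^esub>}. pole_divisor G KG f = multiple_of_place n (PR (pt 0)))"
    by (auto simp: gaps_def)
  \<comment> \<open>This is n/(q + 1) rounded up, so v = u(q + 1) - n lies between 0 and q.\<close>
  define u where "u = (n + q) div (q + 1)"
  define v where "v = q - (n + q) mod (q + 1)"
  have m: "(n + q) mod (q + 1) \<le> q" using mod_less_divisor[of "q + 1" "n + q"] by linarith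
  have "n + q = u * (q + 1) + (n + q) mod (q + 1)"
    unfolding u_def by (rule div_mult_mod_eq[symmetric])
  then have "int n + int q = int u * (int q + 1) + int ((n + q) mod (q + 1))"
    by (metis of_nat_add of_nat_mult of_nat_1)
  moreover have "int v = int q - int ((n + q) mod (q + 1))" using m by (simp add: v_def of_nat_diff)
  ultimately have eq: "int n = int u * (int q + 1) - int v" by simp
  have u1: "u \<ge> 1" unfolding u_def using n(2) by (simp add: Suc_le_eq div_greater_zero_iff)
  have vq: "v \<le> q" by (simp add: v_def)
  have "3 * u \<le> v"
  proof (rule ccontr)
    assume "\<not> 3 * u \<le> v"
    then show False using nongap[OF u1 vq _ eq] n(3) by simp
  qed
  then show "x \<in> {u * (int q + 1) - v | u v :: int. 0 \<le> v \<and> v \<le> int q \<and> 0 < 3 * u \<and> 3 * u \<le> v}"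
    using eq n(1) u1 vq by (intro CollectI exI[of _ "int u"] exI[of _ "int v"]) auto
next
  fix x assume "x \<in> {u * (int q + 1) - v | u v :: int. 0 \<le> v \<and> v \<le> int q \<and> 0 < 3 * u \<and> 3 * u \<le> v}"
  then obtain u v :: int where x: "x = u * (int q + 1) - v" "0 \<le> v" "v \<le> int q" "0 < 3 * u" "3 * u \<le> v"
    by blast
  define u' v' where "u' = nat u" and "v' = nat v"
  have uv: "u = int u'" "v = int v'" using x by (simp_all add: u'_def v'_def)
  have u1: "u' \<ge> 1" and vq: "v' \<le> q" and le: "3 * u' \<le> v'" using x uv by auto
  have "int q + 1 \<le> int u' * (int q + 1)" using u1 mult_right_mono[of 1 "int u'" "int q + 1"] by simp
  moreover have x': "x = int u' * (int q + 1) - int v'" using x(1) unfolding uv .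
  ultimately have pos: "x > 0" using vq by linarith
  have n: "int (nat x) = int u' * (int q + 1) - int v'" using pos x' by simp
  have "nat x \<in> gaps G KG (PR (pt 0))"
    unfolding gaps_def using gap[OF u1 vq le n] pos by auto
  then show "x \<in> int ` gaps G KG (PR (pt 0))" using pos by (intro image_eqI[of _ _ "nat x"]) auto
qed

end

theorem theorem3p1:
  fixes q :: nat and H :: "'k::field poly3" and P :: "'k curve_function set"
  assumes "primepow q"
    and "CARD('k) = q ^ 2"
    and "H = hermitian_form q"
    and "place (curve_function_field H) (curve_constants H) P"
    and "has_degree (curve_function_field H) (curve_constants H) P 3"
  shows "int ` gaps (curve_function_field H) (curve_constants H) P =
    {u * (int q + 1) - v | u v :: int. 0 \<le> v \<and> v \<le> int q \<and> 0 < 3 * u \<and> 3 * u \<le> v}"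
proof -
  interpret hermitian q "TYPE('k)" by standard (fact assms)+
  have H: "H = hermitian.H q" by (simp add: assms(3) H_def)
  obtain a b where ab: "on_curve (Some (a, b))" "P = disc_val.VM (curve_function_field H) (vR (Some (a, b)))"
    "a ^ Q \<noteq> a" "a ^ (Q ^ 3) = a" "b ^ (Q ^ 3) = b"
    using degree3_point[of P] assms(4,5) unfolding H by blast
  interpret degree3_point q "TYPE('k)" a b by standard (use ab in auto)
  show ?thesis using gaps_eq ab(2) unfolding H p_0 by simp
qed

end
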